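(* Let $\beta$ be a positive $n$-braid word and $\tau\in S_{\ell(\beta)}$ an ordering of its crossings. The restriction of the 2-form $\omega_{\beta\cdot\Delta^2}$ to the toric chart $T_\tau\subseteq X_0(\beta\Delta;w_0)\subseteq X_0(\beta\cdot\Delta^2)$ has constant coefficients in the canonical (exponential) coordinates $x_1,\dots,x_{\ell(\beta)}$ associated to the $D_i$ matrices, i.e. it has the form $\sum_{s<t}C_{st}\,\frac{dx_s}{x_s}\wedge\frac{dx_t}{x_t}$ with $C_{st}\in\mathbb{C}$ constant.
   Context: All varieties are over $\mathbb{C}$. A positive $n$-braid word is a finite sequence $\beta=\sigma_{i_1}\cdots\sigma_{i_\ell}$, $\ell(\beta)=\ell$. $B_i(z)$ is the identity $n\times n$ matrix except for the block $\begin{pmatrix}0&1\\ 1&z\end{pmatrix}$ in rows and columns $i,i+1$; $B_\beta(z)=B_{i_1}(z_1)\cdots B_{i_\ell}(z_\ell)$. Permutations are viewed as permutation matrices with $s_i\mapsto B_i(0)$; $w_0\in S_n$ is the longest element; $\Delta=(\sigma_1\cdots\sigma_{n-1})(\sigma_1\cdots\sigma_{n-2})\cdots(\sigma_1\sigma_2)\sigma_1$, $\Delta^2=\Delta\Delta$. $X_0(\beta;\pi)=\{z: B_\beta(z)\pi\text{ upper-triangular}\}$, $X_0(\beta)=X_0(\beta;1)$. $X_0(\beta\Delta;w_0)$ is embedded in $X_0(\beta\Delta^2)$ by $z\mapsto(z,0,\dots,0)$. 2-form: $(f|g)=\mathrm{Tr}(f^{-1}df\wedge dg\,g^{-1})$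 for $\mathrm{GL}(n,\mathbb{C})$-valued functions $f,g$; for a word $\eta=\sigma_{i_1}\cdots\sigma_{i_r}$, $\omega_\eta=\sum_{k=2}^{r}\big(B_{i_1}(z_1)\cdots B_{i_{k-1}}(z_{k-1})\,\big|\,B_{i_k}(z_k)\big)$ on $\mathbb{C}^r$. Chart $T_\tau$: write points of $X_0(\beta\Delta;w_0)$ as $(z,c)$; $L(c):=B_\Delta(c)w_0$ is lower unitriangular, $c\mapsto L(c)$ is a bijection onto lower unitriangular matrices, and the condition is that $B_\beta(z)L(c)$ is upper-triangular. Let $\beta=\beta_1\sigma_i\beta_2$ with $\sigma_i$ in position $r$, $\beta'=\beta_1\beta_2$, $z_r\ne0$. Then $B_i(z_r)=U_iD_iL_i$, with $2\times2$ blocks (rows/columns $i,i+1$) $U_i=\begin{pmatrix}1&z_r^{-1}\\ 0&1\end{pmatrix}$, $D_i=\begin{pmatrix}-z_r^{-1}&0\\ 0&z_r\end{pmatrix}$, $L_i=\begin{pmatrix}1&0\\ z_r^{-1}&1\end{pmatrix}$. Move $U_iD_i$ to the left through $B_{\beta_1}$ one factor at a time by the unique identities $B_j(z)V=\widetilde VB_j(z')$ ($V,\widetilde V$ invertible upper-triangular), and $L_i$ to the right through $B_{\beta_2}$ by $LB_j(z)=B_j(z')\widetilde L$ (lower-triangular), obtaining variables $z'_k$ ($k\ne r$) and a lower unitriangular $L'$; define $c'$ by $L'L(c)=L(c')$. This gives an isomorphism $\{z_r\neq0\}\cong X_0(\beta'\Delta;w_0)\times\mathbb{C}^*$, $(z,c)\mapsto(z',c',z_r^{-1})$.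 $T_\tau$ is the open set of points such that, opening all crossings of $\beta$ successively in the order $\tau$, at each step $j$ the current variable $x_j$ of the crossing being opened is nonzero; $x_1,\dots,x_{\ell(\beta)}$ (the variables appearing in the successive $D_i$ matrices) are coordinates $T_\tau\cong(\mathbb{C}^* )^{\ell(\beta)}$. *)

theory Defs
  imports
    "HOL-Analysis.Complex_Analysis_Basics"
    "HOL-Combinatorics.Permutations"
    "Jordan_Normal_Form.Gauss_Jordan_Elimination"
begin

(* Everything is indexed from 0: the letter i of a braid word, with Suc i < n, is the generator
   sigma_(i+1) of the n-strand braid group, and it acts on rows and columns i, i + 1.  Points and
   tangent vectors of C^r are lists of length r. *)

section \<open>Braid matrices and braid varieties\<close>

type_synonym braid_word = "nat list"

definition is_braid_word :: "nat \<Rightarrow> braid_word \<Rightarrow> bool" where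
  "is_braid_word n \<beta> \<longleftrightarrow> (\<forall>i\<in>set \<beta>. Suc i < n)"

text \<open>The identity matrix with the block (a b; c d) put in rows and columns i, i + 1.\<close>

definition block_gen :: "nat \<Rightarrow> nat \<Rightarrow> complex \<Rightarrow> complex \<Rightarrow> complex \<Rightarrow> complex \<Rightarrow> complex mat" where
  "block_gen n i a b c d = mat n n (\<lambda>(r, s).
     if r = i \<and> s = i then a
     else if r = i \<and> s = Suc i then b
     else if r = Suc i \<and> s = i then c
     else if r = Suc i \<and> s = Suc i then d
     else if r = s then 1 else 0)"

definition braid_gen :: "nat \<Rightarrow> nat \<Rightarrow> complex \<Rightarrow> complex mat" where
  "braid_gen n i z = block_gen n i 0 1 1 z"

fun braid_mat :: "nat \<Rightarrow> braid_word \<Rightarrow> complex list \<Rightarrow> complex mat" where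
  "braid_mat n (i # \<beta>) (x # z) = braid_gen n i x * braid_mat n \<beta> z"
| "braid_mat n _ _ = 1\<^sub>m n"

text \<open>With this convention the transposition of i and i + 1 becomes \<open>braid_gen n i 0\<close>.\<close>

definition perm_mat :: "nat \<Rightarrow> (nat \<Rightarrow> nat) \<Rightarrow> complex mat" where
  "perm_mat n \<pi> = mat n n (\<lambda>(r, s). if r = \<pi> s then 1 else 0)"

definition w0 :: "nat \<Rightarrow> nat \<Rightarrow> nat" where
  "w0 n j = n - 1 - j"

definition Delta :: "nat \<Rightarrow> braid_word" where
  "Delta n = concat (map (\<lambda>k. [0..<k]) (rev [1..<n]))"

definition X0 :: "nat \<Rightarrow> braid_word \<Rightarrow> (nat \<Rightarrow> nat) \<Rightarrow> complex list set" where
  "X0 n \<beta> \<pi> = {z. length z = length \<beta> \<and> upper_triangular (braid_mat n \<beta> z * perm_mat n \<pi>)}"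

text \<open>The embedding of \<open>X0 n (\<beta> @ Delta n) (w0 n)\<close> into \<open>X0 n (\<beta> @ Delta n @ Delta n) id\<close>.\<close>

definition embed_pt :: "nat \<Rightarrow> complex list \<Rightarrow> complex list" where
  "embed_pt n p = p @ replicate (length (Delta n)) 0"

section \<open>The 2-form\<close>

text \<open>A differential 2-form is given by its values on a base point and two tangent vectors,
  with the convention that the wedge of a and b takes (u, v) to a(u) b(v) - a(v) b(u).\<close>

definition mat_trace :: "complex mat \<Rightarrow> complex" where
  "mat_trace A = (\<Sum>i<dim_row A. A $$ (i, i))"

definition mat_diff :: "nat \<Rightarrow> (complex list \<Rightarrow> complex mat) \<Rightarrow> complex list \<Rightarrow> complex list \<Rightarrow> complex mat" where
  "mat_diff n f p u =
     mat n n (\<lambda>(i, j). deriv (\<lambda>t. f (map2 (\<lambda>a b. a + t * b) p u) $$ (i, j)) 0)"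

abbreviation mat_inv :: "complex mat \<Rightarrow> complex mat" where
  "mat_inv A \<equiv> the (mat_inverse A)"

definition pair_form ::
  "nat \<Rightarrow> (complex list \<Rightarrow> complex mat) \<Rightarrow> (complex list \<Rightarrow> complex mat) \<Rightarrow>
   complex list \<Rightarrow> complex list \<Rightarrow> complex list \<Rightarrow> complex" where
  "pair_form n f g p u v =
     mat_trace (mat_inv (f p) * mat_diff n f p u * mat_diff n g p v * mat_inv (g p))
   - mat_trace (mat_inv (f p) * mat_diff n f p v * mat_diff n g p u * mat_inv (g p))"

definition braid_form ::
  "nat \<Rightarrow> braid_word \<Rightarrow> complex list \<Rightarrow> complex list \<Rightarrow> complex list \<Rightarrow> complex" where
  "braid_form n \<eta> p u v =
     (\<Sum>k\<in>{1..<length \<eta>}.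
        pair_form n (\<lambda>z. braid_mat n (take k \<eta>) (take k z)) (\<lambda>z. braid_gen n (\<eta> ! k) (z ! k)) p u v)"

section \<open>Opening crossings\<close>

definition lower_triangular :: "complex mat \<Rightarrow> bool" where
  "lower_triangular A \<longleftrightarrow> upper_triangular (transpose_mat A)"

definition U_mat :: "nat \<Rightarrow> nat \<Rightarrow> complex \<Rightarrow> complex mat" where
  "U_mat n i x = block_gen n i 1 (inverse x) 0 1"

definition D_mat :: "nat \<Rightarrow> nat \<Rightarrow> complex \<Rightarrow> complex mat" where
  "D_mat n i x = block_gen n i (- inverse x) 0 0 x"

definition L_mat :: "nat \<Rightarrow> nat \<Rightarrow> complex \<Rightarrow> complex mat" where
  "L_mat n i x = block_gen n i 1 0 (inverse x) 1"

text \<open>The unique solutions of \<open>B\<^sub>j(z) V = W B\<^sub>j(z')\<close> with W invertible upper-triangular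
  (for V such) and of \<open>L B\<^sub>j(z) = B\<^sub>j(z') M\<close> with M lower-triangular (for L invertible
  lower-triangular).\<close>

definition swap_upper :: "nat \<Rightarrow> nat \<Rightarrow> complex \<Rightarrow> complex mat \<Rightarrow> complex \<times> complex mat" where
  "swap_upper n j z V = (THE (z', W).
     W \<in> carrier_mat n n \<and> upper_triangular W \<and> invertible_mat W \<and>
     braid_gen n j z * V = W * braid_gen n j z')"

definition swap_lower :: "nat \<Rightarrow> complex mat \<Rightarrow> nat \<Rightarrow> complex \<Rightarrow> complex \<times> complex mat" where
  "swap_lower n L j z = (THE (z', M).
     M \<in> carrier_mat n n \<and> lower_triangular M \<and> invertible_mat M \<and>
     L * braid_gen n j z = braid_gen n j z' * M)"

text \<open>\<open>push_left n \<beta> z V\<close> moves V from the right end of \<open>B\<^sub>\<beta>(z)\<close> to its left end, and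
  \<open>push_right n L \<beta> z\<close> moves L from the left end to the right end.  Both return the new
  variables and the matrix that comes out.\<close>

fun push_left ::
  "nat \<Rightarrow> braid_word \<Rightarrow> complex list \<Rightarrow> complex mat \<Rightarrow> complex list \<times> complex mat" where
  "push_left n (j # \<beta>) (x # z) V =
     (let (z', W) = push_left n \<beta> z V; (x', W') = swap_upper n j x W in (x' # z', W'))"
| "push_left n _ _ V = ([], V)"

fun push_right ::
  "nat \<Rightarrow> complex mat \<Rightarrow> braid_word \<Rightarrow> complex list \<Rightarrow> complex list \<times> complex mat" where
  "push_right n L (j # \<beta>) (x # z) =
     (let (x', M) = swap_lower n L j x; (z', M') = push_right n M \<beta> z in (x' # z', M'))"
| "push_right n L _ _ = ([], L)"

definition Lc :: "nat \<Rightarrow> complex list \<Rightarrow> complex mat" where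
  "Lc n c = braid_mat n (Delta n) c * perm_mat n (w0 n)"

text \<open>Opening the crossing in position r of \<open>\<beta>\<close>, at the point (z, c).\<close>

fun open_crossing ::
  "nat \<Rightarrow> nat \<Rightarrow> braid_word \<times> complex list \<times> complex list \<Rightarrow> braid_word \<times> complex list \<times> complex list" where
  "open_crossing n r (\<beta>, z, c) =
     (let i = \<beta> ! r;
          x = z ! r;
          (z1, V) = push_left n (take r \<beta>) (take r z) (U_mat n i x * D_mat n i x);
          (z2, L') = push_right n (L_mat n i x) (drop (Suc r) \<beta>) (drop (Suc r) z);
          c' = (THE c'. length c' = length (Delta n) \<and> L' * Lc n c = Lc n c')
      in (take r \<beta> @ drop (Suc r) \<beta>, z1 @ z2, c'))"

text \<open>At step j the crossing opened is \<open>\<tau> j\<close>, in the numbering of the original word.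
  Its position among the crossings that are still closed is the following.\<close>

definition current_pos :: "(nat \<Rightarrow> nat) \<Rightarrow> nat \<Rightarrow> nat" where
  "current_pos \<tau> j = card {q. q < \<tau> j \<and> q \<notin> \<tau> ` {..<j}}"

primrec opened ::
  "nat \<Rightarrow> braid_word \<Rightarrow> (nat \<Rightarrow> nat) \<Rightarrow> complex list \<Rightarrow> nat \<Rightarrow> braid_word \<times> complex list \<times> complex list" where
  "opened n \<beta> \<tau> p 0 = (\<beta>, take (length \<beta>) p, drop (length \<beta>) p)"
| "opened n \<beta> \<tau> p (Suc j) = open_crossing n (current_pos \<tau> j) (opened n \<beta> \<tau> p j)"

definition chart_coord :: "nat \<Rightarrow> braid_word \<Rightarrow> (nat \<Rightarrow> nat) \<Rightarrow> nat \<Rightarrow> complex list \<Rightarrow> complex" where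
  "chart_coord n \<beta> \<tau> j p = fst (snd (opened n \<beta> \<tau> p j)) ! current_pos \<tau> j"

definition toric_chart :: "nat \<Rightarrow> braid_word \<Rightarrow> (nat \<Rightarrow> nat) \<Rightarrow> complex list set" where
  "toric_chart n \<beta> \<tau> =
     {p \<in> X0 n (\<beta> @ Delta n) (w0 n). \<forall>j<length \<beta>. chart_coord n \<beta> \<tau> j p \<noteq> 0}"

section \<open>Restriction of forms to a submanifold\<close>

text \<open>Tangent vectors of a complex submanifold S at p are the velocities at 0 of germs of
  holomorphic curves in S through p.  The logarithmic differential df / f of a function f on S
  is evaluated on such a vector by differentiating f along the curve, so that f need not be
  extended off S.\<close>

definition holo_curve :: "complex list set \<Rightarrow> complex list \<Rightarrow> (complex \<Rightarrow> complex list) \<Rightarrow> bool" where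
  "holo_curve S p \<gamma> \<longleftrightarrow> \<gamma> 0 = p \<and>
     (\<exists>e>0. (\<forall>t\<in>ball 0 e. \<gamma> t \<in> S \<and> length (\<gamma> t) = length p) \<and>
            (\<forall>k<length p. (\<lambda>t. \<gamma> t ! k) holomorphic_on ball 0 e))"

definition velocity :: "(complex \<Rightarrow> complex list) \<Rightarrow> complex list" where
  "velocity \<gamma> = map (\<lambda>k. deriv (\<lambda>t. \<gamma> t ! k) 0) [0..<length (\<gamma> 0)]"

definition dlog :: "(complex list \<Rightarrow> complex) \<Rightarrow> (complex \<Rightarrow> complex list) \<Rightarrow> complex" where
  "dlog f \<gamma> = deriv (\<lambda>t. f (\<gamma> t)) 0 / f (\<gamma> 0)"

end

theory Submission
  imports Defs "Jordan_Normal_Form.Determinant"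
begin

text \<open>
  The pairing satisfies the cocycle rule \<open>(f | g) + (f g | h) = (f | g h) + (g | h)\<close>
  (\<open>form_cocycle\<close>).  So every factorisation \<open>f\<^sub>1 \<cdots> f\<^sub>m\<close> of a matrix-valued function has a form,
  \<open>prod_form\<close>, and a factor f g may be split into f and g at the cost of (f | g).  The 2-form of a
  braid word is the form of its factorisation into braid generators.  Constant factors contribute
  nothing.  Two upper-triangular factors contribute only through the logarithmic differentials of
  their diagonals (\<open>form_upper_triangular\<close>), and two lower unitriangular factors contribute
  nothing (\<open>form_lower_unitriangular\<close>).

  On the chart the form is that of \<open>B\<^sub>\<beta>(z) L(c)\<close> with \<open>L(c)\<close> as one factor: the last half twist is
  constant, and the word of a half twist is reduced, so its factors become lower unitriangular
  matrices when the permutation matrices are moved to the right (\<open>Delta_factors\<close>).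

  Opening a crossing does not change the form, apart from a term on the far left.  In
  \<open>B\<^sub>i(x) = (U D) L\<close> both parts depend on x alone, so splitting costs nothing.  An exchange
  \<open>B\<^sub>j(z) V = W B\<^sub>j(z')\<close> costs nothing either: \<open>B\<^sub>j(z)\<close> is a constant permutation matrix times a
  unipotent upper-triangular matrix, and the entry of W in position (j, j + 1) is zero
  (\<open>exchange_upper\<close>).  Transposition gives the same for lower-triangular matrices.  Hence the form
  of \<open>B\<^sub>\<beta>(z) L(c)\<close> is the form of \<open>V B\<^bsub>\<beta>'\<^esub>(z') L(c')\<close> with V upper-triangular
  (\<open>open_crossing_equiv\<close>), and the diagonal entries of V are \<open>- 1 / x\<close>, x and 1 in an order that
  depends only on the word.

  On the chart the whole product \<open>B\<^sub>\<beta>(z) L(c)\<close> is upper-triangular, so after all crossings have been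
  opened it is \<open>V\<^sub>0 V\<^sub>1 \<cdots>\<close> times a matrix that is both lower unitriangular and upper-triangular,
  that is, times the identity.  Therefore the 2-form is the sum over s of
  \<open>(V\<^sub>s | V\<^bsub>s+1\<^esub> V\<^bsub>s+2\<^esub> \<cdots>)\<close> (\<open>tail_form\<close>).  All diagonals are Laurent monomials in the chart
  coordinates up to sign, with exponents fixed by \<beta> and \<tau>, so the coefficients are the constants
  \<open>chart_coefficient\<close>.
\<close>

section \<open>Matrix algebra\<close>

lemma square_mat_mult_carrier [simp]:
  "A \<in> carrier_mat n n \<Longrightarrow> B \<in> carrier_mat n n \<Longrightarrow> A * B \<in> carrier_mat n n"
  by (rule mult_carrier_mat)

lemma mat_mult_entry:
  assumes "A \<in> carrier_mat n n" "B \<in> carrier_mat n n" "r < n" "s < n"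
  shows "(A * B) $$ (r, s) = (\<Sum>k<n. A $$ (r, k) * B $$ (k, s))"
  using assms by (auto simp: scalar_prod_def atLeast0LessThan)

lemma mat_trace_mult:
  assumes "A \<in> carrier_mat n n" "B \<in> carrier_mat n n"
  shows "mat_trace (A * B) = (\<Sum>i<n. \<Sum>k<n. A $$ (i, k) * B $$ (k, i))"
  unfolding mat_trace_def using assms mat_mult_entry[OF assms] by auto

lemma mat_trace_comm:
  assumes "A \<in> carrier_mat n n" "B \<in> carrier_mat n n"
  shows "mat_trace (A * B) = mat_trace (B * A)"
  unfolding mat_trace_mult[OF assms] mat_trace_mult[OF assms(2,1)]
  by (subst sum.swap) (simp add: mult.commute)

lemma mat_trace_add:
  assumes "A \<in> carrier_mat n n" "B \<in> carrier_mat n n"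
  shows "mat_trace (A + B) = mat_trace A + mat_trace B"
  using assms by (auto simp: mat_trace_def sum.distrib)

lemma mat_trace_smult:
  assumes "A \<in> carrier_mat n n"
  shows "mat_trace (k \<cdot>\<^sub>m A) = k * mat_trace A"
  using assms by (auto simp: mat_trace_def sum_distrib_left)

lemma mat_trace_transpose:
  assumes "A \<in> carrier_mat n n"
  shows "mat_trace (transpose_mat A) = mat_trace A"
  using assms by (auto simp: mat_trace_def)

lemma mat_inv_unique:
  assumes A: "A \<in> carrier_mat n n" and B: "B \<in> carrier_mat n n"
    and AB: "A * B = 1\<^sub>m n" and BA: "B * A = 1\<^sub>m n"
  shows "mat_inv A = B"
proof (cases "mat_inverse A")
  case None
  have "A \<in> Units (ring_mat TYPE(complex) n ())"
    using assms by (auto simp: Units_def ring_mat_def)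
  with mat_inverse(1)[OF A None, where b = "()"] show ?thesis by auto
next
  case (Some C)
  from mat_inverse(2)[OF A Some] have C: "A * C = 1\<^sub>m n" "C * A = 1\<^sub>m n" "C \<in> carrier_mat n n"
    by auto
  have "C = C * (A * B)" using C AB by auto
  also have "\<dots> = (C * A) * B" using A B C by (subst assoc_mult_mat[of _ n n _ n _ n]) auto
  also have "\<dots> = B" using C B by auto
  finally show ?thesis using Some by simp
qed

text \<open>Invertibility with the size n made explicit, so that it can serve as a simplifier premise
  and provides the carrier facts.\<close>

definition unit_mat :: "nat \<Rightarrow> complex mat \<Rightarrow> bool" where
  "unit_mat n A \<longleftrightarrow> A \<in> carrier_mat n n \<and>
     (\<exists>B\<in>carrier_mat n n. A * B = 1\<^sub>m n \<and> B * A = 1\<^sub>m n)"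

lemma unit_matI:
  assumes "A \<in> carrier_mat n n" "B \<in> carrier_mat n n" "A * B = 1\<^sub>m n" "B * A = 1\<^sub>m n"
  shows "unit_mat n A"
  using assms unfolding unit_mat_def by blast

lemma unit_matD:
  assumes "unit_mat n A"
  shows "A \<in> carrier_mat n n" "mat_inv A \<in> carrier_mat n n"
    "A * mat_inv A = 1\<^sub>m n" "mat_inv A * A = 1\<^sub>m n"
  using assms mat_inv_unique[of A n] unfolding unit_mat_def by auto

lemma unit_mat_iff_invertible:
  "unit_mat n A \<longleftrightarrow> A \<in> carrier_mat n n \<and> invertible_mat A"
proof
  assume u: "unit_mat n A"
  note unit_matD[OF u]
  then show "A \<in> carrier_mat n n \<and> invertible_mat A"
    unfolding invertible_mat_def inverts_mat_def by (auto intro!: exI[of _ "mat_inv A"])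
next
  assume a: "A \<in> carrier_mat n n \<and> invertible_mat A"
  then obtain B where B: "A * B = 1\<^sub>m (dim_row A)" "B * A = 1\<^sub>m (dim_row B)"
    unfolding invertible_mat_def inverts_mat_def by auto
  have "dim_col (A * B) = n" using B a by auto
  moreover have "dim_col (B * A) = dim_row B" using B by simp
  ultimately have "B \<in> carrier_mat n n" using a by auto
  with B a show "unit_mat n A" by (auto intro: unit_matI)
qed

lemma unit_mat_one [simp]: "unit_mat n (1\<^sub>m n)"
  by (rule unit_matI[of _ _ "1\<^sub>m n"]) auto

lemma unit_mat_mult_aux:
  assumes "unit_mat n A" "unit_mat n B"
  shows "A * B * (mat_inv B * mat_inv A) = 1\<^sub>m n" "mat_inv B * mat_inv A * (A * B) = 1\<^sub>m n"
proof -
  note a = unit_matD[OF assms(1)] and b = unit_matD[OF assms(2)]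
  have "A * B * (mat_inv B * mat_inv A) = A * (B * mat_inv B) * mat_inv A"
    using a(1,2) b(1,2) by (simp add: assoc_mult_mat[of _ n n _ n _ n])
  then show "A * B * (mat_inv B * mat_inv A) = 1\<^sub>m n" using a b by simp
  have "mat_inv B * mat_inv A * (A * B) = mat_inv B * (mat_inv A * A) * B"
    using a(1,2) b(1,2) by (simp add: assoc_mult_mat[of _ n n _ n _ n])
  then show "mat_inv B * mat_inv A * (A * B) = 1\<^sub>m n" using a b by simp
qed

lemma unit_mat_mult [simp]:
  assumes "unit_mat n A" "unit_mat n B"
  shows "unit_mat n (A * B)"
  by (rule unit_matI[OF _ _ unit_mat_mult_aux[OF assms]]) (use assms unit_matD in auto)

lemma mat_inv_mult:
  assumes "unit_mat n A" "unit_mat n B"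
  shows "mat_inv (A * B) = mat_inv B * mat_inv A"
  by (rule mat_inv_unique[OF _ _ unit_mat_mult_aux[OF assms]]) (use assms unit_matD in auto)

lemma
  assumes "unit_mat n A"
  shows unit_mat_transpose [simp]: "unit_mat n (transpose_mat A)"
    and mat_inv_transpose: "mat_inv (transpose_mat A) = transpose_mat (mat_inv A)"
proof -
  note a = unit_matD[OF assms]
  have 1: "transpose_mat A * transpose_mat (mat_inv A) = 1\<^sub>m n"
    by (subst transpose_mult[symmetric, of _ n n _ n]) (use a in auto)
  have 2: "transpose_mat (mat_inv A) * transpose_mat A = 1\<^sub>m n"
    by (subst transpose_mult[symmetric, of _ n n _ n]) (use a in auto)
  show "unit_mat n (transpose_mat A)"
    by (rule unit_matI[OF _ _ 1 2]) (use a in auto)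
  show "mat_inv (transpose_mat A) = transpose_mat (mat_inv A)"
    by (rule mat_inv_unique[OF _ _ 1 2]) (use a in auto)
qed

lemma unit_mat_cancel_left:
  assumes "unit_mat n A" "B \<in> carrier_mat n n" "C \<in> carrier_mat n n"
  shows "A * B = C \<longleftrightarrow> B = mat_inv A * C"
proof -
  note a = unit_matD[OF assms(1)]
  have "mat_inv A * (A * B) = (mat_inv A * A) * B" "A * (mat_inv A * C) = (A * mat_inv A) * C"
    using a(1,2) assms by (simp_all add: assoc_mult_mat[of _ n n _ n _ n])
  then show ?thesis using a assms by auto
qed

subsection \<open>Triangular matrices\<close>

lemma upper_triangular_mult:
  assumes "upper_triangular A" "upper_triangular B" "A \<in> carrier_mat n n" "B \<in> carrier_mat n n"
  shows "upper_triangular (A * B)"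
proof (rule upper_triangularI)
  fix i j assume ij: "j < i" "i < dim_row (A * B)"
  have "A $$ (i, k) * B $$ (k, j) = 0" if "k < n" for k
    using that ij assms upper_triangularD[of A k i] upper_triangularD[of B j k]
    by (cases "k < i") auto
  then show "(A * B) $$ (i, j) = 0"
    using mat_mult_entry[OF assms(3,4)] ij assms by (auto intro!: sum.neutral)
qed

lemma upper_triangular_mult_diag:
  assumes "upper_triangular A" "upper_triangular B" "A \<in> carrier_mat n n" "B \<in> carrier_mat n n"
    and "i < n"
  shows "(A * B) $$ (i, i) = A $$ (i, i) * B $$ (i, i)"
proof -
  have "(A * B) $$ (i, i) = (\<Sum>k<n. if k = i then A $$ (i, i) * B $$ (i, i) else 0)"
    unfolding mat_mult_entry[OF assms(3,4,5,5)]
  proof (rule sum.cong[OF refl])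
    fix k assume "k \<in> {..<n}"
    then show "A $$ (i, k) * B $$ (k, i) = (if k = i then A $$ (i, i) * B $$ (i, i) else 0)"
      using assms upper_triangularD[of A k i] upper_triangularD[of B i k]
      by (cases k i rule: linorder_cases) auto
  qed
  then show ?thesis using assms by simp
qed

lemma upper_triangular_inv:
  assumes A: "upper_triangular A" and u: "unit_mat n A"
  shows "upper_triangular (mat_inv A)"
    and "\<And>i. i < n \<Longrightarrow> A $$ (i, i) \<noteq> 0"
    and "\<And>i. i < n \<Longrightarrow> mat_inv A $$ (i, i) = inverse (A $$ (i, i))"
proof -
  note a = unit_matD[OF u]
  let ?B = "mat_inv A"
  have "det A * det ?B = 1" using det_mult[OF a(1,2)] a(3) by simp
  then have "det A \<noteq> 0" by auto
  then have nz: "A $$ (i, i) \<noteq> 0" if "i < n" for i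
    using det_upper_triangular[OF A a(1)] that a(1) by (auto simp: diag_mat_def)
  then show "\<And>i. i < n \<Longrightarrow> A $$ (i, i) \<noteq> 0" .
  \<comment> \<open>Row i of the equation mat_inv A * A = 1 is solved column by column from the left.\<close>
  have *: "?B $$ (i, j) = 0" if "j < i" "i < n" for i j
    using that
  proof (induction j rule: less_induct)
    case (less j)
    have "0 = (?B * A) $$ (i, j)" using less a by simp
    also have "\<dots> = (\<Sum>k<n. if k = j then ?B $$ (i, j) * A $$ (j, j) else 0)"
      unfolding mat_mult_entry[OF a(2,1) less(3) less.prems(1)[THEN less_trans, OF less(3)]]
    proof (rule sum.cong[OF refl])
      fix k assume "k \<in> {..<n}"
      then show "?B $$ (i, k) * A $$ (k, j) = (if k = j then ?B $$ (i, j) * A $$ (j, j) else 0)"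
        using less a upper_triangularD[OF A, of j k] by (cases k j rule: linorder_cases) auto
    qed
    also have "\<dots> = ?B $$ (i, j) * A $$ (j, j)" using less by simp
    finally show ?case using nz[of j] less by auto
  qed
  show B: "upper_triangular ?B" using * a by (intro upper_triangularI) auto
  show "?B $$ (i, i) = inverse (A $$ (i, i))" if "i < n" for i
    using upper_triangular_mult_diag[OF B A a(2,1) that] a(4) that nz[OF that]
    by (auto simp: field_simps)
qed

lemma mat_trace_upper_mult:
  assumes "upper_triangular A" "upper_triangular B" "A \<in> carrier_mat n n" "B \<in> carrier_mat n n"
  shows "mat_trace (A * B) = (\<Sum>i<n. A $$ (i, i) * B $$ (i, i))"
  unfolding mat_trace_def using assms(3,4)
  by (auto intro!: sum.cong upper_triangular_mult_diag[OF assms] simp del: index_mult_mat(1))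

definition lower_unitriangular :: "complex mat \<Rightarrow> bool" where
  "lower_unitriangular A \<longleftrightarrow> lower_triangular A \<and> (\<forall>i<dim_row A. A $$ (i, i) = 1)"

lemma lower_unitriangular_one [simp]: "lower_unitriangular (1\<^sub>m n)"
  by (auto simp: lower_unitriangular_def lower_triangular_def upper_triangular_def)

lemma lower_unitriangular_mult:
  assumes "lower_unitriangular A" "lower_unitriangular B"
    "A \<in> carrier_mat n n" "B \<in> carrier_mat n n"
  shows "lower_unitriangular (A * B)"
proof -
  have t: "transpose_mat (A * B) = transpose_mat B * transpose_mat A"
    using assms by (simp add: transpose_mult[of _ n n _ n])
  have u: "upper_triangular (transpose_mat A)" "upper_triangular (transpose_mat B)"
    using assms by (auto simp: lower_unitriangular_def lower_triangular_def)
  have "(A * B) $$ (i, i) = 1" if "i < n" for i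
  proof -
    have "(A * B) $$ (i, i) = transpose_mat (A * B) $$ (i, i)" using assms that by simp
    then show ?thesis
      using assms that upper_triangular_mult_diag[OF u(2,1), of n i]
      by (simp add: t lower_unitriangular_def del: index_mult_mat)
  qed
  then show ?thesis
    using t upper_triangular_mult[OF u(2,1)] assms
    by (auto simp: lower_unitriangular_def lower_triangular_def)
qed

lemma upper_and_lower_unitriangular:
  assumes "lower_unitriangular A" "upper_triangular A" "A \<in> carrier_mat n n"
  shows "A = 1\<^sub>m n"
proof (rule eq_matI)
  fix i j assume "i < dim_row (1\<^sub>m n)" "j < dim_col (1\<^sub>m n)"
  then show "A $$ (i, j) = 1\<^sub>m n $$ (i, j)"
    using assms upper_triangularD[of A j i] upper_triangularD[of "transpose_mat A" i j]
    by (cases i j rule: linorder_cases) (auto simp: lower_unitriangular_def lower_triangular_def)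
qed (use assms in auto)

subsection \<open>Braid matrices\<close>

lemma block_gen_carrier [simp]: "block_gen n i a b c d \<in> carrier_mat n n"
  by (simp add: block_gen_def)

lemma braid_gen_carrier [simp]: "braid_gen n i z \<in> carrier_mat n n"
  by (simp add: braid_gen_def)

lemma braid_mat_carrier [simp]: "braid_mat n \<beta> z \<in> carrier_mat n n"
  by (induction n \<beta> z rule: braid_mat.induct) auto

lemma perm_mat_carrier [simp]: "perm_mat n \<pi> \<in> carrier_mat n n"
  by (simp add: perm_mat_def)

lemma block_gen_mult_left:
  assumes "Suc i < n" "A \<in> carrier_mat n n" "r < n" "s < n"
  shows "(block_gen n i a b c d * A) $$ (r, s) =
    (if r = i then a * A $$ (i, s) + b * A $$ (Suc i, s)
     else if r = Suc i then c * A $$ (i, s) + d * A $$ (Suc i, s) else A $$ (r, s))"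
proof -
  have "(block_gen n i a b c d * A) $$ (r, s) = (\<Sum>k<n. block_gen n i a b c d $$ (r, k) * A $$ (k, s))"
    using assms by (intro mat_mult_entry) auto
  also have "\<dots> = (\<Sum>k<n. if r = i then (if k = i then a * A $$ (i, s) else 0) +
        (if k = Suc i then b * A $$ (Suc i, s) else 0)
      else if r = Suc i then (if k = i then c * A $$ (i, s) else 0) +
        (if k = Suc i then d * A $$ (Suc i, s) else 0)
      else if k = r then A $$ (r, s) else 0)"
    using assms by (intro sum.cong) (auto simp: block_gen_def)
  also have "\<dots> = (if r = i then a * A $$ (i, s) + b * A $$ (Suc i, s)
     else if r = Suc i then c * A $$ (i, s) + d * A $$ (Suc i, s) else A $$ (r, s))"
    using assms by (auto simp: sum.distrib)
  finally show ?thesis .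
qed

lemma transpose_block_gen: "transpose_mat (block_gen n i a b c d) = block_gen n i a c b d"
  by (rule eq_matI) (auto simp: block_gen_def)

lemma transpose_braid_gen [simp]: "transpose_mat (braid_gen n i z) = braid_gen n i z"
  by (simp add: braid_gen_def transpose_block_gen)

lemma block_gen_mult_right:
  assumes "Suc i < n" "A \<in> carrier_mat n n" "r < n" "s < n"
  shows "(A * block_gen n i a b c d) $$ (r, s) =
    (if s = i then a * A $$ (r, i) + c * A $$ (r, Suc i)
     else if s = Suc i then b * A $$ (r, i) + d * A $$ (r, Suc i) else A $$ (r, s))"
proof -
  have "(A * block_gen n i a b c d) $$ (r, s) = transpose_mat (A * block_gen n i a b c d) $$ (s, r)"
    using assms by (subst index_transpose_mat(1)) (auto simp: block_gen_def)
  also have "\<dots> = (block_gen n i a c b d * transpose_mat A) $$ (s, r)"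
    using assms by (simp add: transpose_mult[of _ n n _ n] transpose_block_gen del: index_mult_mat)
  finally show ?thesis
    using assms block_gen_mult_left[of i n "transpose_mat A" s r a c b d] by simp
qed

lemma block_gen_mult:
  assumes "Suc i < n"
  shows "block_gen n i a b c d * block_gen n i a' b' c' d' =
    block_gen n i (a * a' + b * c') (a * b' + b * d') (c * a' + d * c') (c * b' + d * d')"
proof (rule eq_matI)
  fix r s assume "r < dim_row (block_gen n i (a * a' + b * c') (a * b' + b * d') (c * a' + d * c') (c * b' + d * d'))"
    "s < dim_col (block_gen n i (a * a' + b * c') (a * b' + b * d') (c * a' + d * c') (c * b' + d * d'))"
  then have rs: "r < n" "s < n" by (auto simp: block_gen_def)
  show "(block_gen n i a b c d * block_gen n i a' b' c' d') $$ (r, s) =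
    block_gen n i (a * a' + b * c') (a * b' + b * d') (c * a' + d * c') (c * b' + d * d') $$ (r, s)"
    unfolding block_gen_mult_left[OF assms block_gen_carrier rs]
    using assms rs by (auto simp: block_gen_def)
qed (auto simp: block_gen_def)

lemma block_gen_one: "block_gen n i 1 0 0 1 = 1\<^sub>m n"
proof (rule eq_matI)
  fix r s assume "r < dim_row (1\<^sub>m n)" "s < dim_col (1\<^sub>m n)"
  then have "r < n" "s < n" by auto
  then show "block_gen n i 1 0 0 1 $$ (r, s) = 1\<^sub>m n $$ (r, s)"
    by (cases "r = s") (simp_all add: block_gen_def)
qed (auto simp: block_gen_def)

definition braid_inv :: "nat \<Rightarrow> nat \<Rightarrow> complex \<Rightarrow> complex mat" where
  "braid_inv n i z = block_gen n i (- z) 1 1 0"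

lemma braid_inv_carrier [simp]: "braid_inv n i z \<in> carrier_mat n n"
  by (simp add: braid_inv_def)

lemma braid_inv:
  assumes "Suc i < n"
  shows "braid_gen n i z * braid_inv n i z = 1\<^sub>m n" "braid_inv n i z * braid_gen n i z = 1\<^sub>m n"
  using assms by (simp_all add: braid_gen_def braid_inv_def block_gen_mult block_gen_one)

lemma unit_braid_gen [simp]: "Suc i < n \<Longrightarrow> unit_mat n (braid_gen n i z)"
  by (rule unit_matI[of _ _ "braid_inv n i z"]) (auto simp: braid_inv)

lemma unit_braid_inv [simp]: "Suc i < n \<Longrightarrow> unit_mat n (braid_inv n i z)"
  by (rule unit_matI[of _ _ "braid_gen n i z"]) (auto simp: braid_inv)

lemma braid_gen_UDL:
  assumes "Suc i < n" "x \<noteq> 0"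
  shows "braid_gen n i x = U_mat n i x * D_mat n i x * L_mat n i x"
  using assms by (simp add: braid_gen_def U_mat_def D_mat_def L_mat_def block_gen_mult)

subsection \<open>Exchanging a triangular matrix and a braid generator\<close>

text \<open>The solution of \<open>B\<^sub>j(z) V = W B\<^sub>j(z')\<close>.  Multiplication by \<open>B\<^sub>j(z)\<close> on the left exchanges rows
  j and j + 1 up to a multiple of row j + 1, and multiplication by the inverse of \<open>B\<^sub>j(z')\<close> on the
  right exchanges columns j and j + 1 up to a multiple of column j.  The variable z' is chosen so that the only entry below the
  diagonal that could survive, in position (j + 1, j), cancels.  The entry of W in position
  (j, j + 1) vanishes because it comes from below the diagonal of V.\<close>

definition exch_var :: "nat \<Rightarrow> complex \<Rightarrow> complex mat \<Rightarrow> complex" where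
  "exch_var j z V = (V $$ (j, Suc j) + z * V $$ (Suc j, Suc j)) / V $$ (j, j)"

definition exch_mat :: "nat \<Rightarrow> nat \<Rightarrow> complex \<Rightarrow> complex mat \<Rightarrow> complex mat" where
  "exch_mat n j z V = braid_gen n j z * V * braid_inv n j (exch_var j z V)"

lemma exch_mat:
  assumes j: "Suc j < n" and V: "unit_mat n V" "upper_triangular V"
  shows "unit_mat n (exch_mat n j z V)"
    and "upper_triangular (exch_mat n j z V)"
    and "exch_mat n j z V $$ (j, Suc j) = 0"
    and "\<And>k. k < n \<Longrightarrow> exch_mat n j z V $$ (k, k) = V $$ (Transposition.transpose j (Suc j) k, Transposition.transpose j (Suc j) k)"
    and "braid_gen n j z * V = exch_mat n j z V * braid_gen n j (exch_var j z V)"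
proof -
  let ?W = "exch_mat n j z V" and ?z = "exch_var j z V"
  note v = unit_matD(1)[OF V(1)]
  show "unit_mat n ?W" using V j by (simp add: exch_mat_def)
  have nz: "V $$ (j, j) \<noteq> 0" using upper_triangular_inv(2)[OF V(2,1), of j] j by simp
  have entry: "?W $$ (r, s) =
    (if s = j then - ?z * (braid_gen n j z * V) $$ (r, j) + (braid_gen n j z * V) $$ (r, Suc j)
     else if s = Suc j then (braid_gen n j z * V) $$ (r, j) else (braid_gen n j z * V) $$ (r, s))"
    if "r < n" "s < n" for r s
    unfolding exch_mat_def braid_inv_def
    by (subst block_gen_mult_right) (use that j v in auto)
  have BV: "(braid_gen n j z * V) $$ (r, s) =
    (if r = j then V $$ (Suc j, s) else if r = Suc j then V $$ (j, s) + z * V $$ (Suc j, s)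
     else V $$ (r, s))" if "r < n" "s < n" for r s
    unfolding braid_gen_def
    by (subst block_gen_mult_left) (use that j v in auto)
  have low: "V $$ (r, s) = 0" if "s < r" "r < n" for r s
    using upper_triangularD[OF V(2)] that v by auto
  show "?W $$ (j, Suc j) = 0" using j low by (simp add: entry BV del: index_mult_mat)
  show "?W $$ (k, k) = V $$ (Transposition.transpose j (Suc j) k, Transposition.transpose j (Suc j) k)" if "k < n" for k
    using that j low by (auto simp: entry BV Transposition.transpose_def simp del: index_mult_mat)
  show "upper_triangular ?W"
  proof (rule upper_triangularI)
    fix r s assume "s < r" "r < dim_row ?W"
    moreover have "dim_row ?W = n" using v by (simp add: exch_mat_def braid_gen_def block_gen_def)
    ultimately show "?W $$ (r, s) = 0"
      using j low nz by (auto simp: entry BV exch_var_def simp del: index_mult_mat)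
  qed
  have "?W * braid_gen n j ?z = braid_gen n j z * V * (braid_inv n j ?z * braid_gen n j ?z)"
    unfolding exch_mat_def using v by (subst assoc_mult_mat[of _ n n _ n _ n]) auto
  then show "braid_gen n j z * V = ?W * braid_gen n j ?z"
    using j v by (simp add: braid_inv)
qed

text \<open>The quotient of two solutions is the upper-triangular matrix
  \<open>B\<^sub>j(z\<^sub>1) B\<^sub>j(z\<^sub>2)\<^bsup>-1\<^esup>\<close>, whose entry below the diagonal is the difference of the variables.\<close>

lemma exch_unique:
  assumes j: "Suc j < n" and V: "unit_mat n V" "upper_triangular V"
    and W: "W \<in> carrier_mat n n" "invertible_mat W" "upper_triangular W"
    and eq: "braid_gen n j z * V = W * braid_gen n j z'"
  shows "z' = exch_var j z V \<and> W = exch_mat n j z V"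
proof -
  note e = exch_mat[OF j V, where z = z] and v = unit_matD(1)[OF V(1)]
  let ?W = "exch_mat n j z V" and ?z = "exch_var j z V"
  note w = unit_matD(1,2)[OF e(1)]
  have eq: "?W * braid_gen n j ?z = W * braid_gen n j z'" using eq e(5) by simp
  have "braid_gen n j ?z = mat_inv ?W * (W * braid_gen n j z')"
    using eq unit_mat_cancel_left[OF e(1) braid_gen_carrier, of "W * braid_gen n j z'"] W by auto
  then have "braid_gen n j ?z * braid_inv n j z' = mat_inv ?W * (W * braid_gen n j z') * braid_inv n j z'"
    by simp
  also have "\<dots> = mat_inv ?W * W * (braid_gen n j z' * braid_inv n j z')"
    using w W by (simp add: assoc_mult_mat[of _ n n _ n _ n])
  also have "\<dots> = mat_inv ?W * W"
    using w W j by (simp add: braid_inv)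
  finally have q: "upper_triangular (braid_gen n j ?z * braid_inv n j z')"
    using upper_triangular_mult[OF upper_triangular_inv(1)[OF e(2,1)] W(3) w(2) W(1)]
    by simp
  have "(braid_gen n j ?z * braid_inv n j z') $$ (Suc j, j) = 0"
    by (rule upper_triangularD[OF q]) (use j in \<open>auto simp: braid_gen_def block_gen_def\<close>)
  then have z: "z' = ?z"
    using j by (simp add: braid_gen_def braid_inv_def block_gen_mult) (simp add: block_gen_def)
  have "W = W * braid_gen n j ?z * braid_inv n j ?z"
    using W j by (simp add: braid_inv assoc_mult_mat[of _ n n _ n _ n])
  also have "\<dots> = ?W * braid_gen n j ?z * braid_inv n j ?z"
    using eq z by simp
  also have "\<dots> = ?W" using w j by (simp add: braid_inv assoc_mult_mat[of _ n n _ n _ n])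
  finally show ?thesis using z by simp
qed

lemma swap_upper_eq:
  assumes j: "Suc j < n" and V: "unit_mat n V" "upper_triangular V"
  shows "swap_upper n j z V = (exch_var j z V, exch_mat n j z V)"
  unfolding swap_upper_def
proof (rule the_equality, goal_cases)
  case 1
  show ?case
    using exch_mat(1,2,5)[OF assms, where z = z] by (simp add: unit_mat_iff_invertible)
next
  case (2 y)
  then show ?case
    using exch_unique[OF assms, of "snd y" z "fst y"] by (cases y) simp
qed

text \<open>A braid generator is symmetric, so the lower-triangular exchange is the transpose of the
  upper-triangular one.\<close>

lemma swap_lower_eq:
  assumes j: "Suc j < n" and L: "unit_mat n L" "lower_triangular L"
  shows "swap_lower n L j z =
    (exch_var j z (transpose_mat L), transpose_mat (exch_mat n j z (transpose_mat L)))"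
proof -
  have V: "unit_mat n (transpose_mat L)" "upper_triangular (transpose_mat L)"
    using L by (auto simp: lower_triangular_def)
  have l: "L \<in> carrier_mat n n" using L unit_matD by auto
  let ?z = "exch_var j z (transpose_mat L)" and ?W = "exch_mat n j z (transpose_mat L)"
  note e = exch_mat[OF j V, where z = z] and w = unit_matD(1)[OF exch_mat(1)[OF j V, where z = z]]
  have "transpose_mat (braid_gen n j z * transpose_mat L) = transpose_mat (?W * braid_gen n j ?z)"
    using e(5) by simp
  then have ex: "L * braid_gen n j z = braid_gen n j ?z * transpose_mat ?W"
    using l w by (simp add: transpose_mult[of _ n n _ n])
  show ?thesis
    unfolding swap_lower_def
  proof (rule the_equality, goal_cases)
    case 1
    then show ?case
      using e(2) ex unit_mat_transpose[OF e(1)] by (auto simp: unit_mat_iff_invertible lower_triangular_def)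
  next
    case (2 y)
    then obtain z' M where y: "y = (z', M)" and M: "M \<in> carrier_mat n n" "lower_triangular M"
      "invertible_mat M" and eq: "L * braid_gen n j z = braid_gen n j z' * M"
      by (cases y) auto
    have "transpose_mat (L * braid_gen n j z) = transpose_mat (braid_gen n j z' * M)"
      using eq by simp
    then have "braid_gen n j z * transpose_mat L = transpose_mat M * braid_gen n j z'"
      using l M by (simp add: transpose_mult[of _ n n _ n])
    moreover have "invertible_mat (transpose_mat M)"
      using M unit_mat_transpose[of n M] by (simp add: unit_mat_iff_invertible)
    ultimately have "z' = ?z \<and> transpose_mat M = ?W"
      using exch_unique[OF j V, of "transpose_mat M"] M by (simp add: lower_triangular_def)
    then show ?case using y transpose_transpose[of M] by simp
  qed
qed

section \<open>The pairing of matrix-valued functions along two curves\<close>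

text \<open>The value of a 2-form at p on two tangent vectors involves only derivatives at 0 along one
  curve for each vector.  All matrix-valued functions below are therefore functions on the space in
  which the curves run, differentiated along the two curves.  They matter only on the set S, which
  contains both curves near 0: an identity that holds on S may be differentiated.\<close>

locale curve_pair =
  fixes n :: nat and S :: "'p set" and \<gamma> \<delta> :: "complex \<Rightarrow> 'p" and p :: 'p
  assumes base: "\<And>c. c \<in> {\<gamma>, \<delta>} \<Longrightarrow> c 0 = p" and p_in: "p \<in> S"
    and near: "\<And>c. c \<in> {\<gamma>, \<delta>} \<Longrightarrow> \<forall>\<^sub>F t in nhds 0. c t \<in> S"
begin

definition smooth :: "('p \<Rightarrow> complex) \<Rightarrow> bool" where
  "smooth f \<longleftrightarrow> (\<forall>c\<in>{\<gamma>, \<delta>}. (\<lambda>t. f (c t)) field_differentiable at 0)"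

definition regular :: "('p \<Rightarrow> complex mat) \<Rightarrow> bool" where
  "regular F \<longleftrightarrow> (\<forall>q\<in>S. unit_mat n (F q)) \<and> (\<forall>i<n. \<forall>j<n. smooth (\<lambda>q. F q $$ (i, j)))"

definition dmat :: "(complex \<Rightarrow> 'p) \<Rightarrow> ('p \<Rightarrow> complex mat) \<Rightarrow> complex mat" where
  "dmat c F = mat n n (\<lambda>(i, j). deriv (\<lambda>t. F (c t) $$ (i, j)) 0)"

text \<open>One of the two terms of the wedge product, without antisymmetrisation.\<close>

definition half_form ::
  "(complex \<Rightarrow> 'p) \<Rightarrow> (complex \<Rightarrow> 'p) \<Rightarrow> ('p \<Rightarrow> complex mat) \<Rightarrow> ('p \<Rightarrow> complex mat) \<Rightarrow> complex" where
  "half_form c d F G = mat_trace (mat_inv (F p) * dmat c F * dmat d G * mat_inv (G p))"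

definition form :: "('p \<Rightarrow> complex mat) \<Rightarrow> ('p \<Rightarrow> complex mat) \<Rightarrow> complex" where
  "form F G = half_form \<gamma> \<delta> F G - half_form \<delta> \<gamma> F G"

definition log_deriv :: "(complex \<Rightarrow> 'p) \<Rightarrow> ('p \<Rightarrow> complex) \<Rightarrow> complex" where
  "log_deriv c f = deriv (\<lambda>t. f (c t)) 0 / f p"

subsection \<open>Smooth functions\<close>

lemma along_cong:
  assumes c: "c \<in> {\<gamma>, \<delta>}" and eq: "\<And>q. q \<in> S \<Longrightarrow> f q = g q"
  shows "(\<lambda>t. f (c t)) field_differentiable at 0 \<longleftrightarrow> (\<lambda>t. g (c t)) field_differentiable at 0"
    and "deriv (\<lambda>t. f (c t)) 0 = deriv (\<lambda>t. g (c t)) 0"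
proof -
  have ev: "\<forall>\<^sub>F t in nhds 0. f (c t) = g (c t)"
    using near[OF c] by eventually_elim (simp add: eq)
  show "deriv (\<lambda>t. f (c t)) 0 = deriv (\<lambda>t. g (c t)) 0"
    by (rule deriv_cong_ev[OF ev refl])
  show "(\<lambda>t. f (c t)) field_differentiable at 0 \<longleftrightarrow> (\<lambda>t. g (c t)) field_differentiable at 0"
    using DERIV_cong_ev[OF refl ev refl] by (simp add: field_differentiable_def)
qed

lemma smooth_cong:
  assumes "\<And>q. q \<in> S \<Longrightarrow> f q = g q"
  shows "smooth f \<longleftrightarrow> smooth g"
  using along_cong(1)[of _ f g] assms by (auto simp: smooth_def)

lemma smooth_const [simp]: "smooth (\<lambda>_. a)"
  by (simp add: smooth_def)

lemma smooth_add: "smooth f \<Longrightarrow> smooth g \<Longrightarrow> smooth (\<lambda>q. f q + g q)"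
  by (auto simp: smooth_def intro: field_differentiable_add)

lemma smooth_minus: "smooth f \<Longrightarrow> smooth (\<lambda>q. - f q)"
  by (auto simp: smooth_def intro: field_differentiable_minus)

lemma smooth_mult: "smooth f \<Longrightarrow> smooth g \<Longrightarrow> smooth (\<lambda>q. f q * g q)"
  by (auto simp: smooth_def intro: field_differentiable_mult)

lemma smooth_divide: "smooth f \<Longrightarrow> smooth g \<Longrightarrow> g p \<noteq> 0 \<Longrightarrow> smooth (\<lambda>q. f q / g q)"
  using base by (auto simp: smooth_def intro!: field_differentiable_divide)

lemma smooth_sum: "(\<And>k. k \<in> K \<Longrightarrow> smooth (f k)) \<Longrightarrow> smooth (\<lambda>q. \<Sum>k\<in>K. f k q)"
  by (induction K rule: infinite_finite_induct) (auto intro: smooth_add)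

lemma smooth_if: "(P \<Longrightarrow> smooth f) \<Longrightarrow> (\<not> P \<Longrightarrow> smooth g) \<Longrightarrow> smooth (\<lambda>q. if P then f q else g q)"
  by (cases P) auto

lemma smooth_has_deriv:
  assumes "smooth f" "c \<in> {\<gamma>, \<delta>}"
  shows "((\<lambda>t. f (c t)) has_field_derivative deriv (\<lambda>t. f (c t)) 0) (at 0)"
  using assms by (auto simp: smooth_def field_differentiable_derivI)

subsection \<open>Regular matrix functions\<close>

lemma dmat_carrier [simp]: "dmat c F \<in> carrier_mat n n"
  by (simp add: dmat_def)

lemma regularD:
  assumes "regular F"
  shows "q \<in> S \<Longrightarrow> unit_mat n (F q)" "q \<in> S \<Longrightarrow> F q \<in> carrier_mat n n"
    and "i < n \<Longrightarrow> j < n \<Longrightarrow> smooth (\<lambda>q. F q $$ (i, j))"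
  using assms unit_matD(1) by (auto simp: regular_def)

lemma regular_cong:
  assumes "\<And>q. q \<in> S \<Longrightarrow> F q = G q"
  shows "regular F \<longleftrightarrow> regular G"
  using assms smooth_cong[of "\<lambda>q. F q $$ _" "\<lambda>q. G q $$ _"] by (auto simp: regular_def)

lemma regular_const: "unit_mat n K \<Longrightarrow> regular (\<lambda>_. K)"
  by (simp add: regular_def)

lemma dmat_const [simp]: "dmat c (\<lambda>_. K) = 0\<^sub>m n n"
  by (rule eq_matI) (auto simp: dmat_def)

lemma regular_block_gen:
  assumes "\<And>q. q \<in> S \<Longrightarrow> unit_mat n (block_gen n i (a q) (b q) (c q) (d q))"
    and "smooth a" "smooth b" "smooth c" "smooth d"
  shows "regular (\<lambda>q. block_gen n i (a q) (b q) (c q) (d q))"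
  unfolding regular_def using assms(1) by (auto simp: block_gen_def intro!: smooth_if assms(2-))

lemma regular_braid_gen: "Suc i < n \<Longrightarrow> smooth x \<Longrightarrow> regular (\<lambda>q. braid_gen n i (x q))"
  using regular_block_gen[of i "\<lambda>_. 0" "\<lambda>_. 1" "\<lambda>_. 1" x] unit_braid_gen by (simp add: braid_gen_def)

lemma regular_braid_inv: "Suc i < n \<Longrightarrow> smooth x \<Longrightarrow> regular (\<lambda>q. braid_inv n i (x q))"
  using regular_block_gen[of i "\<lambda>q. - x q" "\<lambda>_. 1" "\<lambda>_. 1" "\<lambda>_. 0"] unit_braid_inv
  by (simp add: braid_inv_def smooth_minus)

lemma
  assumes F: "regular F" and G: "regular G"
  shows regular_mult: "regular (\<lambda>q. F q * G q)"
    and dmat_mult: "c \<in> {\<gamma>, \<delta>} \<Longrightarrow>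
      dmat c (\<lambda>q. F q * G q) = dmat c F * G p + F p * dmat c G"
proof -
  have entry: "(F q * G q) $$ (i, j) = (\<Sum>k<n. F q $$ (i, k) * G q $$ (k, j))"
    if "q \<in> S" "i < n" "j < n" for q i j
    using mat_mult_entry regularD(2)[OF F] regularD(2)[OF G] that by blast
  have "smooth (\<lambda>q. (F q * G q) $$ (i, j))" if "i < n" "j < n" for i j
    using that smooth_cong[of "\<lambda>q. (F q * G q) $$ (i, j)", OF entry]
      smooth_sum[of "{..<n}" "\<lambda>k q. F q $$ (i, k) * G q $$ (k, j)"]
      smooth_mult[OF regularD(3)[OF F] regularD(3)[OF G]] by auto
  then show "regular (\<lambda>q. F q * G q)"
    using regularD(1)[OF F] regularD(1)[OF G] by (auto simp: regular_def)
  assume c: "c \<in> {\<gamma>, \<delta>}"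
  show "dmat c (\<lambda>q. F q * G q) = dmat c F * G p + F p * dmat c G"
  proof (rule eq_matI)
    fix i j assume "i < dim_row (dmat c F * G p + F p * dmat c G)"
      "j < dim_col (dmat c F * G p + F p * dmat c G)"
    then have ij: "i < n" "j < n" using regularD(2)[OF F p_in] regularD(2)[OF G p_in] by (auto simp: dmat_def)
    have "dmat c (\<lambda>q. F q * G q) $$ (i, j) = deriv (\<lambda>t. (F (c t) * G (c t)) $$ (i, j)) 0"
      using ij by (simp add: dmat_def)
    also have "\<dots> = deriv (\<lambda>t. \<Sum>k<n. F (c t) $$ (i, k) * G (c t) $$ (k, j)) 0"
      by (rule along_cong(2)[OF c, of "\<lambda>q. (F q * G q) $$ (i, j)", OF entry]) (use ij in auto)
    also have "\<dots> = (\<Sum>k<n. dmat c F $$ (i, k) * G p $$ (k, j) + dmat c G $$ (k, j) * F p $$ (i, k))"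
    proof (rule DERIV_imp_deriv, rule DERIV_sum)
      fix k assume "k \<in> {..<n}"
      then show "((\<lambda>t. F (c t) $$ (i, k) * G (c t) $$ (k, j)) has_field_derivative
        dmat c F $$ (i, k) * G p $$ (k, j) + dmat c G $$ (k, j) * F p $$ (i, k)) (at 0)"
        using DERIV_mult[OF smooth_has_deriv[OF regularD(3)[OF F] c, of i k]
            smooth_has_deriv[OF regularD(3)[OF G] c, of k j]] ij base[OF c]
        by (simp add: dmat_def)
    qed
    also have "\<dots> = (dmat c F * G p) $$ (i, j) + (F p * dmat c G) $$ (i, j)"
      using mat_mult_entry[OF dmat_carrier regularD(2)[OF G p_in] ij]
        mat_mult_entry[OF regularD(2)[OF F p_in] dmat_carrier ij]
      by (simp add: sum.distrib mult.commute)
    finally show "dmat c (\<lambda>q. F q * G q) $$ (i, j) = (dmat c F * G p + F p * dmat c G) $$ (i, j)"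
      using ij regularD(2)[OF F p_in] regularD(2)[OF G p_in] by (simp add: dmat_def)
  qed (use regularD(2)[OF F p_in] regularD(2)[OF G p_in] in \<open>auto simp: dmat_def\<close>)
qed

lemma
  assumes F: "regular F"
  shows regular_transpose: "regular (\<lambda>q. transpose_mat (F q))"
    and dmat_transpose: "c \<in> {\<gamma>, \<delta>} \<Longrightarrow>
      dmat c (\<lambda>q. transpose_mat (F q)) = transpose_mat (dmat c F)"
proof -
  have entry: "transpose_mat (F q) $$ (i, j) = F q $$ (j, i)" if "q \<in> S" "i < n" "j < n" for q i j
    using regularD(2)[OF F that(1)] that by simp
  show "regular (\<lambda>q. transpose_mat (F q))"
    unfolding regular_def
    using regularD(1)[OF F] regularD(3)[OF F] smooth_cong[of "\<lambda>q. transpose_mat (F q) $$ _", OF entry]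
    by auto
  assume c: "c \<in> {\<gamma>, \<delta>}"
  show "dmat c (\<lambda>q. transpose_mat (F q)) = transpose_mat (dmat c F)"
    using along_cong(2)[OF c, of "\<lambda>q. transpose_mat (F q) $$ _", OF entry]
    by (intro eq_matI) (auto simp: dmat_def)
qed

lemma dmat_cong:
  assumes "c \<in> {\<gamma>, \<delta>}" "\<And>q. q \<in> S \<Longrightarrow> F q = G q"
  shows "dmat c F = dmat c G"
  using along_cong(2)[OF assms(1), of "\<lambda>q. F q $$ _" "\<lambda>q. G q $$ _"] assms(2)
  by (simp add: dmat_def)

subsection \<open>The pairing\<close>

lemma form_cong:
  assumes "\<And>q. q \<in> S \<Longrightarrow> F q = F' q" "\<And>q. q \<in> S \<Longrightarrow> G q = G' q"
  shows "form F G = form F' G'"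
  using dmat_cong[of _ F F'] dmat_cong[of _ G G'] assms p_in
  by (simp add: form_def half_form_def)

lemma half_form_cocycle:
  assumes F: "regular F" and G: "regular G" and H: "regular H" and c: "c \<in> {\<gamma>, \<delta>}" and d: "d \<in> {\<gamma>, \<delta>}"
  shows "half_form c d F G + half_form c d (\<lambda>q. F q * G q) H =
    half_form c d F (\<lambda>q. G q * H q) + half_form c d G H"
proof -
  note f = unit_matD[OF regularD(1)[OF F p_in]] and g = unit_matD[OF regularD(1)[OF G p_in]]
    and h = unit_matD[OF regularD(1)[OF H p_in]]
  define f g h f' g' h' where defs: "f = F p" "g = G p" "h = H p" "f' = mat_inv (F p)"
    "g' = mat_inv (G p)" "h' = mat_inv (H p)"
  define df dg dg2 dh where ds: "df = dmat c F" "dg = dmat c G" "dg2 = dmat d G" "dh = dmat d H"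
  have car [simp]: "f \<in> carrier_mat n n" "g \<in> carrier_mat n n" "h \<in> carrier_mat n n"
    "f' \<in> carrier_mat n n" "g' \<in> carrier_mat n n" "h' \<in> carrier_mat n n"
    "df \<in> carrier_mat n n" "dg \<in> carrier_mat n n" "dg2 \<in> carrier_mat n n" "dh \<in> carrier_mat n n"
    using f g h by (simp_all add: defs ds)
  note assoc = assoc_mult_mat[of _ n n _ n _ n]
  note distr = add_mult_distrib_mat[of _ n n _ _ n] mult_add_distrib_mat[of _ n n _ n]
  have inv: "f' * f = 1\<^sub>m n" "h * h' = 1\<^sub>m n" using f h by (simp_all add: defs)
  have inv1: "f' * (f * A) = A" if "A \<in> carrier_mat n n" for A
    using that inv by (simp flip: assoc)
  have inv2: "h * (h' * A) = A" if "A \<in> carrier_mat n n" for A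
    using that inv by (simp flip: assoc)
  have half: "half_form c d G H = mat_trace (g' * dg * dh * h')"
    "half_form c d F G = mat_trace (f' * df * dg2 * g')"
    by (simp_all add: half_form_def defs ds)
  have "half_form c d (\<lambda>q. F q * G q) H = mat_trace (g' * f' * (df * g + f * dg) * dh * h')"
    using dmat_mult[OF F G c] mat_inv_mult[OF regularD(1)[OF F p_in] regularD(1)[OF G p_in]]
    by (simp add: half_form_def defs ds)
  also have "g' * f' * (df * g + f * dg) * dh * h' = g' * (f' * df * g * dh * h') + g' * dg * dh * h'"
    by (simp add: distr assoc inv1)
  also have "mat_trace \<dots> = mat_trace (g' * (f' * df * g * dh * h')) + half_form c d G H"
    by (subst mat_trace_add[of _ n]) (simp_all add: half)
  also have "mat_trace (g' * (f' * df * g * dh * h')) = mat_trace (f' * df * g * dh * h' * g')"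
    by (rule mat_trace_comm[of _ n]) auto
  finally have 1: "half_form c d (\<lambda>q. F q * G q) H =
    mat_trace (f' * df * g * dh * h' * g') + half_form c d G H" .
  have "half_form c d F (\<lambda>q. G q * H q) = mat_trace (f' * df * (dg2 * h + g * dh) * (h' * g'))"
    using dmat_mult[OF G H d] mat_inv_mult[OF regularD(1)[OF G p_in] regularD(1)[OF H p_in]]
    by (simp add: half_form_def defs ds)
  also have "f' * df * (dg2 * h + g * dh) * (h' * g') = f' * df * dg2 * g' + f' * df * g * dh * h' * g'"
    by (simp add: distr assoc inv2)
  also have "mat_trace \<dots> = half_form c d F G + mat_trace (f' * df * g * dh * h' * g')"
    by (subst mat_trace_add[of _ n]) (simp_all add: half)
  finally show ?thesis using 1 by simp
qed

text \<open>By the product rule d(F G) on the left and d(G H) on the right both contribute the term in dF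
  and dH, and the invariance of the trace under cyclic permutations identifies the rest.  This
  cocycle rule makes the form of a product of several factors independent of the bracketing.\<close>

lemma form_cocycle:
  assumes "regular F" "regular G" "regular H"
  shows "form F G + form (\<lambda>q. F q * G q) H = form F (\<lambda>q. G q * H q) + form G H"
  using half_form_cocycle[OF assms, of \<gamma> \<delta>] half_form_cocycle[OF assms, of \<delta> \<gamma>]
  by (simp add: form_def algebra_simps)

lemma form_const_left [simp]: "unit_mat n K \<Longrightarrow> regular G \<Longrightarrow> form (\<lambda>_. K) G = 0"
  using unit_matD(2)[OF regularD(1)[OF _ p_in]] unit_matD(2)[of n K]
  by (simp add: form_def half_form_def left_mult_zero_mat[of _ n n n] right_mult_zero_mat[of _ n n n])

lemma form_const_right [simp]: "unit_mat n K \<Longrightarrow> regular F \<Longrightarrow> form F (\<lambda>_. K) = 0"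
  using unit_matD(2)[OF regularD(1)[OF _ p_in]] unit_matD(2)[of n K]
  by (simp add: form_def half_form_def left_mult_zero_mat[of _ n n n] right_mult_zero_mat[of _ n n n])

lemma form_const_mult_left:
  assumes "unit_mat n K" "regular F" "regular G"
  shows "form (\<lambda>q. K * F q) G = form F G"
  using form_cocycle[OF regular_const[OF assms(1)] assms(2,3)] assms by (simp add: regular_mult)

lemma form_const_mult_right:
  assumes "unit_mat n K" "regular F" "regular G"
  shows "form F (\<lambda>q. G q * K) = form F G"
  using form_cocycle[OF assms(2,3) regular_const[OF assms(1)]] assms by (simp add: regular_mult regular_const)

lemma form_const_shift:
  assumes "unit_mat n K" "regular F" "regular G"
  shows "form (\<lambda>q. F q * K) G = form F (\<lambda>q. K * G q)"
  using form_cocycle[OF assms(2) regular_const[OF assms(1)] assms(3)] assms by simp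

text \<open>Transposition reverses products, so it turns the pairing into its negative with the two
  arguments exchanged.  This reduces every lower-triangular statement to an upper-triangular one.\<close>

lemma form_transpose:
  assumes F: "regular F" and G: "regular G"
  shows "form (\<lambda>q. transpose_mat (G q)) (\<lambda>q. transpose_mat (F q)) = - form F G"
proof -
  have "half_form d c (\<lambda>q. transpose_mat (G q)) (\<lambda>q. transpose_mat (F q)) = half_form c d F G"
    if c: "c \<in> {\<gamma>, \<delta>}" and d: "d \<in> {\<gamma>, \<delta>}" for c d
  proof -
    note f = unit_matD[OF regularD(1)[OF F p_in]] and g = unit_matD[OF regularD(1)[OF G p_in]]
    have "half_form c d F G = mat_trace (transpose_mat (mat_inv (F p) * dmat c F * dmat d G * mat_inv (G p)))"
      unfolding half_form_def by (rule mat_trace_transpose[of _ n, symmetric]) (use f g in auto)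
    also have "transpose_mat (mat_inv (F p) * dmat c F * dmat d G * mat_inv (G p)) =
      mat_inv (transpose_mat (G p)) * dmat d (\<lambda>q. transpose_mat (G q)) *
      dmat c (\<lambda>q. transpose_mat (F q)) * mat_inv (transpose_mat (F p))"
      using f(1,2) g(1,2) c d
      by (simp add: transpose_mult[of _ n n _ n] mat_inv_transpose[OF regularD(1)[OF F p_in]]
          mat_inv_transpose[OF regularD(1)[OF G p_in]] dmat_transpose[OF F c] dmat_transpose[OF G d]
          assoc_mult_mat[of _ n n _ n _ n])
    finally show ?thesis by (simp add: half_form_def)
  qed
  then show ?thesis by (simp add: form_def)
qed

text \<open>The trace of a product of upper-triangular matrices sees only their diagonals, and the
  diagonal of the logarithmic differential of F consists of the logarithmic differentials of the
  diagonal entries.\<close>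

lemma form_upper_triangular:
  assumes F: "regular F" "\<And>q. q \<in> S \<Longrightarrow> upper_triangular (F q)"
    and G: "regular G" "\<And>q. q \<in> S \<Longrightarrow> upper_triangular (G q)"
  shows "form F G = (\<Sum>i<n.
      log_deriv \<gamma> (\<lambda>q. F q $$ (i, i)) * log_deriv \<delta> (\<lambda>q. G q $$ (i, i))
    - log_deriv \<delta> (\<lambda>q. F q $$ (i, i)) * log_deriv \<gamma> (\<lambda>q. G q $$ (i, i)))"
proof -
  have dm: "upper_triangular (dmat c H)"
    if c: "c \<in> {\<gamma>, \<delta>}" and H: "regular H" "\<And>q. q \<in> S \<Longrightarrow> upper_triangular (H q)" for c H
  proof (rule upper_triangularI)
    fix i j assume ij: "j < i" "i < dim_row (dmat c H)"
    have "H q $$ (i, j) = 0" if "q \<in> S" for q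
      using upper_triangularD[OF H(2)[OF that] ij(1)] regularD(2)[OF H(1) that] ij by (simp add: dmat_def)
    from along_cong(2)[OF c, of "\<lambda>q. H q $$ (i, j)" "\<lambda>_. 0", OF this]
    show "dmat c H $$ (i, j) = 0" using ij by (simp add: dmat_def)
  qed
  have "half_form c d F G = (\<Sum>i<n.
      log_deriv c (\<lambda>q. F q $$ (i, i)) * log_deriv d (\<lambda>q. G q $$ (i, i)))"
    if c: "c \<in> {\<gamma>, \<delta>}" and d: "d \<in> {\<gamma>, \<delta>}" for c d
  proof -
    note f = unit_matD[OF regularD(1)[OF F(1) p_in]] and g = unit_matD[OF regularD(1)[OF G(1) p_in]]
    note fi = upper_triangular_inv[OF F(2)[OF p_in] regularD(1)[OF F(1) p_in]]
    note gi = upper_triangular_inv[OF G(2)[OF p_in] regularD(1)[OF G(1) p_in]]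
    have dF: "upper_triangular (dmat c F)" and dG: "upper_triangular (dmat d G)"
      using dm[OF c F] dm[OF d G] by auto
    note ut = upper_triangular_mult[OF fi(1) dF f(2) dmat_carrier]
      upper_triangular_mult[OF dG gi(1) dmat_carrier g(2)]
    have "half_form c d F G = mat_trace ((mat_inv (F p) * dmat c F) * (dmat d G * mat_inv (G p)))"
      unfolding half_form_def using f(2) g(2) by (simp add: assoc_mult_mat[of _ n n _ n _ n])
    also have "\<dots> = (\<Sum>i<n. (mat_inv (F p) * dmat c F) $$ (i, i) * (dmat d G * mat_inv (G p)) $$ (i, i))"
      by (rule mat_trace_upper_mult[OF ut]) (use f g in auto)
    also have "\<dots> = (\<Sum>i<n. log_deriv c (\<lambda>q. F q $$ (i, i)) * log_deriv d (\<lambda>q. G q $$ (i, i)))"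
    proof (rule sum.cong[OF refl])
      fix i assume "i \<in> {..<n}"
      then have i: "i < n" by simp
      show "(mat_inv (F p) * dmat c F) $$ (i, i) * (dmat d G * mat_inv (G p)) $$ (i, i) =
        log_deriv c (\<lambda>q. F q $$ (i, i)) * log_deriv d (\<lambda>q. G q $$ (i, i))"
        unfolding upper_triangular_mult_diag[OF fi(1) dF f(2) dmat_carrier i]
          upper_triangular_mult_diag[OF dG gi(1) dmat_carrier g(2) i]
        using i fi(3)[OF i] gi(3)[OF i] by (simp add: dmat_def log_deriv_def divide_inverse)
    qed
    finally show ?thesis .
  qed
  then show ?thesis by (simp add: form_def sum_subtractf)
qed

lemma log_deriv_const:
  assumes "c \<in> {\<gamma>, \<delta>}" "\<And>q. q \<in> S \<Longrightarrow> f q = a"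
  shows "log_deriv c f = 0"
  using along_cong(2)[OF assms(1), of f "\<lambda>_. a"] assms(2) by (simp add: log_deriv_def)

lemma log_deriv_cong:
  assumes "c \<in> {\<gamma>, \<delta>}" "\<And>q. q \<in> S \<Longrightarrow> f q = g q"
  shows "log_deriv c f = log_deriv c g"
  using along_cong(2)[OF assms(1), of f g] assms(2) p_in by (simp add: log_deriv_def)

lemma log_deriv_mult:
  assumes "c \<in> {\<gamma>, \<delta>}" "smooth f" "smooth g" "f p \<noteq> 0" "g p \<noteq> 0"
  shows "log_deriv c (\<lambda>q. f q * g q) = log_deriv c f + log_deriv c g"
  using DERIV_imp_deriv[OF DERIV_mult[OF smooth_has_deriv[OF assms(2,1)] smooth_has_deriv[OF assms(3,1)]]]
    base[OF assms(1)] assms(4,5)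
  by (simp add: log_deriv_def field_simps)

lemma log_deriv_minus_inverse:
  assumes "c \<in> {\<gamma>, \<delta>}" "smooth f" "f p \<noteq> 0"
  shows "log_deriv c (\<lambda>q. - inverse (f q)) = - log_deriv c f"
  using DERIV_imp_deriv[OF DERIV_minus[OF DERIV_inverse_fun[OF smooth_has_deriv[OF assms(2,1)]]]]
    base[OF assms(1)] assms(3)
  by (simp add: log_deriv_def field_simps)

lemma form_upper_unipotent_left:
  assumes F: "regular F" "\<And>q. q \<in> S \<Longrightarrow> upper_triangular (F q)" "\<And>q i. q \<in> S \<Longrightarrow> i < n \<Longrightarrow> F q $$ (i, i) = 1"
    and G: "regular G" "\<And>q. q \<in> S \<Longrightarrow> upper_triangular (G q)"
  shows "form F G = 0"
proof -
  have "form F G = (\<Sum>i<n.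
      log_deriv \<gamma> (\<lambda>q. F q $$ (i, i)) * log_deriv \<delta> (\<lambda>q. G q $$ (i, i))
    - log_deriv \<delta> (\<lambda>q. F q $$ (i, i)) * log_deriv \<gamma> (\<lambda>q. G q $$ (i, i)))"
    by (rule form_upper_triangular) (use F G in auto)
  also have "\<dots> = 0"
  proof (rule sum.neutral, rule ballI)
  fix i assume "i \<in> {..<n}"
  then have "log_deriv c (\<lambda>q. F q $$ (i, i)) = 0" if "c \<in> {\<gamma>, \<delta>}" for c
    using log_deriv_const[OF that, of "\<lambda>q. F q $$ (i, i)" 1] F(3) by auto
  then show "log_deriv \<gamma> (\<lambda>q. F q $$ (i, i)) * log_deriv \<delta> (\<lambda>q. G q $$ (i, i))
    - log_deriv \<delta> (\<lambda>q. F q $$ (i, i)) * log_deriv \<gamma> (\<lambda>q. G q $$ (i, i)) = 0" by simp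
  qed
  finally show ?thesis .
qed

lemma form_upper_unipotent_right:
  assumes F: "regular F" "\<And>q. q \<in> S \<Longrightarrow> upper_triangular (F q)"
    and G: "regular G" "\<And>q. q \<in> S \<Longrightarrow> upper_triangular (G q)" "\<And>q i. q \<in> S \<Longrightarrow> i < n \<Longrightarrow> G q $$ (i, i) = 1"
  shows "form F G = 0"
proof -
  have "form F G = - form G F"
    using F G by (simp add: form_upper_triangular sum_negf[symmetric] mult.commute)
  moreover have "form G F = 0"
    by (rule form_upper_unipotent_left) (use F G in auto)
  ultimately show ?thesis by simp
qed

lemma form_lower_unitriangular:
  assumes F: "regular F" "\<And>q. q \<in> S \<Longrightarrow> lower_unitriangular (F q)"
    and G: "regular G" "\<And>q. q \<in> S \<Longrightarrow> lower_unitriangular (G q)"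
  shows "form F G = 0"
proof -
  have "form (\<lambda>q. transpose_mat (G q)) (\<lambda>q. transpose_mat (F q)) = 0"
    using F G carrier_matD(1)[OF regularD(2)[OF G(1)]] carrier_matD(2)[OF regularD(2)[OF G(1)]]
    by (intro form_upper_unipotent_left regular_transpose)
      (auto simp: lower_unitriangular_def lower_triangular_def)
  then show ?thesis using form_transpose[OF F(1) G(1)] by simp
qed

text \<open>Both differentials are multiples of dx, and dx \<and> dx = 0.\<close>

lemma form_one_variable:
  assumes x: "smooth x"
    and A: "\<And>i j. i < n \<Longrightarrow> j < n \<Longrightarrow> (\<lambda>z. A z $$ (i, j)) field_differentiable at (x p)"
    and B: "\<And>i j. i < n \<Longrightarrow> j < n \<Longrightarrow> (\<lambda>z. B z $$ (i, j)) field_differentiable at (x p)"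
    and u: "unit_mat n (A (x p))" "unit_mat n (B (x p))"
  shows "form (\<lambda>q. A (x q)) (\<lambda>q. B (x q)) = 0"
proof -
  have d: "dmat c (\<lambda>q. C (x q)) = deriv (\<lambda>t. x (c t)) 0 \<cdot>\<^sub>m mat n n (\<lambda>(i, j). deriv (\<lambda>z. C z $$ (i, j)) (x p))"
    if c: "c \<in> {\<gamma>, \<delta>}" and C: "\<And>i j. i < n \<Longrightarrow> j < n \<Longrightarrow> (\<lambda>z. C z $$ (i, j)) field_differentiable at (x p)"
    for c and C :: "complex \<Rightarrow> complex mat"
  proof (rule eq_matI, goal_cases)
    case (1 i j)
    then have ij: "i < n" "j < n" by auto
    have "deriv ((\<lambda>z. C z $$ (i, j)) \<circ> (\<lambda>t. x (c t))) 0 =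
      deriv (\<lambda>z. C z $$ (i, j)) (x (c 0)) * deriv (\<lambda>t. x (c t)) 0"
      using x c C[OF ij] base[OF c] by (intro deriv_chain) (auto simp: smooth_def)
    then show ?case using ij base[OF c] by (simp add: dmat_def o_def)
  qed (auto simp: dmat_def)
  note ui = unit_matD(2)[OF u(1)] unit_matD(2)[OF u(2)]
  have "half_form c d (\<lambda>q. A (x q)) (\<lambda>q. B (x q)) =
     deriv (\<lambda>t. x (c t)) 0 * (deriv (\<lambda>t. x (d t)) 0 * mat_trace (mat_inv (A (x p)) *
       mat n n (\<lambda>(i, j). deriv (\<lambda>z. A z $$ (i, j)) (x p)) *
       mat n n (\<lambda>(i, j). deriv (\<lambda>z. B z $$ (i, j)) (x p)) * mat_inv (B (x p))))"
    if c: "c \<in> {\<gamma>, \<delta>}" and d': "d \<in> {\<gamma>, \<delta>}" for c d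
    using ui d[of c A, OF c A] d[of d B, OF d' B]
    by (simp add: half_form_def mat_trace_smult[of _ n] mult_smult_distrib[of _ n n _ n] mult_smult_assoc_mat[of _ n n _ n])
  then show ?thesis by (simp add: form_def mult.left_commute)
qed

subsection \<open>The form of a product\<close>

fun mprod :: "('p \<Rightarrow> complex mat) list \<Rightarrow> 'p \<Rightarrow> complex mat" where
  "mprod [] q = 1\<^sub>m n"
| "mprod (F # Fs) q = F q * mprod Fs q"

text \<open>The form of a product \<open>F\<^sub>1 \<cdots> F\<^sub>m\<close>: the sum of the pairings
  \<open>(F\<^sub>k | F\<^bsub>k+1\<^esub> \<cdots> F\<^sub>m)\<close>.  Bracketing from the right suits induction on lists;
  \<open>prod_form_left_sum\<close> returns to the bracketing from the left.\<close>

fun prod_form :: "('p \<Rightarrow> complex mat) list \<Rightarrow> complex" where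
  "prod_form [] = 0"
| "prod_form (F # Fs) = form F (mprod Fs) + prod_form Fs"

abbreviation all_regular :: "('p \<Rightarrow> complex mat) list \<Rightarrow> bool" where
  "all_regular Fs \<equiv> \<forall>F\<in>set Fs. regular F"

lemma mprod_Cons: "mprod (F # Fs) = (\<lambda>q. F q * mprod Fs q)"
  by (rule ext) simp

lemma mprod_Nil: "mprod [] = (\<lambda>_. 1\<^sub>m n)"
  by (rule ext) simp

lemma regular_mprod: "all_regular Fs \<Longrightarrow> regular (mprod Fs)"
  by (induction Fs) (auto simp: mprod_Nil mprod_Cons regular_const regular_mult)

lemma mprod_append:
  "all_regular Fs \<Longrightarrow> all_regular Gs \<Longrightarrow> q \<in> S \<Longrightarrow> mprod (Fs @ Gs) q = mprod Fs q * mprod Gs q"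
  using regularD(2)[OF regular_mprod[of Gs]] regularD(2)[OF regular_mprod] regularD(2)
  by (induction Fs) (auto simp: assoc_mult_mat[of _ n n _ n _ n] left_mult_one_mat[of _ n n])

lemma prod_form_append:
  assumes "all_regular Fs" "all_regular Gs"
  shows "prod_form (Fs @ Gs) = prod_form Fs + prod_form Gs + form (mprod Fs) (mprod Gs)"
  using assms(1)
proof (induction Fs)
  case Nil
  then show ?case using regular_mprod[OF assms(2)] by (simp add: mprod_Nil)
next
  case (Cons F Fs)
  have "form F (mprod (Fs @ Gs)) = form F (\<lambda>q. mprod Fs q * mprod Gs q)"
    using Cons mprod_append[OF _ assms(2)] by (intro form_cong) auto
  moreover have "form F (mprod Fs) + form (\<lambda>q. F q * mprod Fs q) (mprod Gs) =
    form F (\<lambda>q. mprod Fs q * mprod Gs q) + form (mprod Fs) (mprod Gs)"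
    using Cons assms by (intro form_cocycle regular_mprod) auto
  ultimately show ?case using Cons by (simp add: mprod_Cons)
qed

text \<open>By the previous lemma a stretch of factors enters the form of the whole only through its own
  form and its product.\<close>

lemma prod_form_replace:
  assumes "all_regular Xs" "all_regular Fs" "all_regular Gs" "all_regular Ys"
    and eq: "\<And>q. q \<in> S \<Longrightarrow> mprod Fs q = mprod Gs q" and "prod_form Fs = prod_form Gs"
  shows "prod_form (Xs @ Fs @ Ys) = prod_form (Xs @ Gs @ Ys)"
proof -
  have "form (mprod Fs) (mprod Ys) = form (mprod Gs) (mprod Ys)"
    using eq by (intro form_cong) auto
  moreover have "form (mprod Xs) (mprod (Fs @ Ys)) = form (mprod Xs) (mprod (Gs @ Ys))"
    using eq assms by (intro form_cong) (auto simp: mprod_append)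
  moreover have "prod_form (Xs @ Hs @ Ys) = prod_form Xs + (prod_form Hs + prod_form Ys +
      form (mprod Hs) (mprod Ys)) + form (mprod Xs) (mprod (Hs @ Ys))" if "all_regular Hs" for Hs
    using that assms(1,4) prod_form_append[of Xs "Hs @ Ys"] prod_form_append[of Hs Ys] by auto
  ultimately show ?thesis
    using assms(2,3,6) by presburger
qed

lemma prod_form_left_sum:
  assumes "all_regular Fs"
  shows "prod_form Fs = (\<Sum>k\<in>{1..<length Fs}. form (mprod (take k Fs)) (Fs ! k))"
  using assms
proof (induction Fs rule: rev_induct)
  case (snoc F Fs)
  have F: "form (mprod Fs) (mprod [F]) = form (mprod Fs) F"
    using snoc regularD(2) by (intro form_cong) (auto simp: right_mult_one_mat[of _ n n])
  have "prod_form (Fs @ [F]) = prod_form Fs + form (mprod Fs) F"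
    using snoc F by (simp add: prod_form_append mprod_Nil)
  also have "prod_form Fs = (\<Sum>k\<in>{1..<length Fs}. form (mprod (take k (Fs @ [F]))) ((Fs @ [F]) ! k))"
    using snoc by (auto simp: nth_append intro!: sum.cong)
  finally show ?case
    using snoc by (cases "Fs = []") (auto simp: mprod_Nil atLeastLessThanSuc Suc_le_eq)
qed simp

end

text \<open>Conjugation by the transposition of j and j + 1 moves only one entry from above to below the
  diagonal, the one in position (j, j + 1).\<close>

lemma swap_index_upper:
  assumes j: "Suc j < n" and W: "W \<in> carrier_mat n n" "upper_triangular W" "W $$ (j, Suc j) = 0"
  shows "upper_triangular (braid_gen n j 0 * (W * braid_gen n j 0))"
proof (rule upper_triangularI)
  fix r s assume "s < r" "r < dim_row (braid_gen n j 0 * (W * braid_gen n j 0))"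
  then have rs: "s < r" "r < n" by (auto simp: braid_gen_def block_gen_def)
  have low: "W $$ (a, b) = 0" if "b < a" "a < n" for a b
    using upper_triangularD[OF W(2)] that W by auto
  have e: "(W * braid_gen n j 0) $$ (a, b) =
    (if b = j then W $$ (a, Suc j) else if b = Suc j then W $$ (a, j) else W $$ (a, b))"
    if "a < n" "b < n" for a b
    unfolding braid_gen_def by (subst block_gen_mult_right) (use that j W in auto)
  have "(braid_gen n j 0 * (W * braid_gen n j 0)) $$ (r, s) =
    (if r = j then (W * braid_gen n j 0) $$ (Suc j, s)
     else if r = Suc j then (W * braid_gen n j 0) $$ (j, s) else (W * braid_gen n j 0) $$ (r, s))"
    unfolding braid_gen_def by (subst block_gen_mult_left) (use rs j W in \<open>auto simp: braid_gen_def[symmetric]\<close>)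
  then show "(braid_gen n j 0 * (W * braid_gen n j 0)) $$ (r, s) = 0"
    using rs j low W(3) by (auto simp: e simp del: index_mult_mat)
qed

text \<open>The unipotent factor in \<open>B\<^sub>j(z) = s\<^sub>j u\<^sub>j(z)\<close>.\<close>

definition unip_gen :: "nat \<Rightarrow> nat \<Rightarrow> complex \<Rightarrow> complex mat" where
  "unip_gen n j z = block_gen n j 1 z 0 1"

lemma braid_gen_unip: "Suc j < n \<Longrightarrow> braid_gen n j z = braid_gen n j 0 * unip_gen n j z"
  by (simp add: braid_gen_def unip_gen_def block_gen_mult)

lemma unip_gen:
  assumes "Suc j < n"
  shows "unit_mat n (unip_gen n j z)" "upper_triangular (unip_gen n j z)"
    "i < n \<Longrightarrow> unip_gen n j z $$ (i, i) = 1"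
proof -
  show "unit_mat n (unip_gen n j z)"
    by (rule unit_matI[of _ _ "block_gen n j 1 (- z) 0 1"])
      (use assms in \<open>auto simp: unip_gen_def block_gen_mult block_gen_one\<close>)
qed (auto simp: unip_gen_def block_gen_def intro!: upper_triangularI)

context curve_pair
begin

lemma regular_unip_gen: "Suc i < n \<Longrightarrow> smooth x \<Longrightarrow> regular (\<lambda>q. unip_gen n i (x q))"
  using regular_block_gen[of i "\<lambda>_. 1" x "\<lambda>_. 0" "\<lambda>_. 1"] unip_gen(1) by (simp add: unip_gen_def)

text \<open>The constant factor \<open>s\<^sub>j\<close> of \<open>B\<^sub>j(z) = s\<^sub>j u\<^sub>j(z)\<close> drops out of the pairing, and the unipotent
  factor has a constant diagonal.\<close>

lemma form_braid_upper:
  assumes j: "Suc j < n" and x: "smooth x" and V: "regular V" "\<And>q. q \<in> S \<Longrightarrow> upper_triangular (V q)"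
  shows "form (\<lambda>q. braid_gen n j (x q)) V = 0"
proof -
  have "form (\<lambda>q. braid_gen n j (x q)) V = form (\<lambda>q. braid_gen n j 0 * unip_gen n j (x q)) V"
    by (rule form_cong) (rule braid_gen_unip[OF j], rule refl)
  also have "\<dots> = form (\<lambda>q. unip_gen n j (x q)) V"
    using form_const_mult_left[OF unit_braid_gen[OF j] regular_unip_gen[OF j x] V(1)] .
  also have "\<dots> = 0"
    using unip_gen[OF j] V by (intro form_upper_unipotent_left[OF regular_unip_gen[OF j x]]) auto
  finally show ?thesis .
qed

text \<open>Here \<open>s\<^sub>j\<close> first has to be moved into W, which conjugates W.\<close>

lemma form_upper_braid:
  assumes j: "Suc j < n" and x: "smooth x" and W: "regular W" "\<And>q. q \<in> S \<Longrightarrow> upper_triangular (W q)"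
    and W0: "\<And>q. q \<in> S \<Longrightarrow> W q $$ (j, Suc j) = 0"
  shows "form W (\<lambda>q. braid_gen n j (x q)) = 0"
proof -
  let ?K = "braid_gen n j 0" and ?u = "\<lambda>q. unip_gen n j (x q)"
  note u = regular_unip_gen[OF j x]
  have K: "unit_mat n ?K" "regular (\<lambda>_. ?K)" using j by (auto intro: regular_const)
  have "form W (\<lambda>q. braid_gen n j (x q)) = form W (\<lambda>q. ?K * ?u q)"
    by (rule form_cong) (rule refl, rule braid_gen_unip[OF j])
  also have "\<dots> = form (\<lambda>q. W q * ?K) ?u"
    using form_const_shift[OF K(1) W(1) u] by simp
  also have "\<dots> = form (\<lambda>q. ?K * (W q * ?K)) ?u"
    using form_const_mult_left[OF K(1) regular_mult[OF W(1) K(2)] u] by simp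
  also have "\<dots> = 0"
    using unip_gen[OF j] regularD(2)[OF W(1)] W W0 u
    by (intro form_upper_unipotent_right[OF regular_mult[OF K(2) regular_mult[OF W(1) K(2)]]])
      (auto intro: swap_index_upper[OF j])
  finally show ?thesis .
qed

subsection \<open>Exchanging factors\<close>

text \<open>All moves in the opening of a crossing are instances of this relation, which is preserved
  when further factors are put on both sides.\<close>

definition equiv_factors :: "('p \<Rightarrow> complex mat) list \<Rightarrow> ('p \<Rightarrow> complex mat) list \<Rightarrow> bool" where
  "equiv_factors Fs Gs \<longleftrightarrow> all_regular Fs \<and> all_regular Gs \<and>
     (\<forall>q\<in>S. mprod Fs q = mprod Gs q) \<and> prod_form Fs = prod_form Gs"

lemma equiv_factors_trans:
  "equiv_factors Fs Gs \<Longrightarrow> equiv_factors Gs Hs \<Longrightarrow> equiv_factors Fs Hs"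
  by (simp add: equiv_factors_def)

lemma equiv_factors_context:
  assumes "equiv_factors Fs Gs" "all_regular Xs" "all_regular Ys"
  shows "equiv_factors (Xs @ Fs @ Ys) (Xs @ Gs @ Ys)"
proof -
  have regular: "all_regular Fs" "all_regular Gs" using assms by (auto simp: equiv_factors_def)
  have "prod_form (Xs @ Fs @ Ys) = prod_form (Xs @ Gs @ Ys)"
    using assms by (intro prod_form_replace) (auto simp: equiv_factors_def)
  moreover have "mprod (Xs @ Hs @ Ys) q = mprod Xs q * (mprod Hs q * mprod Ys q)"
    if "q \<in> S" "all_regular Hs" for q Hs
    using mprod_append[of Xs "Hs @ Ys" q] mprod_append[of Hs Ys q] that assms by auto
  ultimately show ?thesis
    using assms regular unfolding equiv_factors_def by auto
qed

lemma equiv_factors_two: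
  assumes "regular F" "regular G" "regular H" "regular K"
  shows "equiv_factors [F, G] [H, K] \<longleftrightarrow> (\<forall>q\<in>S. F q * G q = H q * K q) \<and> form F G = form H K"
proof -
  have "F q * (G q * 1\<^sub>m n) = F q * G q" "H q * (K q * 1\<^sub>m n) = H q * K q" if "q \<in> S" for q
    using regularD(2)[OF _ that] assms by (simp_all add: right_mult_one_mat[of _ n n])
  moreover have "form F (mprod [G]) = form F G" "form H (mprod [K]) = form H K"
    using regularD(2) assms by (auto intro!: form_cong simp: right_mult_one_mat[of _ n n])
  ultimately show ?thesis
    using assms by (simp add: equiv_factors_def mprod_Nil)
qed

lemma equiv_factors_transpose:
  assumes eq: "equiv_factors [F, G] [H, K]"
  shows "equiv_factors [\<lambda>q. transpose_mat (G q), \<lambda>q. transpose_mat (F q)]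
    [\<lambda>q. transpose_mat (K q), \<lambda>q. transpose_mat (H q)]"
proof -
  have regular: "regular F" "regular G" "regular H" "regular K" using eq by (auto simp: equiv_factors_def)
  have e: "F q * G q = H q * K q" if "q \<in> S" for q
    using eq that equiv_factors_two[OF regular] by blast
  have "transpose_mat (G q) * transpose_mat (F q) = transpose_mat (K q) * transpose_mat (H q)"
    if "q \<in> S" for q
    using arg_cong[OF e[OF that], of transpose_mat]
      transpose_mult[OF regularD(2)[OF regular(1) that] regularD(2)[OF regular(2) that]]
      transpose_mult[OF regularD(2)[OF regular(3) that] regularD(2)[OF regular(4) that]] by metis
  moreover have "- form F G = - form H K"
    using eq equiv_factors_two[OF regular] by metis
  ultimately show ?thesis
    unfolding equiv_factors_two[OF regular(2,1,4,3)[THEN regular_transpose]]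
      form_transpose[OF regular(1,2)] form_transpose[OF regular(3,4)] by blast
qed

text \<open>Both pairings vanish, the one on the right because the entry of W in position (j, j + 1) does.\<close>

lemma exchange_upper:
  assumes j: "Suc j < n" and x: "smooth x" and V: "regular V" "\<And>q. q \<in> S \<Longrightarrow> upper_triangular (V q)"
    and x': "\<And>q. q \<in> S \<Longrightarrow> x' q = exch_var j (x q) (V q)"
    and W: "\<And>q. q \<in> S \<Longrightarrow> W q = exch_mat n j (x q) (V q)"
  shows "smooth x'" "regular W"
    and "equiv_factors [\<lambda>q. braid_gen n j (x q), V] [W, \<lambda>q. braid_gen n j (x' q)]"
proof -
  note e = exch_mat[OF j regularD(1)[OF V(1)] V(2)]
  have nz: "V p $$ (j, j) \<noteq> 0"
    using upper_triangular_inv(2)[OF V(2)[OF p_in] regularD(1)[OF V(1) p_in], of j] j by simp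
  have "smooth (\<lambda>q. exch_var j (x q) (V q))"
    unfolding exch_var_def
    using j nz by (intro smooth_divide smooth_add smooth_mult x regularD(3)[OF V(1)]) auto
  then show x's: "smooth x'" by (subst smooth_cong[OF x'])
  have "regular (\<lambda>q. braid_gen n j (x q) * V q * braid_inv n j (x' q))"
    using j x V x's by (intro regular_mult regular_braid_gen regular_braid_inv)
  moreover have "W q = braid_gen n j (x q) * V q * braid_inv n j (x' q)" if "q \<in> S" for q
    using W[OF that] x'[OF that] by (simp add: exch_mat_def)
  ultimately show Wg: "regular W" by (subst regular_cong)
  have "form W (\<lambda>q. braid_gen n j (x' q)) = 0"
    using j x's Wg W e by (intro form_upper_braid) auto
  moreover have "form (\<lambda>q. braid_gen n j (x q)) V = 0"
    by (rule form_braid_upper[OF j x V])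
  ultimately show "equiv_factors [\<lambda>q. braid_gen n j (x q), V] [W, \<lambda>q. braid_gen n j (x' q)]"
    using e(5) W x' by (subst equiv_factors_two) (auto intro: regular_braid_gen j x x's V Wg)
qed

lemma exchange_lower:
  assumes j: "Suc j < n" and x: "smooth x" and L: "regular L" "\<And>q. q \<in> S \<Longrightarrow> lower_triangular (L q)"
    and x': "\<And>q. q \<in> S \<Longrightarrow> x' q = exch_var j (x q) (transpose_mat (L q))"
    and M: "\<And>q. q \<in> S \<Longrightarrow> M q = transpose_mat (exch_mat n j (x q) (transpose_mat (L q)))"
  shows "smooth x'" "regular M"
    and "equiv_factors [L, \<lambda>q. braid_gen n j (x q)] [\<lambda>q. braid_gen n j (x' q), M]"
proof -
  have V: "regular (\<lambda>q. transpose_mat (L q))" "\<And>q. q \<in> S \<Longrightarrow> upper_triangular (transpose_mat (L q))"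
    using L by (auto simp: lower_triangular_def regular_transpose)
  have W: "transpose_mat (M q) = exch_mat n j (x q) (transpose_mat (L q))" if "q \<in> S" for q
    using M[OF that] by simp
  note e = exchange_upper[OF j x V x' W]
  show "smooth x'" using e by blast
  have "regular (\<lambda>q. transpose_mat (M q))" using e by blast
  from regular_transpose[OF this] show "regular M" by simp
  have "equiv_factors [\<lambda>q. transpose_mat (transpose_mat (L q)), \<lambda>q. transpose_mat (braid_gen n j (x q))]
     [\<lambda>q. transpose_mat (braid_gen n j (x' q)), \<lambda>q. transpose_mat (transpose_mat (M q))]"
    by (rule equiv_factors_transpose) (use e in blast)
  then show "equiv_factors [L, \<lambda>q. braid_gen n j (x q)] [\<lambda>q. braid_gen n j (x' q), M]" by simp
qed

text \<open>The two factors U D and L depend on the same single variable.\<close>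

lemma split_braid_gen:
  assumes j: "Suc j < n" and x: "smooth x" and nz: "\<And>q. q \<in> S \<Longrightarrow> x q \<noteq> 0"
  shows "regular (\<lambda>q. U_mat n j (x q) * D_mat n j (x q))" "regular (\<lambda>q. L_mat n j (x q))"
    and "equiv_factors [\<lambda>q. braid_gen n j (x q)]
      [\<lambda>q. U_mat n j (x q) * D_mat n j (x q), \<lambda>q. L_mat n j (x q)]"
proof -
  let ?UD = "\<lambda>z. block_gen n j (- inverse z) 1 0 z" and ?L = "\<lambda>z. block_gen n j 1 0 (inverse z) 1"
  have UD: "U_mat n j z * D_mat n j z = ?UD z" if "z \<noteq> 0" for z
    using that j by (simp add: U_mat_def D_mat_def block_gen_mult)
  have uUD: "unit_mat n (?UD z)" if "z \<noteq> 0" for z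
    by (rule unit_matI[of _ _ "block_gen n j (- z) 1 0 (inverse z)"])
      (use that j in \<open>auto simp: block_gen_mult block_gen_one\<close>)
  have uL: "unit_mat n (?L z)" for z
    by (rule unit_matI[of _ _ "block_gen n j 1 0 (- inverse z) 1"])
      (use j in \<open>auto simp: block_gen_mult block_gen_one\<close>)
  have xi: "smooth (\<lambda>q. inverse (x q))"
    using smooth_divide[OF smooth_const x, of 1] nz[OF p_in] by (simp add: divide_inverse)
  have g: "regular (\<lambda>q. ?UD (x q))"
    using uUD nz x xi by (intro regular_block_gen smooth_minus) auto
  then show gUD: "regular (\<lambda>q. U_mat n j (x q) * D_mat n j (x q))"
    using regular_cong[of "\<lambda>q. U_mat n j (x q) * D_mat n j (x q)" "\<lambda>q. ?UD (x q)"] UD nz by simp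
  show gL: "regular (\<lambda>q. L_mat n j (x q))"
    unfolding L_mat_def using uL xi by (intro regular_block_gen) auto
  have gB: "regular (\<lambda>q. braid_gen n j (x q))" by (rule regular_braid_gen[OF j x])
  have "form (\<lambda>q. U_mat n j (x q) * D_mat n j (x q)) (\<lambda>q. L_mat n j (x q)) =
    form (\<lambda>q. ?UD (x q)) (\<lambda>q. ?L (x q))"
    using UD nz by (intro form_cong) (auto simp: L_mat_def)
  also have "\<dots> = 0"
  proof (rule form_one_variable[OF x])
    have if_diff: "(\<lambda>z. if P then f z else g z) field_differentiable F"
      if "P \<Longrightarrow> f field_differentiable F" "\<not> P \<Longrightarrow> g field_differentiable F"
      for P and f g :: "complex \<Rightarrow> complex" and F
      using that by (cases P) auto
    have fi: "inverse field_differentiable at (x p)"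
      by (rule field_differentiable_inverse) (use nz[OF p_in] in auto)
    fix a b assume ab: "a < n" "b < n"
    show "(\<lambda>z. ?UD z $$ (a, b)) field_differentiable at (x p)"
      using ab nz[OF p_in] by (auto simp: block_gen_def field_differentiable_minus fi field_differentiable_ident intro!: if_diff)
    show "(\<lambda>z. ?L z $$ (a, b)) field_differentiable at (x p)"
      using ab by (auto simp: block_gen_def fi intro!: if_diff)
  qed (use uUD uL nz[OF p_in] in auto)
  finally have f0: "form (\<lambda>q. U_mat n j (x q) * D_mat n j (x q)) (\<lambda>q. L_mat n j (x q)) = 0" .
  have "form (\<lambda>q. U_mat n j (x q) * D_mat n j (x q)) (mprod [\<lambda>q. L_mat n j (x q)]) = 0"
    unfolding f0[symmetric]
    using regularD(2)[OF gL] by (intro form_cong) (auto simp: right_mult_one_mat[of _ n n])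
  moreover have "braid_gen n j (x q) = U_mat n j (x q) * D_mat n j (x q) * (L_mat n j (x q) * 1\<^sub>m n)"
    if "q \<in> S" for q
    using braid_gen_UDL[OF j nz[OF that]] regularD(2)[OF gL that] by (simp add: right_mult_one_mat[of _ n n])
  ultimately show "equiv_factors [\<lambda>q. braid_gen n j (x q)]
      [\<lambda>q. U_mat n j (x q) * D_mat n j (x q), \<lambda>q. L_mat n j (x q)]"
    using gB gUD gL regularD(2)[OF gB]
    by (auto simp: equiv_factors_def mprod_Nil right_mult_one_mat[of _ n n])
qed

end

section \<open>Opening a crossing\<close>

context curve_pair
begin

definition smooth_list :: "nat \<Rightarrow> ('p \<Rightarrow> complex list) \<Rightarrow> bool" where
  "smooth_list m Z \<longleftrightarrow> (\<forall>q\<in>S. length (Z q) = m) \<and> (\<forall>k<m. smooth (\<lambda>q. Z q ! k))"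

lemma smooth_list_Suc:
  "smooth_list (Suc m) Z \<longleftrightarrow> (\<forall>q\<in>S. Z q \<noteq> []) \<and> smooth (\<lambda>q. hd (Z q)) \<and> smooth_list m (\<lambda>q. tl (Z q))"
proof -
  have "smooth (\<lambda>q. hd (Z q)) \<longleftrightarrow> smooth (\<lambda>q. Z q ! 0)" if "\<And>q. q \<in> S \<Longrightarrow> Z q \<noteq> []"
    by (rule smooth_cong) (use that in \<open>simp add: hd_conv_nth\<close>)
  moreover have "smooth (\<lambda>q. tl (Z q) ! k) \<longleftrightarrow> smooth (\<lambda>q. Z q ! Suc k)"
    if "\<And>q. q \<in> S \<Longrightarrow> Z q \<noteq> []" for k
  proof (rule smooth_cong)
    fix q assume "q \<in> S"
    with that show "tl (Z q) ! k = Z q ! Suc k" by (cases "Z q") auto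
  qed
  moreover have "(\<forall>q\<in>S. length (Z q) = Suc m) \<longleftrightarrow> (\<forall>q\<in>S. Z q \<noteq> []) \<and> (\<forall>q\<in>S. length (tl (Z q)) = m)"
    by (metis Nitpick.size_list_simp(2) length_0_conv length_tl nat.distinct(1) nat.inject)
  ultimately show ?thesis
    unfolding smooth_list_def by (auto simp: All_less_Suc2)
qed

lemma smooth_list_take: "smooth_list m Z \<Longrightarrow> k \<le> m \<Longrightarrow> smooth_list k (\<lambda>q. take k (Z q))"
  by (simp add: smooth_list_def)

lemma smooth_list_drop:
  assumes "smooth_list m Z" "k \<le> m"
  shows "smooth_list (m - k) (\<lambda>q. drop k (Z q))"
proof -
  have "smooth (\<lambda>q. drop k (Z q) ! i)" if "i < m - k" for i
    by (subst smooth_cong[of _ "\<lambda>q. Z q ! (k + i)"]) (use assms that in \<open>auto simp: smooth_list_def\<close>)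
  then show ?thesis using assms by (simp add: smooth_list_def)
qed

lemma smooth_list_append:
  assumes "smooth_list k Z" "smooth_list m Y"
  shows "smooth_list (k + m) (\<lambda>q. Z q @ Y q)"
proof -
  have "smooth (\<lambda>q. (Z q @ Y q) ! i)" if "i < k + m" for i
    by (subst smooth_cong[of _ "\<lambda>q. if i < k then Z q ! i else Y q ! (i - k)"])
      (use assms that in \<open>auto simp: smooth_list_def nth_append intro!: smooth_if\<close>)
  then show ?thesis using assms by (simp add: smooth_list_def)
qed

fun braid_factors :: "braid_word \<Rightarrow> ('p \<Rightarrow> complex list) \<Rightarrow> ('p \<Rightarrow> complex mat) list" where
  "braid_factors [] Z = []"
| "braid_factors (j # \<beta>) Z = (\<lambda>q. braid_gen n j (hd (Z q))) # braid_factors \<beta> (\<lambda>q. tl (Z q))"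

lemma braid_factors_append:
  "braid_factors (\<beta> @ \<beta>') Z = braid_factors \<beta> (\<lambda>q. take (length \<beta>) (Z q)) @
     braid_factors \<beta>' (\<lambda>q. drop (length \<beta>) (Z q))"
proof (induction \<beta> arbitrary: Z)
  case (Cons j \<beta>)
  have "hd (take (Suc (length \<beta>)) (Z q)) = hd (Z q)" for q
    by (cases "Z q") auto
  moreover have "tl (take (Suc (length \<beta>)) (Z q)) = take (length \<beta>) (tl (Z q))" for q
    by (cases "Z q") auto
  moreover have "drop (length \<beta>) (tl (Z q)) = drop (Suc (length \<beta>)) (Z q)" for q
    by (cases "Z q") auto
  ultimately show ?case using Cons[of "\<lambda>q. tl (Z q)"] by simp
qed simp

lemma length_braid_factors [simp]: "length (braid_factors \<beta> Z) = length \<beta>"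
  by (induction \<beta> arbitrary: Z) auto

lemma regular_braid_factors:
  "is_braid_word n \<beta> \<Longrightarrow> smooth_list (length \<beta>) Z \<Longrightarrow> all_regular (braid_factors \<beta> Z)"
  by (induction \<beta> arbitrary: Z) (auto simp: is_braid_word_def smooth_list_Suc regular_braid_gen)

lemma mprod_braid_factors:
  "q \<in> S \<Longrightarrow> length (Z q) = length \<beta> \<Longrightarrow> mprod (braid_factors \<beta> Z) q = braid_mat n \<beta> (Z q)"
proof (induction \<beta> arbitrary: Z)
  case (Cons j \<beta>)
  then show ?case by (cases "Z q") auto
qed simp

lemma push_left_length:
  "length z = length \<beta> \<Longrightarrow> length (fst (push_left n \<beta> z V)) = length \<beta>"
  by (induction n \<beta> z V rule: push_left.induct) (auto split: prod.splits)

end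

text \<open>Pushing an upper-triangular matrix to the left through a braid permutes its diagonal entries.\<close>

fun diag_perm :: "braid_word \<Rightarrow> nat \<Rightarrow> nat" where
  "diag_perm [] k = k"
| "diag_perm (j # \<beta>) k = diag_perm \<beta> (Transposition.transpose j (Suc j) k)"

lemma diag_perm_less: "is_braid_word n \<beta> \<Longrightarrow> k < n \<Longrightarrow> diag_perm \<beta> k < n"
  by (induction \<beta> arbitrary: k) (auto simp: is_braid_word_def Transposition.transpose_def)

text \<open>The matrix U D has the diagonal entries \<open>- 1 / x\<close> and x in positions i and i + 1, where i is the
  letter of the crossing.  The integer below is the exponent of x in the k-th diagonal entry after
  U D has been pushed to the left end.\<close>

definition opened_exponent :: "braid_word \<Rightarrow> nat \<Rightarrow> nat \<Rightarrow> int" where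
  "opened_exponent \<beta> r k =
     (if diag_perm (take r \<beta>) k = \<beta> ! r then - 1
      else if diag_perm (take r \<beta>) k = Suc (\<beta> ! r) then 1 else 0)"

context curve_pair
begin

text \<open>One exchange for every letter.  The effect on the diagonal depends on the word alone, which is
  why the final coefficients are constants.\<close>

lemma push_left_equiv:
  assumes "is_braid_word n \<beta>" "smooth_list (length \<beta>) Z"
    and "regular V" "\<And>q. q \<in> S \<Longrightarrow> upper_triangular (V q)"
    and "\<And>q. q \<in> S \<Longrightarrow> push_left n \<beta> (Z q) (V q) = (Z' q, W q)"
  shows "smooth_list (length \<beta>) Z' \<and> regular W \<and>
    (\<forall>q\<in>S. upper_triangular (W q) \<and> (\<forall>k<n. W q $$ (k, k) = V q $$ (diag_perm \<beta> k, diag_perm \<beta> k))) \<and>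
    equiv_factors (braid_factors \<beta> Z @ [V]) (W # braid_factors \<beta> Z')"
  using assms
proof (induction \<beta> arbitrary: Z Z' W)
  case Nil
  then have W: "W q = V q" "Z' q = []" if "q \<in> S" for q using that by auto
  have gW: "regular W" using Nil regular_cong[of W V] W by blast
  have "equiv_factors [V] [W]"
    using form_cong[of V W "\<lambda>_. 1\<^sub>m n"] Nil W gW by (auto simp: equiv_factors_def mprod_Nil)
  then show ?case using Nil W gW by (auto simp: smooth_list_def)
next
  case (Cons j \<beta>)
  have j: "Suc j < n" and \<beta>: "is_braid_word n \<beta>" using Cons by (auto simp: is_braid_word_def)
  have Z: "\<And>q. q \<in> S \<Longrightarrow> Z q \<noteq> []" and x: "smooth (\<lambda>q. hd (Z q))"
    and Zt: "smooth_list (length \<beta>) (\<lambda>q. tl (Z q))"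
    using Cons.prems(2) by (auto simp: smooth_list_Suc)
  define W1 where "W1 q = snd (push_left n \<beta> (tl (Z q)) (V q))" for q
  have rec: "push_left n \<beta> (tl (Z q)) (V q) = (tl (Z' q), W1 q)"
    "swap_upper n j (hd (Z q)) (W1 q) = (hd (Z' q), W q)" "Z' q \<noteq> []" if q: "q \<in> S" for q
  proof -
    have "push_left n (j # \<beta>) (hd (Z q) # tl (Z q)) (V q) = (Z' q, W q)"
      using Cons.prems(5)[OF q] Z[OF q] by simp
    then show "push_left n \<beta> (tl (Z q)) (V q) = (tl (Z' q), W1 q)"
      "swap_upper n j (hd (Z q)) (W1 q) = (hd (Z' q), W q)" "Z' q \<noteq> []"
      unfolding W1_def by (cases "Z' q"; auto split: prod.splits)+
  qed
  have IH: "smooth_list (length \<beta>) (\<lambda>q. tl (Z' q))" "regular W1"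
    "\<And>q. q \<in> S \<Longrightarrow> upper_triangular (W1 q)"
    "\<And>q k. q \<in> S \<Longrightarrow> k < n \<Longrightarrow> W1 q $$ (k, k) = V q $$ (diag_perm \<beta> k, diag_perm \<beta> k)"
    "equiv_factors (braid_factors \<beta> (\<lambda>q. tl (Z q)) @ [V]) (W1 # braid_factors \<beta> (\<lambda>q. tl (Z' q)))"
    using Cons.IH[OF \<beta> Zt Cons.prems(3,4) rec(1)] by blast+
  have swap: "hd (Z' q) = exch_var j (hd (Z q)) (W1 q)" "W q = exch_mat n j (hd (Z q)) (W1 q)"
    if q: "q \<in> S" for q
    using rec(2)[OF q] swap_upper_eq[OF j regularD(1)[OF IH(2) q] IH(3)[OF q], of "hd (Z q)"] by auto
  note ex = exchange_upper[OF j x IH(2,3) swap]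
  note em = exch_mat[OF j regularD(1)[OF IH(2)] IH(3)]
  have gB: "regular (\<lambda>q. braid_gen n j (hd (Z q)))" by (rule regular_braid_gen[OF j x])
  have gZ': "all_regular (braid_factors \<beta> (\<lambda>q. tl (Z' q)))" by (rule regular_braid_factors[OF \<beta> IH(1)])
  have "equiv_factors ([\<lambda>q. braid_gen n j (hd (Z q))] @ (braid_factors \<beta> (\<lambda>q. tl (Z q)) @ [V]) @ [])
      ([\<lambda>q. braid_gen n j (hd (Z q))] @ (W1 # braid_factors \<beta> (\<lambda>q. tl (Z' q))) @ [])"
    using gB by (intro equiv_factors_context[OF IH(5)]) auto
  moreover have "equiv_factors ([] @ [\<lambda>q. braid_gen n j (hd (Z q)), W1] @ braid_factors \<beta> (\<lambda>q. tl (Z' q)))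
      ([] @ [W, \<lambda>q. braid_gen n j (hd (Z' q))] @ braid_factors \<beta> (\<lambda>q. tl (Z' q)))"
    using gZ' ex by (intro equiv_factors_context) auto
  ultimately have "equiv_factors (braid_factors (j # \<beta>) Z @ [V]) (W # braid_factors (j # \<beta>) Z')"
    using equiv_factors_trans by simp
  moreover have "smooth_list (Suc (length \<beta>)) Z'"
    using ex IH(1) rec(3) by (auto simp: smooth_list_Suc)
  moreover have "W q $$ (k, k) = V q $$ (diag_perm (j # \<beta>) k, diag_perm (j # \<beta>) k)"
    if "q \<in> S" "k < n" for q k
  proof -
    have "Transposition.transpose j (Suc j) k < n" using that j by (auto simp: Transposition.transpose_def)
    then show ?thesis using that IH(4) swap em(4) by simp
  qed
  ultimately show ?case using ex swap em(2) by auto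
qed

text \<open>The matrix that is pushed to the right stays lower unitriangular, because an exchange only
  permutes the diagonal.\<close>

lemma push_right_equiv:
  assumes "is_braid_word n \<beta>" "smooth_list (length \<beta>) Z"
    and "regular L" "\<And>q. q \<in> S \<Longrightarrow> lower_unitriangular (L q)"
    and "\<And>q. q \<in> S \<Longrightarrow> push_right n (L q) \<beta> (Z q) = (Z' q, M q)"
  shows "smooth_list (length \<beta>) Z' \<and> regular M \<and> (\<forall>q\<in>S. lower_unitriangular (M q)) \<and>
    equiv_factors (L # braid_factors \<beta> Z) (braid_factors \<beta> Z' @ [M])"
  using assms
proof (induction \<beta> arbitrary: Z Z' L)
  case Nil
  then have M: "M q = L q" "Z' q = []" if "q \<in> S" for q using that by auto
  have gM: "regular M" using Nil regular_cong[of M L] M by blast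
  have "equiv_factors [L] [M]"
    using form_cong[of L M "\<lambda>_. 1\<^sub>m n"] Nil M gM by (auto simp: equiv_factors_def mprod_Nil)
  then show ?case using Nil M gM by (auto simp: smooth_list_def)
next
  case (Cons j \<beta>)
  have j: "Suc j < n" and \<beta>: "is_braid_word n \<beta>" using Cons by (auto simp: is_braid_word_def)
  have Z: "\<And>q. q \<in> S \<Longrightarrow> Z q \<noteq> []" and x: "smooth (\<lambda>q. hd (Z q))"
    and Zt: "smooth_list (length \<beta>) (\<lambda>q. tl (Z q))"
    using Cons.prems(2) by (auto simp: smooth_list_Suc)
  have lt: "lower_triangular (L q)" "upper_triangular (transpose_mat (L q))" if "q \<in> S" for q
    using Cons.prems(4)[OF that] by (auto simp: lower_unitriangular_def lower_triangular_def)
  define L1 where "L1 q = transpose_mat (exch_mat n j (hd (Z q)) (transpose_mat (L q)))" for q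
  have step: "Z' q = exch_var j (hd (Z q)) (transpose_mat (L q)) # tl (Z' q) \<and>
      push_right n (L1 q) \<beta> (tl (Z q)) = (tl (Z' q), M q)"
    if q: "q \<in> S" for q
  proof -
    have "push_right n (L q) (j # \<beta>) (hd (Z q) # tl (Z q)) = (Z' q, M q)"
      using Cons.prems(5)[OF q] Z[OF q] by simp
    then have "exch_var j (hd (Z q)) (transpose_mat (L q)) # fst (push_right n (L1 q) \<beta> (tl (Z q))) = Z' q \<and>
        snd (push_right n (L1 q) \<beta> (tl (Z q))) = M q"
      using swap_lower_eq[OF j regularD(1)[OF Cons.prems(3) q] lt(1)[OF q], of "hd (Z q)"]
      by (simp add: L1_def split: prod.splits)
    then show ?thesis by (metis list.sel(3) prod.collapse)
  qed
  have hd': "hd (Z' q) = exch_var j (hd (Z q)) (transpose_mat (L q))" if "q \<in> S" for q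
    using step[OF that] by (metis list.sel(1))
  note ex = exchange_lower[OF j x Cons.prems(3) lt(1) hd' L1_def]
  have uL1: "lower_unitriangular (L1 q)" if q: "q \<in> S" for q
  proof -
    have u: "unit_mat n (transpose_mat (L q))" using regularD(1)[OF Cons.prems(3) q] by simp
    note em = exch_mat[OF j u lt(2)[OF q], where z = "hd (Z q)"]
    have c: "L q \<in> carrier_mat n n" "L1 q \<in> carrier_mat n n"
      "exch_mat n j (hd (Z q)) (transpose_mat (L q)) \<in> carrier_mat n n"
      using regularD(2)[OF Cons.prems(3) q] unit_matD(1)[OF em(1)] by (auto simp: L1_def)
    have "L1 q $$ (k, k) = 1" if "k < n" for k
    proof -
      let ?t = "Transposition.transpose j (Suc j) k"
      have "?t < n" using that j by (auto simp: Transposition.transpose_def)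
      then show ?thesis
        using that em(4)[OF that] c Cons.prems(4)[OF q] by (simp add: L1_def lower_unitriangular_def)
    qed
    then show ?thesis using em(2) c by (simp add: lower_unitriangular_def lower_triangular_def L1_def)
  qed
  have IH: "smooth_list (length \<beta>) (\<lambda>q. tl (Z' q)) \<and> regular M \<and> (\<forall>q\<in>S. lower_unitriangular (M q)) \<and>
    equiv_factors (L1 # braid_factors \<beta> (\<lambda>q. tl (Z q))) (braid_factors \<beta> (\<lambda>q. tl (Z' q)) @ [M])"
    by (rule Cons.IH[OF \<beta> Zt]) (use ex uL1 step in auto)
  have gZ: "all_regular (braid_factors \<beta> (\<lambda>q. tl (Z q)))" by (rule regular_braid_factors[OF \<beta> Zt])
  have gB: "regular (\<lambda>q. braid_gen n j (hd (Z' q)))" using ex by (intro regular_braid_gen j) auto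
  have "equiv_factors ([] @ [L, \<lambda>q. braid_gen n j (hd (Z q))] @ braid_factors \<beta> (\<lambda>q. tl (Z q)))
      ([] @ [\<lambda>q. braid_gen n j (hd (Z' q)), L1] @ braid_factors \<beta> (\<lambda>q. tl (Z q)))"
    using gZ ex by (intro equiv_factors_context) auto
  moreover have "equiv_factors ([\<lambda>q. braid_gen n j (hd (Z' q))] @ (L1 # braid_factors \<beta> (\<lambda>q. tl (Z q))) @ [])
      ([\<lambda>q. braid_gen n j (hd (Z' q))] @ (braid_factors \<beta> (\<lambda>q. tl (Z' q)) @ [M]) @ [])"
    using gB IH by (intro equiv_factors_context) auto
  ultimately have "equiv_factors (L # braid_factors (j # \<beta>) Z) (braid_factors (j # \<beta>) Z' @ [M])"
    using equiv_factors_trans by simp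
  moreover have "Z' q \<noteq> []" if "q \<in> S" for q using step[OF that] by (metis list.distinct(1))
  then have "smooth_list (Suc (length \<beta>)) Z'"
    using ex IH by (auto simp: smooth_list_Suc)
  ultimately show ?case using IH by auto
qed

lemma equiv_factors_merge:
  assumes "regular L" "\<And>q. q \<in> S \<Longrightarrow> lower_unitriangular (L q)"
    and "regular M" "\<And>q. q \<in> S \<Longrightarrow> lower_unitriangular (M q)"
  shows "equiv_factors [L, M] [\<lambda>q. L q * M q]"
proof -
  have g: "regular (\<lambda>q. L q * M q)" using assms by (intro regular_mult)
  have "form L (mprod [M]) = form L M"
    using regularD(2)[OF assms(3)] by (intro form_cong) (auto simp: right_mult_one_mat[of _ n n])
  also have "\<dots> = 0" by (rule form_lower_unitriangular[OF assms])
  finally have "form L (mprod [M]) = 0" .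
  then show ?thesis
    using assms g regularD(2)[OF assms(1)] regularD(2)[OF assms(3)]
    by (auto simp: equiv_factors_def mprod_Nil assoc_mult_mat[of _ n n _ n _ n])
qed

text \<open>The factor at the crossing is split into U D and L, which leave on the two sides; the matrix L'
  that arrives on the right is absorbed into M.  In this way M stands for \<open>L(c)\<close> and \<open>M'\<close> for
  \<open>L(c') = L' L(c)\<close>.  The word and its variables evolve independently of c, which is why the
  argument can follow the matrix \<open>L(c)\<close> itself.\<close>

lemma open_crossing_equiv:
  assumes \<beta>: "is_braid_word n \<beta>" and r: "r < length \<beta>" and Z: "smooth_list (length \<beta>) Z"
    and nz: "\<And>q. q \<in> S \<Longrightarrow> Z q ! r \<noteq> 0"
    and M: "regular M" "\<And>q. q \<in> S \<Longrightarrow> lower_unitriangular (M q)"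
    and Z': "\<And>q. q \<in> S \<Longrightarrow> Z' q = fst (snd (open_crossing n r (\<beta>, Z q, c q)))"
  defines "\<beta>' \<equiv> take r \<beta> @ drop (Suc r) \<beta>"
  obtains V M' where "smooth_list (length \<beta>') Z'"
    "regular V" "\<And>q. q \<in> S \<Longrightarrow> upper_triangular (V q)"
    "\<And>d k. d \<in> {\<gamma>, \<delta>} \<Longrightarrow> k < n \<Longrightarrow>
      log_deriv d (\<lambda>q. V q $$ (k, k)) = of_int (opened_exponent \<beta> r k) * log_deriv d (\<lambda>q. Z q ! r)"
    "regular M'" "\<And>q. q \<in> S \<Longrightarrow> lower_unitriangular (M' q)"
    "equiv_factors (braid_factors \<beta> Z @ [M]) (V # braid_factors \<beta>' Z' @ [M'])"
proof -
  let ?i = "\<beta> ! r" and ?l = "take r \<beta>" and ?r = "drop (Suc r) \<beta>"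
  let ?zl = "\<lambda>q. take r (Z q)" and ?zr = "\<lambda>q. drop (Suc r) (Z q)"
  define x where "x q = hd (drop r (Z q))" for q
  have x_eq: "x q = Z q ! r" if "q \<in> S" for q
    using Z that r by (simp add: x_def smooth_list_def hd_drop_conv_nth)
  define UD where "UD q = U_mat n ?i (x q) * D_mat n ?i (x q)" for q
  define L where "L q = L_mat n ?i (x q)" for q
  define V where "V q = snd (push_left n ?l (?zl q) (UD q))" for q
  define L' where "L' q = snd (push_right n (L q) ?r (?zr q))" for q
  have lens: "length ?l = r" "length ?r = length \<beta> - Suc r" using r by auto
  have wl: "is_braid_word n ?l" and wr: "is_braid_word n ?r" and i: "Suc ?i < n"
    using \<beta> r set_take_subset[of r \<beta>] set_drop_subset[of "Suc r" \<beta>] nth_mem[OF r]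
    unfolding is_braid_word_def by blast+
  have sx: "smooth x"
    by (subst smooth_cong[OF x_eq]) (use Z r in \<open>auto simp: smooth_list_def\<close>)
  have xnz: "x q \<noteq> 0" if "q \<in> S" for q using nz x_eq that by simp
  note sp = split_braid_gen[OF i sx xnz, folded UD_def L_def]
  have UDb: "UD q = block_gen n ?i (- inverse (x q)) 1 0 (x q)" if "q \<in> S" for q
    using xnz[OF that] i by (simp add: UD_def U_mat_def D_mat_def block_gen_mult)
  have UDu: "upper_triangular (UD q)" if "q \<in> S" for q
    by (auto simp: UDb[OF that] block_gen_def intro!: upper_triangularI)
  have Lu: "lower_unitriangular (L q)" for q
    by (auto simp: L_def L_mat_def lower_unitriangular_def lower_triangular_def block_gen_def
        intro!: upper_triangularI)
  have zl: "smooth_list (length ?l) ?zl" using smooth_list_take[OF Z, of r] r by simp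
  have zr: "smooth_list (length ?r) ?zr" using smooth_list_drop[OF Z, of "Suc r"] r by simp
  have Z'_eq: "Z' q = fst (push_left n ?l (?zl q) (UD q)) @ fst (push_right n (L q) ?r (?zr q))"
    if "q \<in> S" for q
    by (auto simp: Z'[OF that] Let_def L_def UD_def x_eq[OF that] split: prod.splits)
  have Z'_parts: "take r (Z' q) = fst (push_left n ?l (?zl q) (UD q))"
    "drop r (Z' q) = fst (push_right n (L q) ?r (?zr q))" if "q \<in> S" for q
  proof -
    have "length (fst (push_left n ?l (?zl q) (UD q))) = r"
      using push_left_length[of "?zl q" ?l] zl that lens by (simp add: smooth_list_def)
    then show "take r (Z' q) = fst (push_left n ?l (?zl q) (UD q))"
      "drop r (Z' q) = fst (push_right n (L q) ?r (?zr q))" by (simp_all add: Z'_eq[OF that])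
  qed
  let ?Bl = "braid_factors ?l ?zl" and ?Br = "braid_factors ?r ?zr"
  let ?Bl' = "braid_factors ?l (\<lambda>q. take r (Z' q))" and ?Br' = "braid_factors ?r (\<lambda>q. drop r (Z' q))"
  have pl: "smooth_list (length ?l) (\<lambda>q. take r (Z' q)) \<and> regular V \<and>
    (\<forall>q\<in>S. upper_triangular (V q) \<and> (\<forall>k<n. V q $$ (k, k) = UD q $$ (diag_perm ?l k, diag_perm ?l k))) \<and>
    equiv_factors (?Bl @ [UD]) (V # ?Bl')"
    by (rule push_left_equiv[OF wl zl sp(1) UDu]) (auto simp: V_def Z'_parts)
  have pr: "smooth_list (length ?r) (\<lambda>q. drop r (Z' q)) \<and> regular L' \<and> (\<forall>q\<in>S. lower_unitriangular (L' q)) \<and>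
    equiv_factors (L # ?Br) (?Br' @ [L'])"
    by (rule push_right_equiv[OF wr zr sp(2) Lu]) (auto simp: L'_def Z'_parts)
  have regular: "all_regular ?Bl" "all_regular ?Br" "all_regular ?Bl'" "all_regular ?Br'" "regular V" "regular L" "regular L'"
    using regular_braid_factors[OF wl zl] regular_braid_factors[OF wr zr] pl pr sp
      regular_braid_factors[OF wl, of "\<lambda>q. take r (Z' q)"]
      regular_braid_factors[OF wr, of "\<lambda>q. drop r (Z' q)"] by auto
  define M' where "M' q = L' q * M q" for q
  have factors: "braid_factors \<beta> Z = ?Bl @ (\<lambda>q. braid_gen n ?i (x q)) # ?Br"
  proof -
    have "braid_factors (?l @ ?i # ?r) Z = ?Bl @ (\<lambda>q. braid_gen n ?i (x q)) # ?Br"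
      using lens by (simp add: braid_factors_append x_def tl_drop drop_Suc)
    then show ?thesis using id_take_nth_drop[OF r] by simp
  qed
  have factors': "braid_factors \<beta>' Z' = ?Bl' @ ?Br'"
    using lens by (simp add: \<beta>'_def braid_factors_append)
  \<comment> \<open>Split the crossing, push U D to the left, push L to the right, absorb L' into M.\<close>
  have 1: "equiv_factors (?Bl @ [\<lambda>q. braid_gen n ?i (x q)] @ (?Br @ [M])) (?Bl @ [UD, L] @ (?Br @ [M]))"
    using regular M sp by (intro equiv_factors_context) auto
  have 2: "equiv_factors ([] @ (?Bl @ [UD]) @ (L # ?Br @ [M])) ([] @ (V # ?Bl') @ (L # ?Br @ [M]))"
    using regular M pl by (intro equiv_factors_context) auto
  have 3: "equiv_factors ((V # ?Bl') @ (L # ?Br) @ [M]) ((V # ?Bl') @ (?Br' @ [L']) @ [M])"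
    using regular M pr by (intro equiv_factors_context) auto
  have "equiv_factors [L', M] [M']"
    unfolding M'_def by (rule equiv_factors_merge) (use pr M in auto)
  then have 4: "equiv_factors ((V # ?Bl' @ ?Br') @ [L', M] @ []) ((V # ?Bl' @ ?Br') @ [M'] @ [])"
    using regular by (intro equiv_factors_context) auto
  have eq: "equiv_factors (braid_factors \<beta> Z @ [M]) (V # braid_factors \<beta>' Z' @ [M'])"
    using equiv_factors_trans[OF 1] equiv_factors_trans[OF 2] equiv_factors_trans[OF 3] 4
    by (simp add: factors factors')
  have sZ': "smooth_list (length \<beta>') Z'"
  proof -
    have "smooth_list (length ?l + length ?r) (\<lambda>q. take r (Z' q) @ drop r (Z' q))"
      using pl pr by (intro smooth_list_append) auto
    then show ?thesis by (simp add: \<beta>'_def)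
  qed
  have ld: "log_deriv d (\<lambda>q. V q $$ (k, k)) = of_int (opened_exponent \<beta> r k) * log_deriv d (\<lambda>q. Z q ! r)"
    if d: "d \<in> {\<gamma>, \<delta>}" and k: "k < n" for d k
  proof -
    let ?m = "diag_perm ?l k"
    have m: "?m < n" by (rule diag_perm_less[OF wl k])
    have e: "V q $$ (k, k) = (if ?m = ?i then - inverse (x q) else if ?m = Suc ?i then x q else 1)"
      if "q \<in> S" for q
      using pl that k m i by (auto simp: UDb block_gen_def)
    have "log_deriv d (\<lambda>q. V q $$ (k, k)) = of_int (opened_exponent \<beta> r k) * log_deriv d x"
      using log_deriv_cong[OF d e] log_deriv_minus_inverse[OF d sx xnz[OF p_in]]
        log_deriv_const[OF d refl] by (auto simp: opened_exponent_def)
    also have "log_deriv d x = log_deriv d (\<lambda>q. Z q ! r)"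
      by (rule log_deriv_cong[OF d x_eq])
    finally show ?thesis .
  qed
  show thesis
  proof (rule that[OF sZ' _ _ ld _ _ eq])
    show "regular M'" unfolding M'_def using regular M by (intro regular_mult) auto
    show "lower_unitriangular (M' q)" if "q \<in> S" for q
      unfolding M'_def
      using that pr M regularD(2)[OF regular(7) that] regularD(2)[OF M(1) that]
      by (intro lower_unitriangular_mult[of _ _ n]) auto
  qed (use pl in auto)
qed

end

section \<open>The half twist\<close>

text \<open>Every letter creates a new inversion when the word is read after \<pi>.  For the identity this
  says that the word is reduced.\<close>

fun ascending :: "(nat \<Rightarrow> nat) \<Rightarrow> braid_word \<Rightarrow> bool" where
  "ascending \<pi> [] = True"
| "ascending \<pi> (i # \<beta>) = (\<pi> i < \<pi> (Suc i) \<and> ascending (\<pi> \<circ> Transposition.transpose i (Suc i)) \<beta>)"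

fun word_perm :: "(nat \<Rightarrow> nat) \<Rightarrow> braid_word \<Rightarrow> nat \<Rightarrow> nat" where
  "word_perm \<pi> [] = \<pi>"
| "word_perm \<pi> (i # \<beta>) = word_perm (\<pi> \<circ> Transposition.transpose i (Suc i)) \<beta>"

lemma ascending_append:
  "ascending \<pi> (\<beta> @ \<beta>') \<longleftrightarrow> ascending \<pi> \<beta> \<and> ascending (word_perm \<pi> \<beta>) \<beta>'"
  by (induction \<beta> arbitrary: \<pi>) auto

lemma word_perm_append: "word_perm \<pi> (\<beta> @ \<beta>') = word_perm (word_perm \<pi> \<beta>) \<beta>'"
  by (induction \<beta> arbitrary: \<pi>) auto

text \<open>The permutation of one row \<open>\<sigma>\<^sub>1 \<cdots> \<sigma>\<^sub>q\<close> of the half twist.\<close>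

definition row_cycle :: "nat \<Rightarrow> nat \<Rightarrow> nat" where
  "row_cycle q k = (if k < q then Suc k else if k = q then 0 else k)"

lemma word_perm_row: "word_perm \<pi> [0..<q] = \<pi> \<circ> row_cycle q"
proof (induction q)
  case 0
  then show ?case by (auto simp: row_cycle_def)
next
  case (Suc q)
  have "row_cycle q \<circ> Transposition.transpose q (Suc q) = row_cycle (Suc q)"
    by (rule ext) (auto simp: row_cycle_def Transposition.transpose_def)
  moreover have "word_perm \<pi> [0..<Suc q] = word_perm \<pi> [0..<q] \<circ> Transposition.transpose q (Suc q)"
    by (simp add: word_perm_append)
  ultimately show ?case by (simp only: Suc comp_assoc)
qed

lemma ascending_row:
  "ascending \<pi> [0..<q] \<longleftrightarrow> (\<forall>k<q. \<pi> 0 < \<pi> (Suc k))"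
proof (induction q)
  case (Suc q)
  then show ?case
    by (auto simp: ascending_append word_perm_row row_cycle_def less_Suc_eq)
qed simp

text \<open>The permutation reached after the first b rows of the half twist.\<close>

definition rows_perm :: "nat \<Rightarrow> nat \<Rightarrow> nat \<Rightarrow> nat" where
  "rows_perm n b k = (if k < n - b then k + b else n - 1 - k)"

lemma rows_perm_Suc:
  assumes "Suc b < n" "k < n"
  shows "(rows_perm n b \<circ> row_cycle (n - 1 - b)) k = rows_perm n (Suc b) k"
  using assms by (auto simp: rows_perm_def row_cycle_def)

lemma word_perm_cong:
  assumes "is_braid_word n \<beta>" "\<And>k. k < n \<Longrightarrow> \<pi> k = \<pi>' k"
  shows "k < n \<Longrightarrow> word_perm \<pi> \<beta> k = word_perm \<pi>' \<beta> k" "ascending \<pi> \<beta> = ascending \<pi>' \<beta>"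
proof -
  have "(\<forall>k<n. word_perm \<pi> \<beta> k = word_perm \<pi>' \<beta> k) \<and> ascending \<pi> \<beta> = ascending \<pi>' \<beta>"
    using assms
  proof (induction \<beta> arbitrary: \<pi> \<pi>')
    case (Cons i \<beta>)
    then have "(\<pi> \<circ> Transposition.transpose i (Suc i)) k = (\<pi>' \<circ> Transposition.transpose i (Suc i)) k"
      if "k < n" for k
      using that by (auto simp: is_braid_word_def Transposition.transpose_def)
    moreover have "is_braid_word n \<beta>" "\<pi> i = \<pi>' i" "\<pi> (Suc i) = \<pi>' (Suc i)"
      using Cons.prems by (auto simp: is_braid_word_def)
    ultimately show ?case
      using Cons.IH[of "\<pi> \<circ> Transposition.transpose i (Suc i)" "\<pi>' \<circ> Transposition.transpose i (Suc i)"]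
      by (simp only: word_perm.simps ascending.simps) blast
  qed simp
  then show "k < n \<Longrightarrow> word_perm \<pi> \<beta> k = word_perm \<pi>' \<beta> k" "ascending \<pi> \<beta> = ascending \<pi>' \<beta>" by auto
qed

lemma rev_upt_Suc: "b < n \<Longrightarrow> rev [1..<n - b] = (if Suc b < n then (n - 1 - b) # rev [1..<n - Suc b] else [])"
proof (cases "Suc b < n")
  case True
  then have "n - b = Suc (n - 1 - b)" "n - Suc b = n - 1 - b" "1 \<le> n - 1 - b" by auto
  then show ?thesis using True by (metis list.simps(8,9) rev.simps(2) rev_append rev_singleton_conv upt_Suc_append append_Cons append_Nil)
qed auto

lemma braid_word_Delta: "is_braid_word n (Delta n)"
  by (auto simp: is_braid_word_def Delta_def)

text \<open>Row number b of the half twist, counted from 0, is \<open>\<sigma>\<^sub>1 \<cdots> \<sigma>\<^bsub>n-1-b\<^esub>\<close>, and the induction peels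
  off one row at a time.\<close>

lemma Delta_rows:
  assumes "b < n"
  shows "ascending (rows_perm n b) (concat (map (\<lambda>k. [0..<k]) (rev [1..<n - b]))) \<and>
    (\<forall>k<n. word_perm (rows_perm n b) (concat (map (\<lambda>k. [0..<k]) (rev [1..<n - b]))) k = w0 n k)"
  using assms
proof (induction "n - b" arbitrary: b)
  case (Suc m)
  let ?w = "\<lambda>b. concat (map (\<lambda>k. [0..<k]) (rev [1..<n - b]))"
  show ?case
  proof (cases "Suc b < n")
    case True
    have w: "?w b = [0..<n - 1 - b] @ ?w (Suc b)"
      using rev_upt_Suc[OF Suc.prems] True by simp
    have IH: "ascending (rows_perm n (Suc b)) (?w (Suc b)) \<and>
      (\<forall>k<n. word_perm (rows_perm n (Suc b)) (?w (Suc b)) k = w0 n k)"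
      using Suc True by simp
    have bw: "is_braid_word n (?w (Suc b))" by (auto simp: is_braid_word_def)
    let ?\<rho> = "rows_perm n b \<circ> row_cycle (n - 1 - b)"
    have c: "ascending ?\<rho> (?w (Suc b)) = ascending (rows_perm n (Suc b)) (?w (Suc b))"
      "\<And>k. k < n \<Longrightarrow> word_perm ?\<rho> (?w (Suc b)) k = word_perm (rows_perm n (Suc b)) (?w (Suc b)) k"
      using word_perm_cong[OF bw, of ?\<rho> "rows_perm n (Suc b)"] rows_perm_Suc[OF True] by blast+
    have "ascending (rows_perm n b) [0..<n - 1 - b]"
      unfolding ascending_row by (auto simp: rows_perm_def)
    then show ?thesis
      using IH c by (simp only: w ascending_append word_perm_append word_perm_row) blast
  next
    case False
    then have b: "b = n - 1" using Suc.prems by simp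
    have "?w b = []" using rev_upt_Suc[OF Suc.prems] False by (simp only: if_False list.map concat.simps)
    moreover have "rows_perm n b k = w0 n k" if "k < n" for k
      using b that by (auto simp: rows_perm_def w0_def)
    ultimately show ?thesis by (simp only: ascending.simps word_perm.simps) blast
  qed
qed simp

lemma Delta_reduced:
  shows "ascending id (Delta n)" "k < n \<Longrightarrow> word_perm id (Delta n) k = w0 n k"
proof -
  have "ascending id (Delta n) \<and> (\<forall>k<n. word_perm id (Delta n) k = w0 n k)"
  proof (cases "n = 0")
    case True
    then show ?thesis by (simp add: Delta_def)
  next
    case False
    have "rows_perm n 0 k = id k" if "k < n" for k using that by (simp add: rows_perm_def)
    then have "ascending (rows_perm n 0) (Delta n) = ascending id (Delta n)"
      "\<And>k. k < n \<Longrightarrow> word_perm (rows_perm n 0) (Delta n) k = word_perm id (Delta n) k"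
      using word_perm_cong[OF braid_word_Delta, of n "rows_perm n 0" id] by blast+
    then show ?thesis using Delta_rows[of 0 n] False by (simp add: Delta_def del: upt_Suc)
  qed
  then show "ascending id (Delta n)" "k < n \<Longrightarrow> word_perm id (Delta n) k = w0 n k" by auto
qed

subsection \<open>Moving permutation matrices through a braid\<close>

lemma perm_mat_cong: "(\<And>k. k < n \<Longrightarrow> \<pi> k = \<rho> k) \<Longrightarrow> perm_mat n \<pi> = perm_mat n \<rho>"
  unfolding perm_mat_def by (rule cong_mat) auto

lemma mult_perm_mat_entry:
  assumes "A \<in> carrier_mat n n" "r < n" "s < n" "\<pi> s < n"
  shows "(A * perm_mat n \<pi>) $$ (r, s) = A $$ (r, \<pi> s)"
proof -
  have "(A * perm_mat n \<pi>) $$ (r, s) = (\<Sum>k<n. A $$ (r, k) * (if k = \<pi> s then 1 else 0))"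
    using mat_mult_entry[OF assms(1) perm_mat_carrier assms(2,3)] assms by (simp add: perm_mat_def)
  then show ?thesis using assms by (simp add: if_distrib cong: if_cong)
qed

lemma perm_mat_mult:
  assumes "\<And>k. k < n \<Longrightarrow> \<rho> k < n"
  shows "perm_mat n \<pi> * perm_mat n \<rho> = perm_mat n (\<pi> \<circ> \<rho>)"
proof (rule eq_matI, goal_cases)
  case (1 r s)
  then have "r < n" "s < n" by (auto simp: perm_mat_def)
  then show ?case
    using mult_perm_mat_entry[OF perm_mat_carrier, of r n s \<rho> \<pi>] assms by (simp add: perm_mat_def)
qed (auto simp: perm_mat_def)

lemma unit_perm_mat:
  assumes "bij_betw \<pi> {..<n} {..<n}"
  shows "unit_mat n (perm_mat n \<pi>)"
proof -
  let ?\<rho> = "inv_into {..<n} \<pi>"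
  have inv: "?\<rho> k < n" "\<pi> (?\<rho> k) = k" "?\<rho> (\<pi> k) = k" "\<pi> k < n" if "k < n" for k
    using assms that bij_betw_inv_into[OF assms] bij_betw_inv_into_left[OF assms, of k]
      bij_betw_inv_into_right[OF assms, of k] by (auto simp: bij_betw_def)
  have one: "perm_mat n \<sigma> = 1\<^sub>m n" if "\<And>k. k < n \<Longrightarrow> \<sigma> k = k" for \<sigma>
    by (rule eq_matI) (auto simp: perm_mat_def that)
  show ?thesis
    by (rule unit_matI[of _ _ "perm_mat n ?\<rho>"]) (auto simp: perm_mat_mult inv intro!: one)
qed

text \<open>The elementary matrix 1 + x E(a, b).\<close>

definition elem_mat :: "nat \<Rightarrow> nat \<Rightarrow> nat \<Rightarrow> complex \<Rightarrow> complex mat" where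
  "elem_mat n a b x = mat n n (\<lambda>(r, s). if r = a \<and> s = b then x else if r = s then 1 else 0)"

lemma elem_mat_carrier [simp]: "elem_mat n a b x \<in> carrier_mat n n"
  by (simp add: elem_mat_def)

lemma lower_elem_mat: "b < a \<Longrightarrow> lower_unitriangular (elem_mat n a b x)"
  by (auto simp: elem_mat_def lower_unitriangular_def lower_triangular_def intro!: upper_triangularI)

text \<open>Since \<open>B\<^sub>i(x) = (1 + x E(i + 1, i)) s\<^sub>i\<close>, and conjugation by \<pi> permutes the indices of an
  elementary matrix.\<close>

lemma perm_mat_braid_gen:
  assumes "bij_betw \<pi> {..<n} {..<n}" and i: "Suc i < n"
  shows "perm_mat n \<pi> * braid_gen n i x =
    elem_mat n (\<pi> (Suc i)) (\<pi> i) x * perm_mat n (\<pi> \<circ> Transposition.transpose i (Suc i))"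
proof (rule eq_matI, goal_cases)
  case (1 r s)
  have pn: "\<pi> k < n" if "k < n" for k using assms that by (auto simp: bij_betw_def)
  have inj: "\<pi> a = \<pi> b \<longleftrightarrow> a = b" if "a < n" "b < n" for a b
    using assms that by (auto simp: bij_betw_def inj_on_def)
  have rs: "r < n" "s < n" using 1 by (auto simp: elem_mat_def perm_mat_def)
  let ?t = "Transposition.transpose i (Suc i)"
  have t: "?t s < n" using i rs by (auto simp: Transposition.transpose_def)
  obtain k where k: "k < n" "r = \<pi> k" using assms rs by (metis bij_betw_iff_bijections lessThan_iff)
  have "(perm_mat n \<pi> * braid_gen n i x) $$ (r, s) = (\<Sum>m<n. if m = k then braid_gen n i x $$ (k, s) else 0)"
    unfolding mat_mult_entry[OF perm_mat_carrier braid_gen_carrier rs]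
    using rs k inj by (intro sum.cong) (auto simp: perm_mat_def)
  also have "\<dots> = braid_gen n i x $$ (k, s)" using k by simp
  also have "\<dots> = elem_mat n (\<pi> (Suc i)) (\<pi> i) x $$ (r, \<pi> (?t s))"
    using k rs i t pn inj by (auto simp: elem_mat_def braid_gen_def block_gen_def Transposition.transpose_def)
  also have "\<dots> = (elem_mat n (\<pi> (Suc i)) (\<pi> i) x * perm_mat n (\<pi> \<circ> ?t)) $$ (r, s)"
    using mult_perm_mat_entry[OF elem_mat_carrier rs, of "\<pi> \<circ> ?t"] pn[OF t] by simp
  finally show ?case .
qed (auto simp: elem_mat_def perm_mat_def braid_gen_def block_gen_def)

lemma bij_transpose_comp:
  assumes "bij_betw \<pi> {..<n} {..<n}" "Suc i < n"
  shows "bij_betw (\<pi> \<circ> Transposition.transpose i (Suc i)) {..<n} {..<n}"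
proof (rule bij_betw_trans[OF _ assms(1)])
  have "Transposition.transpose i (Suc i) permutes {..<n}"
    using assms by (intro permutes_swap_id) auto
  then show "bij_betw (Transposition.transpose i (Suc i)) {..<n} {..<n}"
    by (rule permutes_imp_bij)
qed

context curve_pair
begin

lemma regular_elem_mat:
  assumes "a \<noteq> b" "a < n" "b < n" "smooth x"
  shows "regular (\<lambda>q. elem_mat n a b (x q))"
proof -
  have inv: "elem_mat n a b y * elem_mat n a b (- y) = 1\<^sub>m n" for y
  proof (rule eq_matI, goal_cases)
    case (1 r s)
    then have rs: "r < n" "s < n" by auto
    have "(elem_mat n a b y * elem_mat n a b (- y)) $$ (r, s) =
      (\<Sum>k<n. (if k = r then elem_mat n a b (- y) $$ (r, s) else 0) +
        (if k = b then (if r = a then y * elem_mat n a b (- y) $$ (b, s) else 0) else 0))"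
      unfolding mat_mult_entry[OF elem_mat_carrier elem_mat_carrier rs]
      using rs assms by (intro sum.cong) (auto simp: elem_mat_def)
    also have "\<dots> = elem_mat n a b (- y) $$ (r, s) + (if r = a then y * elem_mat n a b (- y) $$ (b, s) else 0)"
      using rs assms by (simp add: sum.distrib)
    finally show ?case using rs assms by (auto simp: elem_mat_def)
  qed (auto simp: elem_mat_def)
  have "unit_mat n (elem_mat n a b y)" for y
    by (rule unit_matI[of _ _ "elem_mat n a b (- y)"]) (use inv[of y] inv[of "- y"] in auto)
  then show ?thesis
    using assms by (auto simp: regular_def elem_mat_def intro!: smooth_if)
qed

text \<open>Moving the permutation matrices to the right turns a reduced braid into a product of lower
  unitriangular matrices, and these pair to zero among each other.\<close>

lemma reduced_braid_factors:
  assumes "is_braid_word n \<beta>" "smooth_list (length \<beta>) Z" "bij_betw \<pi> {..<n} {..<n}" "ascending \<pi> \<beta>"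
  shows "prod_form (braid_factors \<beta> Z) = 0 \<and> bij_betw (word_perm \<pi> \<beta>) {..<n} {..<n} \<and>
    (\<exists>N. regular N \<and> (\<forall>q\<in>S. lower_unitriangular (N q) \<and>
      perm_mat n \<pi> * mprod (braid_factors \<beta> Z) q = N q * perm_mat n (word_perm \<pi> \<beta>)))"
  using assms
proof (induction \<beta> arbitrary: Z \<pi>)
  case Nil
  have "regular (\<lambda>_. 1\<^sub>m n)" by (rule regular_const) simp
  then show ?case
    using Nil by (auto intro!: exI[of _ "\<lambda>_. 1\<^sub>m n"]
        simp: right_mult_one_mat[OF perm_mat_carrier] left_mult_one_mat[OF perm_mat_carrier])
next
  case (Cons i \<beta>)
  let ?\<pi> = "\<pi> \<circ> Transposition.transpose i (Suc i)" and ?x = "\<lambda>q. hd (Z q)"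
  let ?B = "\<lambda>q. braid_gen n i (hd (Z q))" and ?Bs = "mprod (braid_factors \<beta> (\<lambda>q. tl (Z q)))"
  let ?P = "perm_mat n \<pi>" and ?P' = "perm_mat n ?\<pi>" and ?Q = "perm_mat n (word_perm ?\<pi> \<beta>)"
  have i: "Suc i < n" and \<beta>: "is_braid_word n \<beta>" using Cons by (auto simp: is_braid_word_def)
  have x: "smooth ?x" and Zt: "smooth_list (length \<beta>) (\<lambda>q. tl (Z q))"
    using Cons.prems(2) by (auto simp: smooth_list_Suc)
  have bij: "bij_betw ?\<pi> {..<n} {..<n}" by (rule bij_transpose_comp[OF Cons.prems(3) i])
  have lt: "\<pi> i < \<pi> (Suc i)" and asc: "ascending ?\<pi> \<beta>" using Cons.prems(4) by auto
  obtain N where N: "regular N" "\<And>q. q \<in> S \<Longrightarrow> lower_unitriangular (N q)"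
    "\<And>q. q \<in> S \<Longrightarrow> ?P' * ?Bs q = N q * ?Q"
    and IH: "prod_form (braid_factors \<beta> (\<lambda>q. tl (Z q))) = 0" "bij_betw (word_perm ?\<pi> \<beta>) {..<n} {..<n}"
    using Cons.IH[OF \<beta> Zt bij asc] by blast
  define E where "E q = elem_mat n (\<pi> (Suc i)) (\<pi> i) (hd (Z q))" for q
  have pn: "\<pi> i < n" "\<pi> (Suc i) < n" using Cons.prems(3) i by (auto simp: bij_betw_def)
  have E: "regular E" unfolding E_def using pn lt x by (intro regular_elem_mat) auto
  have El: "lower_unitriangular (E q)" for q unfolding E_def by (rule lower_elem_mat[OF lt])
  have PB: "?P * ?B q = E q * ?P'" for q
    unfolding E_def by (rule perm_mat_braid_gen[OF Cons.prems(3) i])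
  have P: "unit_mat n ?P" "unit_mat n ?P'" "unit_mat n ?Q"
    using Cons.prems(3) bij IH(2) by (auto intro: unit_perm_mat)
  have B: "regular ?B" by (rule regular_braid_gen[OF i x])
  have Bs: "regular ?Bs" by (rule regular_mprod[OF regular_braid_factors[OF \<beta> Zt]])
  have "form ?B ?Bs = form (\<lambda>q. ?P * ?B q) ?Bs"
    by (rule form_const_mult_left[OF P(1) B Bs, symmetric])
  also have "\<dots> = form (\<lambda>q. E q * ?P') ?Bs" by (simp only: PB)
  also have "\<dots> = form E (\<lambda>q. ?P' * ?Bs q)" by (rule form_const_shift[OF P(2) E Bs])
  also have "\<dots> = form E (\<lambda>q. N q * ?Q)" by (rule form_cong[OF refl N(3)])
  also have "\<dots> = form E N" by (rule form_const_mult_right[OF P(3) E N(1)])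
  also have "\<dots> = 0" by (rule form_lower_unitriangular[OF E El N(1,2)])
  finally have 0: "prod_form (braid_factors (i # \<beta>) Z) = 0" using IH(1) by simp
  have "lower_unitriangular (E q * N q) \<and>
      ?P * mprod (braid_factors (i # \<beta>) Z) q = E q * N q * perm_mat n (word_perm \<pi> (i # \<beta>))"
    if q: "q \<in> S" for q
  proof
    note c = regularD(2)[OF E q] regularD(2)[OF N(1) q] regularD(2)[OF Bs q]
    show "lower_unitriangular (E q * N q)"
      by (rule lower_unitriangular_mult[OF El N(2)[OF q] c(1,2)])
    have "?P * (?B q * ?Bs q) = (?P * ?B q) * ?Bs q"
      using c by (subst assoc_mult_mat[of _ n n _ n _ n]) auto
    also have "\<dots> = E q * (?P' * ?Bs q)"
      unfolding PB using c by (subst assoc_mult_mat[of _ n n _ n _ n]) auto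
    also have "\<dots> = E q * N q * ?Q"
      unfolding N(3)[OF q] using c by (subst assoc_mult_mat[of _ n n _ n _ n]) auto
    finally show "?P * mprod (braid_factors (i # \<beta>) Z) q = E q * N q * perm_mat n (word_perm \<pi> (i # \<beta>))"
      by simp
  qed
  then show ?case
    using 0 IH(2) regular_mult[OF E N(1)] by auto
qed

lemma Delta_factors:
  assumes Z: "smooth_list (length (Delta n)) Z"
  shows "prod_form (braid_factors (Delta n) Z) = 0"
    and "regular (\<lambda>q. Lc n (Z q))" "\<And>q. q \<in> S \<Longrightarrow> lower_unitriangular (Lc n (Z q))"
proof -
  have "bij_betw id {..<n} {..<n}" by simp
  from reduced_braid_factors[OF braid_word_Delta Z this Delta_reduced(1)]
  obtain N where 0: "prod_form (braid_factors (Delta n) Z) = 0" and N: "regular N"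
    and N': "\<And>q. q \<in> S \<Longrightarrow> lower_unitriangular (N q)"
      "\<And>q. q \<in> S \<Longrightarrow> perm_mat n id * mprod (braid_factors (Delta n) Z) q =
        N q * perm_mat n (word_perm id (Delta n))"
    by blast
  show "prod_form (braid_factors (Delta n) Z) = 0" by (rule 0)
  have P: "perm_mat n (word_perm id (Delta n)) = perm_mat n (w0 n)"
    by (rule perm_mat_cong) (rule Delta_reduced(2))
  have id: "perm_mat n id = 1\<^sub>m n" by (rule eq_matI) (auto simp: perm_mat_def)
  have w: "w0 n k < n" if "k < n" for k using that by (auto simp: w0_def)
  have ww: "perm_mat n (w0 n) * perm_mat n (w0 n) = 1\<^sub>m n"
    by (subst perm_mat_mult, erule w, subst id[symmetric], rule perm_mat_cong) (auto simp: w0_def)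
  have L: "Lc n (Z q) = N q" if q: "q \<in> S" for q
  proof -
    have "braid_mat n (Delta n) (Z q) = N q * perm_mat n (w0 n)"
      using N'(2)[OF q] mprod_braid_factors[OF q, of Z "Delta n"] Z q
      by (simp add: P id smooth_list_def left_mult_one_mat[OF braid_mat_carrier])
    then have "Lc n (Z q) = N q * (perm_mat n (w0 n) * perm_mat n (w0 n))"
      unfolding Lc_def using regularD(2)[OF N q] by (simp add: assoc_mult_mat[of _ n n _ n _ n])
    then show ?thesis unfolding ww using regularD(2)[OF N q] by simp
  qed
  show "regular (\<lambda>q. Lc n (Z q))" using N regular_cong[OF L] by simp
  show "lower_unitriangular (Lc n (Z q))" if "q \<in> S" for q using L N' that by simp
qed

end

section \<open>The word form along two curves\<close>

context curve_pair
begin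

lemma equiv_factors_cong:
  assumes "list_all2 (\<lambda>F G. regular F \<and> (\<forall>q\<in>S. F q = G q)) Fs Gs"
  shows "equiv_factors Fs Gs"
  using assms
proof (induction rule: list_all2_induct)
  case Nil
  then show ?case by (simp add: equiv_factors_def)
next
  case (Cons F Fs G Gs)
  have "regular G" using Cons regular_cong[of F G] by blast
  moreover have "form F (mprod Fs) = form G (mprod Gs)"
    using Cons by (intro form_cong) (auto simp: equiv_factors_def)
  ultimately show ?case using Cons by (auto simp: equiv_factors_def)
qed

lemma braid_factors_cong:
  assumes "is_braid_word n \<beta>" "smooth_list (length \<beta>) Z" "\<And>q. q \<in> S \<Longrightarrow> Z q = Z' q"
  shows "equiv_factors (braid_factors \<beta> Z) (braid_factors \<beta> Z')"
proof (rule equiv_factors_cong)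
  show "list_all2 (\<lambda>F G. regular F \<and> (\<forall>q\<in>S. F q = G q)) (braid_factors \<beta> Z) (braid_factors \<beta> Z')"
    using assms
    by (induction \<beta> arbitrary: Z Z') (auto simp: smooth_list_Suc is_braid_word_def regular_braid_gen)
qed

lemma const_factors:
  assumes "\<forall>F\<in>set Ks. \<exists>K. unit_mat n K \<and> (\<forall>q\<in>S. F q = K)"
  shows "all_regular Ks \<and> (\<exists>K. unit_mat n K \<and> (\<forall>q\<in>S. mprod Ks q = K)) \<and> prod_form Ks = 0"
  using assms
proof (induction Ks)
  case Nil
  then show ?case by (auto intro!: exI[of _ "1\<^sub>m n"])
next
  case (Cons F Ks)
  obtain K K' where K: "unit_mat n K" "\<And>q. q \<in> S \<Longrightarrow> F q = K"
    and K': "unit_mat n K'" "\<And>q. q \<in> S \<Longrightarrow> mprod Ks q = K'"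
    using Cons by auto
  have "regular F" using regular_cong[of F "\<lambda>_. K"] K regular_const by blast
  moreover have "form F (mprod Ks) = form (\<lambda>_. K) (\<lambda>_. K')"
    using K K' by (intro form_cong) auto
  then have "form F (mprod Ks) = 0" using K K' by (simp add: regular_const)
  moreover have "unit_mat n (K * K')" using K K' by simp
  ultimately show ?case using Cons K K' by (auto intro!: exI[of _ "K * K'"])
qed

lemma prod_form_append_const:
  assumes "all_regular Fs" "\<forall>F\<in>set Ks. \<exists>K. unit_mat n K \<and> (\<forall>q\<in>S. F q = K)"
  shows "prod_form (Fs @ Ks) = prod_form Fs"
proof -
  obtain K where K: "all_regular Ks" "unit_mat n K" "\<And>q. q \<in> S \<Longrightarrow> mprod Ks q = K" "prod_form Ks = 0"
    using const_factors[OF assms(2)] by blast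
  have "form (mprod Fs) (mprod Ks) = form (mprod Fs) (\<lambda>_. K)"
    using K by (intro form_cong) auto
  then show ?thesis using prod_form_append[OF assms(1) K(1)] K regular_mprod[OF assms(1)] by simp
qed

lemma braid_factors_zero:
  assumes "is_braid_word n \<beta>" "\<And>q. q \<in> S \<Longrightarrow> Z q = replicate (length \<beta>) 0"
  shows "\<forall>F\<in>set (braid_factors \<beta> Z). \<exists>K. unit_mat n K \<and> (\<forall>q\<in>S. F q = K)"
  using assms
proof (induction \<beta> arbitrary: Z)
  case (Cons j \<beta>)
  have "\<forall>F\<in>set (braid_factors \<beta> (\<lambda>q. tl (Z q))). \<exists>K. unit_mat n K \<and> (\<forall>q\<in>S. F q = K)"
    using Cons.prems by (intro Cons.IH) (auto simp: is_braid_word_def)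
  then show ?case
    using Cons.prems by (auto simp: is_braid_word_def intro!: exI[of _ "braid_gen n j 0"])
qed simp

lemma dmat_braid_gen_cong:
  assumes "deriv (\<lambda>t. x (\<gamma> t)) 0 = deriv (\<lambda>t. x (\<delta> t)) 0"
  shows "dmat \<gamma> (\<lambda>q. braid_gen n j (x q)) = dmat \<delta> (\<lambda>q. braid_gen n j (x q))"
proof (rule eq_matI, goal_cases)
  case (1 r s)
  then have rs: "r < n" "s < n" by (auto simp: dmat_def)
  have "braid_gen n j z $$ (r, s) = (if r = Suc j \<and> s = Suc j then z else braid_gen n j 0 $$ (r, s))" for z
    using rs by (auto simp: braid_gen_def block_gen_def)
  then have "(\<lambda>t. braid_gen n j (x (c t)) $$ (r, s)) =
    (\<lambda>t. if r = Suc j \<and> s = Suc j then x (c t) else braid_gen n j 0 $$ (r, s))" for c :: "complex \<Rightarrow> 'p"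
    by (intro ext)
  then show ?case using rs assms by (cases "r = Suc j \<and> s = Suc j") (simp_all add: dmat_def)
qed (auto simp: dmat_def)

text \<open>By the product rule only the values and the derivatives of the variables enter.\<close>

lemma dmat_braid_factors_cong:
  assumes "is_braid_word n \<beta>" "smooth_list (length \<beta>) Z"
    and "\<And>k. k < length \<beta> \<Longrightarrow> deriv (\<lambda>t. Z (\<gamma> t) ! k) 0 = deriv (\<lambda>t. Z (\<delta> t) ! k) 0"
  shows "dmat \<gamma> (mprod (braid_factors \<beta> Z)) = dmat \<delta> (mprod (braid_factors \<beta> Z))"
  using assms
proof (induction \<beta> arbitrary: Z)
  case Nil
  then show ?case by (simp add: mprod_Nil)
next
  case (Cons j \<beta>)
  have j: "Suc j < n" and \<beta>: "is_braid_word n \<beta>" using Cons by (auto simp: is_braid_word_def)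
  have Z: "\<And>q. q \<in> S \<Longrightarrow> Z q \<noteq> []" and x: "smooth (\<lambda>q. hd (Z q))"
    and Zt: "smooth_list (length \<beta>) (\<lambda>q. tl (Z q))"
    using Cons.prems(2) by (auto simp: smooth_list_Suc)
  have hd: "deriv (\<lambda>t. hd (Z (c t))) 0 = deriv (\<lambda>t. Z (c t) ! 0) 0" if "c \<in> {\<gamma>, \<delta>}" for c
    by (rule along_cong(2)[OF that, of "\<lambda>q. hd (Z q)"]) (simp add: Z hd_conv_nth)
  have tl: "deriv (\<lambda>t. tl (Z (c t)) ! k) 0 = deriv (\<lambda>t. Z (c t) ! Suc k) 0" if "c \<in> {\<gamma>, \<delta>}" for c k
  proof (rule along_cong(2)[OF that, of "\<lambda>q. tl (Z q) ! k"])
    fix q assume "q \<in> S"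
    then show "tl (Z q) ! k = Z q ! Suc k" using Z[of q] by (cases "Z q") auto
  qed
  have 1: "dmat \<gamma> (\<lambda>q. braid_gen n j (hd (Z q))) = dmat \<delta> (\<lambda>q. braid_gen n j (hd (Z q)))"
    using Cons.prems(3)[of 0] hd by (intro dmat_braid_gen_cong) auto
  have 2: "dmat \<gamma> (mprod (braid_factors \<beta> (\<lambda>q. tl (Z q)))) = dmat \<delta> (mprod (braid_factors \<beta> (\<lambda>q. tl (Z q))))"
    using Cons.prems(3) tl by (intro Cons.IH \<beta> Zt) auto
  show ?case
    using dmat_mult[OF regular_braid_gen[OF j x] regular_mprod[OF regular_braid_factors[OF \<beta> Zt]], of \<gamma>]
      dmat_mult[OF regular_braid_gen[OF j x] regular_mprod[OF regular_braid_factors[OF \<beta> Zt]], of \<delta>] 1 2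
    by (simp add: mprod_Cons)
qed

lemma take_braid_factors:
  "take k (braid_factors \<beta> Z) = braid_factors (take k \<beta>) (\<lambda>q. take k (Z q))"
proof (cases "k \<le> length \<beta>")
  case True
  then show ?thesis
    using braid_factors_append[of "take k \<beta>" "drop k \<beta>" Z] by simp
next
  case False
  have "braid_factors \<beta> Z = braid_factors \<beta> (\<lambda>q. take k (Z q))" if "length \<beta> \<le> k" for k Z
    using that
  proof (induction \<beta> arbitrary: Z k)
    case (Cons j \<beta>)
    then obtain l where k: "k = Suc l" "length \<beta> \<le> l" by (cases k) auto
    have "hd (take (Suc l) (Z q)) = hd (Z q)" "tl (take (Suc l) (Z q)) = take l (tl (Z q))" for q
      by (cases "Z q"; simp)+
    then show ?case using Cons.IH[OF k(2), of "\<lambda>q. tl (Z q)"] by (simp add: k)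
  qed simp
  then show ?thesis using False by simp
qed

lemma nth_braid_factors:
  assumes "k < length \<beta>" "length (Z q) = length \<beta>"
  shows "(braid_factors \<beta> Z ! k) q = braid_gen n (\<beta> ! k) (Z q ! k)"
  using assms
proof (induction \<beta> arbitrary: Z k)
  case (Cons j \<beta>)
  then show ?case by (cases k; cases "Z q") auto
qed simp

end

text \<open>The differentials in the 2-form are taken along the straight line with a given velocity, but
  those of the chart along a curve with that velocity.  The line and the curve form a
  \<open>curve_pair\<close> in the space of all lists of the right length, so
  \<open>dmat_braid_factors_cong\<close> and \<open>dmat_braid_gen_cong\<close> compare the differentials along them.\<close>

lemma mat_diff_velocity:
  assumes \<eta>: "is_braid_word n \<eta>" and c0: "length (c 0) = length \<eta>"
    and near: "\<forall>\<^sub>F t in nhds 0. length (c t) = length \<eta>"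
    and diff: "\<And>k. k < length \<eta> \<Longrightarrow> (\<lambda>t. c t ! k) field_differentiable at 0"
  shows "k \<le> length \<eta> \<Longrightarrow> mat_diff n (\<lambda>z. braid_mat n (take k \<eta>) (take k z)) (c 0) (velocity c) =
      mat n n (\<lambda>ij. deriv (\<lambda>t. braid_mat n (take k \<eta>) (take k (c t)) $$ ij) 0)"
    and "k < length \<eta> \<Longrightarrow> mat_diff n (\<lambda>z. braid_gen n (\<eta> ! k) (z ! k)) (c 0) (velocity c) =
      mat n n (\<lambda>ij. deriv (\<lambda>t. braid_gen n (\<eta> ! k) (c t ! k) $$ ij) 0)"
proof -
  define l where "l t = map2 (\<lambda>a b. a + t * b) (c 0) (velocity c)" for t
  have len: "length (velocity c) = length \<eta>" using c0 by (simp add: velocity_def)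
  have l0: "l 0 = c 0" by (rule nth_equalityI) (simp_all add: l_def len c0)
  have ll: "length (l t) = length \<eta>" for t by (simp add: l_def len c0)
  have lk: "(\<lambda>t. l t ! k) = (\<lambda>t. c 0 ! k + t * velocity c ! k)" if "k < length \<eta>" for k
    using that by (auto simp: l_def len c0)
  have ld: "((\<lambda>t. l t ! k) has_field_derivative velocity c ! k) (at 0)" if "k < length \<eta>" for k
    unfolding lk[OF that] by (auto intro!: derivative_eq_intros)
  have vk: "velocity c ! k = deriv (\<lambda>t. c t ! k) 0" if "k < length \<eta>" for k
    using that c0 by (simp add: velocity_def)
  interpret C: curve_pair n "{q :: complex list. length q = length \<eta>}" l c "c 0"
    using l0 ll near c0 by unfold_locales auto
  have smooth: "C.smooth (\<lambda>q. q ! k)" if "k < length \<eta>" for k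
    using diff[OF that] ld[OF that] by (auto simp: C.smooth_def field_differentiable_def)
  have dl: "mat_diff n f (c 0) (velocity c) = C.dmat l f" for f
    by (simp add: mat_diff_def C.dmat_def l_def)
  have deq: "deriv (\<lambda>t. l t ! k) 0 = deriv (\<lambda>t. c t ! k) 0" if "k < length \<eta>" for k
    using DERIV_imp_deriv[OF ld[OF that]] vk[OF that] by simp
  {
    assume k: "k \<le> length \<eta>"
    let ?F = "C.mprod (C.braid_factors (take k \<eta>) (\<lambda>q. take k q))"
    have "C.dmat l ?F = C.dmat c ?F"
    proof (rule C.dmat_braid_factors_cong)
      show "is_braid_word n (take k \<eta>)" using \<eta> set_take_subset[of k \<eta>] by (auto simp: is_braid_word_def)
      show "C.smooth_list (length (take k \<eta>)) (take k)"
        using k smooth by (auto simp: C.smooth_list_def)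
    qed (use k deq in auto)
    moreover have "C.dmat d (\<lambda>z. braid_mat n (take k \<eta>) (take k z)) = C.dmat d ?F" if "d \<in> {l, c}" for d
      using that k by (intro C.dmat_cong) (auto simp: C.mprod_braid_factors)
    ultimately show "mat_diff n (\<lambda>z. braid_mat n (take k \<eta>) (take k z)) (c 0) (velocity c) =
      mat n n (\<lambda>ij. deriv (\<lambda>t. braid_mat n (take k \<eta>) (take k (c t)) $$ ij) 0)"
      by (simp add: dl) (simp add: C.dmat_def case_prod_beta')
  next
    assume k: "k < length \<eta>"
    show "mat_diff n (\<lambda>z. braid_gen n (\<eta> ! k) (z ! k)) (c 0) (velocity c) =
      mat n n (\<lambda>ij. deriv (\<lambda>t. braid_gen n (\<eta> ! k) (c t ! k) $$ ij) 0)"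
      using C.dmat_braid_gen_cong[of "\<lambda>q. q ! k" "\<eta> ! k", OF deq[OF k]]
      by (simp add: dl) (simp add: C.dmat_def case_prod_beta')
  }
qed

lemma (in curve_pair) braid_form_eq_prod_form:
  assumes \<eta>: "is_braid_word n \<eta>" and Z: "smooth_list (length \<eta>) Z"
  shows "braid_form n \<eta> (Z p) (velocity (\<lambda>t. Z (\<gamma> t))) (velocity (\<lambda>t. Z (\<delta> t))) =
    prod_form (braid_factors \<eta> Z)"
proof -
  have regular: "all_regular (braid_factors \<eta> Z)" by (rule regular_braid_factors[OF \<eta> Z])
  have vel: "k \<le> length \<eta> \<Longrightarrow> mat_diff n (\<lambda>z. braid_mat n (take k \<eta>) (take k z)) (Z p) (velocity (\<lambda>t. Z (c t))) =
      dmat c (mprod (take k (braid_factors \<eta> Z)))" (is "_ \<Longrightarrow> ?A")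
    "k < length \<eta> \<Longrightarrow> mat_diff n (\<lambda>z. braid_gen n (\<eta> ! k) (z ! k)) (Z p) (velocity (\<lambda>t. Z (c t))) =
      dmat c (braid_factors \<eta> Z ! k)" (is "_ \<Longrightarrow> ?B") if c: "c \<in> {\<gamma>, \<delta>}" for c k
  proof -
    have len: "\<forall>\<^sub>F t in nhds 0. length (Z (c t)) = length \<eta>"
      using near[OF c] Z by (auto simp: smooth_list_def elim: eventually_mono)
    have "length (Z (c 0)) = length \<eta>" using Z p_in base[OF c] by (simp add: smooth_list_def)
    moreover have "(\<lambda>t. Z (c t) ! k) field_differentiable at 0" if "k < length \<eta>" for k
      using Z that c by (auto simp: smooth_list_def smooth_def)
    ultimately have m: "k \<le> length \<eta> \<Longrightarrow> mat_diff n (\<lambda>z. braid_mat n (take k \<eta>) (take k z)) (Z p) (velocity (\<lambda>t. Z (c t))) =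
      dmat c (\<lambda>q. braid_mat n (take k \<eta>) (take k (Z q)))"
      "k < length \<eta> \<Longrightarrow> mat_diff n (\<lambda>z. braid_gen n (\<eta> ! k) (z ! k)) (Z p) (velocity (\<lambda>t. Z (c t))) =
      dmat c (\<lambda>q. braid_gen n (\<eta> ! k) (Z q ! k))"
      using mat_diff_velocity[OF \<eta>, of "\<lambda>t. Z (c t)"] len base[OF c]
      by (simp_all add: dmat_def case_prod_beta')
    show ?A if "k \<le> length \<eta>"
      unfolding m(1)[OF that] take_braid_factors
      using Z that by (intro dmat_cong[OF c] mprod_braid_factors[symmetric]) (auto simp: smooth_list_def)
    show ?B if "k < length \<eta>"
      unfolding m(2)[OF that]
      using Z that by (intro dmat_cong[OF c] nth_braid_factors[symmetric]) (auto simp: smooth_list_def)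
  qed
  have "pair_form n (\<lambda>z. braid_mat n (take k \<eta>) (take k z)) (\<lambda>z. braid_gen n (\<eta> ! k) (z ! k)) (Z p)
      (velocity (\<lambda>t. Z (\<gamma> t))) (velocity (\<lambda>t. Z (\<delta> t))) =
    form (mprod (take k (braid_factors \<eta> Z))) (braid_factors \<eta> Z ! k)" if k: "k < length \<eta>" for k
  proof -
    have "mprod (take k (braid_factors \<eta> Z)) p = braid_mat n (take k \<eta>) (take k (Z p))"
      unfolding take_braid_factors using Z p_in k by (intro mprod_braid_factors) (auto simp: smooth_list_def)
    moreover have "(braid_factors \<eta> Z ! k) p = braid_gen n (\<eta> ! k) (Z p ! k)"
      using Z p_in k by (intro nth_braid_factors) (auto simp: smooth_list_def)
    ultimately show ?thesis
      using k by (simp add: pair_form_def form_def half_form_def vel)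
  qed
  then show ?thesis
    unfolding braid_form_def prod_form_left_sum[OF regular] by (intro sum.cong) auto
qed

section \<open>Opening all crossings\<close>

primrec remaining_word :: "braid_word \<Rightarrow> (nat \<Rightarrow> nat) \<Rightarrow> nat \<Rightarrow> braid_word" where
  "remaining_word \<beta> \<tau> 0 = \<beta>"
| "remaining_word \<beta> \<tau> (Suc j) =
     take (current_pos \<tau> j) (remaining_word \<beta> \<tau> j) @ drop (Suc (current_pos \<tau> j)) (remaining_word \<beta> \<tau> j)"

definition opened_vars :: "nat \<Rightarrow> braid_word \<Rightarrow> (nat \<Rightarrow> nat) \<Rightarrow> nat \<Rightarrow> complex list \<Rightarrow> complex list" where
  "opened_vars n \<beta> \<tau> j q = fst (snd (opened n \<beta> \<tau> q j))"

lemma opened_word: "fst (opened n \<beta> \<tau> q j) = remaining_word \<beta> \<tau> j"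
proof (induction j)
  case (Suc j)
  then show ?case
    by (cases "opened n \<beta> \<tau> q j") (auto simp: Let_def split: prod.splits)
qed simp

lemma opened_vars_Suc:
  "opened_vars n \<beta> \<tau> (Suc j) q = fst (snd (open_crossing n (current_pos \<tau> j)
     (remaining_word \<beta> \<tau> j, opened_vars n \<beta> \<tau> j q, snd (snd (opened n \<beta> \<tau> q j)))))"
  unfolding opened_vars_def opened_word[of n \<beta> \<tau> q, symmetric] by (simp only: opened.simps prod.collapse)

lemma chart_coord_eq: "chart_coord n \<beta> \<tau> j q = opened_vars n \<beta> \<tau> j q ! current_pos \<tau> j"
  by (simp add: chart_coord_def opened_vars_def)

text \<open>The crossings counted by \<open>current_pos \<tau> j\<close> are closed after step j as well, and exactly
  m - j - 1 crossings are.\<close>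

lemma current_pos_less:
  assumes \<tau>: "\<tau> permutes {..<m}" and j: "j < m"
  shows "current_pos \<tau> j < m - j"
proof -
  have inj: "inj_on \<tau> A" for A using permutes_inj[OF \<tau>] by (rule inj_on_subset) simp
  have less: "\<tau> k < m" if "k < m" for k using permutes_in_image[OF \<tau>, of k] that by simp
  have "\<tau> ` {..j} \<subseteq> {..<m}" using j by (auto intro: less)
  then have "card ({..<m} - \<tau> ` {..j}) = m - Suc j"
    using card_image[OF inj, of "{..j}"] by (simp add: card_Diff_subset)
  moreover have "{q. q < \<tau> j \<and> q \<notin> \<tau> ` {..<j}} \<subseteq> {..<m} - \<tau> ` {..j}"
    using less[OF j] by (auto simp: le_less)
  then have "current_pos \<tau> j \<le> card ({..<m} - \<tau> ` {..j})"
    unfolding current_pos_def by (intro card_mono) auto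
  ultimately show ?thesis using j by simp
qed

lemma remaining_word:
  assumes "\<tau> permutes {..<length \<beta>}" "is_braid_word n \<beta>" "j \<le> length \<beta>"
  shows "length (remaining_word \<beta> \<tau> j) = length \<beta> - j \<and> is_braid_word n (remaining_word \<beta> \<tau> j)"
  using assms(3)
proof (induction j)
  case (Suc j)
  let ?r = "current_pos \<tau> j" and ?w = "remaining_word \<beta> \<tau> j"
  have "?r < length ?w" using Suc current_pos_less[OF assms(1), of j] by simp
  then show ?case
    using Suc set_take_subset[of ?r ?w] set_drop_subset[of "Suc ?r" ?w]
    by (auto simp: is_braid_word_def)
qed (use assms in simp)

lemma braid_mat_append:
  "length z = length \<beta> \<Longrightarrow> braid_mat n (\<beta> @ \<beta>') (z @ z') = braid_mat n \<beta> z * braid_mat n \<beta>' z'"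
proof (induction n \<beta> z rule: braid_mat.induct)
  case (1 n i \<beta> x z)
  then show ?case
    by (simp add: assoc_mult_mat[OF braid_gen_carrier braid_mat_carrier braid_mat_carrier])
qed (auto simp: left_mult_one_mat[OF braid_mat_carrier])

text \<open>Up to sign the i-th diagonal entry of the matrix \<open>V\<^sub>s\<close> split off in step s is a power of
  \<open>x\<^sub>s\<close>, and this is its exponent.\<close>

definition chart_exponent :: "braid_word \<Rightarrow> (nat \<Rightarrow> nat) \<Rightarrow> nat \<Rightarrow> nat \<Rightarrow> complex" where
  "chart_exponent \<beta> \<tau> s i = of_int (opened_exponent (remaining_word \<beta> \<tau> s) (current_pos \<tau> s) i)"

text \<open>The coefficients with which the form pairs the diagonals of \<open>V\<^sub>s\<close> and \<open>V\<^sub>k\<close>.\<close>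

definition chart_coefficient :: "nat \<Rightarrow> braid_word \<Rightarrow> (nat \<Rightarrow> nat) \<Rightarrow> nat \<Rightarrow> nat \<Rightarrow> complex" where
  "chart_coefficient n \<beta> \<tau> s k = (\<Sum>i<n. chart_exponent \<beta> \<tau> s i * chart_exponent \<beta> \<tau> k i)"

locale chart_curves = curve_pair n "toric_chart n \<beta> \<tau>" \<gamma> \<delta> p
  for n :: nat and \<beta> :: braid_word and \<tau> :: "nat \<Rightarrow> nat" and \<gamma> \<delta> p +
  assumes word: "is_braid_word n \<beta>" and perm: "\<tau> permutes {..<length \<beta>}"
    and smooth_id: "smooth_list (length \<beta> + length (Delta n)) (\<lambda>q. q)"
begin

abbreviation "chart \<equiv> toric_chart n \<beta> \<tau>"
abbreviation "rem_word \<equiv> remaining_word \<beta> \<tau>"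
abbreviation "rem_vars \<equiv> opened_vars n \<beta> \<tau>"
abbreviation "rem_factors j \<equiv> braid_factors (rem_word j) (rem_vars j)"
abbreviation "dlog_coord c s \<equiv> log_deriv c (chart_coord n \<beta> \<tau> s)"

lemma open_step:
  assumes j: "j < length \<beta>" and Z: "smooth_list (length (rem_word j)) (rem_vars j)"
    and M: "regular M" "\<And>q. q \<in> chart \<Longrightarrow> lower_unitriangular (M q)"
  obtains V M' where "smooth_list (length (rem_word (Suc j))) (rem_vars (Suc j))"
    "regular V" "\<And>q. q \<in> chart \<Longrightarrow> upper_triangular (V q)"
    "\<And>c i. c \<in> {\<gamma>, \<delta>} \<Longrightarrow> i < n \<Longrightarrow>
      log_deriv c (\<lambda>q. V q $$ (i, i)) = chart_exponent \<beta> \<tau> j i * dlog_coord c j"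
    "regular M'" "\<And>q. q \<in> chart \<Longrightarrow> lower_unitriangular (M' q)"
    "equiv_factors (rem_factors j @ [M]) (V # rem_factors (Suc j) @ [M'])"
proof (rule open_crossing_equiv[OF _ _ Z _ M opened_vars_Suc])
  show "is_braid_word n (rem_word j)" and "current_pos \<tau> j < length (rem_word j)"
    using remaining_word[OF perm word, of j] j current_pos_less[OF perm j] by auto
  show "rem_vars j q ! current_pos \<tau> j \<noteq> 0" if "q \<in> chart" for q
    using that j by (simp add: toric_chart_def chart_coord_eq[symmetric])
next
  fix V M'
  assume "smooth_list (length (take (current_pos \<tau> j) (rem_word j) @ drop (Suc (current_pos \<tau> j)) (rem_word j))) (rem_vars (Suc j))"
    "regular V" "\<And>q. q \<in> chart \<Longrightarrow> upper_triangular (V q)"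
    "\<And>d k. d \<in> {\<gamma>, \<delta>} \<Longrightarrow> k < n \<Longrightarrow> log_deriv d (\<lambda>q. V q $$ (k, k)) =
      of_int (opened_exponent (rem_word j) (current_pos \<tau> j) k) * log_deriv d (\<lambda>q. rem_vars j q ! current_pos \<tau> j)"
    "regular M'" "\<And>q. q \<in> chart \<Longrightarrow> lower_unitriangular (M' q)"
    "equiv_factors (rem_factors j @ [M]) (V # braid_factors (take (current_pos \<tau> j) (rem_word j) @
      drop (Suc (current_pos \<tau> j)) (rem_word j)) (rem_vars (Suc j)) @ [M'])"
  then show thesis
    by (intro that[of V M']) (simp_all add: chart_exponent_def chart_coord_eq[abs_def])
qed

lemma smooth_rem_vars:
  "j \<le> length \<beta> \<Longrightarrow> smooth_list (length (rem_word j)) (rem_vars j)"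
proof (induction j)
  case 0
  then show ?case
    using smooth_list_take[OF smooth_id, of "length \<beta>"] by (simp add: opened_vars_def)
next
  case (Suc j)
  then show ?case
    using open_step[of j "\<lambda>_. 1\<^sub>m n"] regular_const by (auto simp del: remaining_word.simps)
qed

lemma regular_rem_factors: "j \<le> length \<beta> \<Longrightarrow> all_regular (rem_factors j)"
  using regular_braid_factors smooth_rem_vars remaining_word[OF perm word] by blast

text \<open>Downward induction on the number j of opened crossings.  Step j splits a matrix \<open>V\<^sub>j\<close> off on the
  left, and the form of \<open>V\<^sub>j\<close> times the remaining product R is the pairing \<open>(V\<^sub>j | R)\<close> plus the form of
  R.  Both are upper-triangular, so the pairing only needs the logarithmic derivatives of the
  diagonal of R, and these are carried along in the induction.  When no crossing is left, R is both
  lower unitriangular and upper-triangular, hence the identity.\<close>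

lemma tail_form:
  assumes "j \<le> length \<beta>" "regular M" "\<And>q. q \<in> chart \<Longrightarrow> lower_unitriangular (M q)"
    and "\<And>q. q \<in> chart \<Longrightarrow> upper_triangular (mprod (rem_factors j @ [M]) q)"
  shows "prod_form (rem_factors j @ [M]) = (\<Sum>s\<in>{j..<length \<beta>}. \<Sum>k\<in>{Suc s..<length \<beta>}.
      chart_coefficient n \<beta> \<tau> s k *
        (dlog_coord \<gamma> s * dlog_coord \<delta> k - dlog_coord \<delta> s * dlog_coord \<gamma> k)) \<and>
    (\<forall>c\<in>{\<gamma>, \<delta>}. \<forall>i<n. log_deriv c (\<lambda>q. mprod (rem_factors j @ [M]) q $$ (i, i)) =
      (\<Sum>s\<in>{j..<length \<beta>}. chart_exponent \<beta> \<tau> s i * dlog_coord c s))"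
  using assms
proof (induction arbitrary: M rule: inc_induct)
  case base
  have w: "rem_word (length \<beta>) = []" using remaining_word[OF perm word, of "length \<beta>"] by simp
  have m: "mprod (rem_factors (length \<beta>) @ [M]) q = 1\<^sub>m n" if q: "q \<in> chart" for q
  proof -
    note c = regularD(2)[OF base(1) q]
    have "upper_triangular (M q)" using base(3)[OF q] c by (simp add: w)
    then show ?thesis using upper_and_lower_unitriangular[OF base(2)[OF q] _ c] c by (simp add: w)
  qed
  have "log_deriv c (\<lambda>q. mprod (rem_factors (length \<beta>) @ [M]) q $$ (i, i)) = 0"
    if "c \<in> {\<gamma>, \<delta>}" "i < n" for c i
    using m that by (intro log_deriv_const[of _ _ 1]) auto
  moreover have "prod_form (rem_factors (length \<beta>) @ [M]) = 0"
    using base(1) by (simp add: w mprod_Nil)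
  ultimately show ?case by simp
next
  case (step j)
  obtain V M' where V: "regular V" "\<And>q. q \<in> chart \<Longrightarrow> upper_triangular (V q)"
    and Vd: "\<And>c i. c \<in> {\<gamma>, \<delta>} \<Longrightarrow> i < n \<Longrightarrow>
      log_deriv c (\<lambda>q. V q $$ (i, i)) = chart_exponent \<beta> \<tau> j i * dlog_coord c j"
    and M': "regular M'" "\<And>q. q \<in> chart \<Longrightarrow> lower_unitriangular (M' q)"
    and eq: "equiv_factors (rem_factors j @ [M]) (V # rem_factors (Suc j) @ [M'])"
    using open_step[OF step(2) smooth_rem_vars step(4,5)] step(2) by (metis less_imp_le)
  define R where "R = mprod (rem_factors (Suc j) @ [M'])"
  have R: "regular R"
    unfolding R_def using regular_rem_factors[of "Suc j"] step(2) M' by (intro regular_mprod) auto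
  have VR: "mprod (rem_factors j @ [M]) q = V q * R q" if "q \<in> chart" for q
    using eq that by (simp add: equiv_factors_def R_def)
  have Ru: "upper_triangular (R q)" if q: "q \<in> chart" for q
  proof -
    note u = regularD(1)[OF V(1) q] and c = regularD(2)[OF V(1) q] regularD(2)[OF R q]
    have "R q = mat_inv (V q) * mprod (rem_factors j @ [M]) q"
      using unit_mat_cancel_left[OF u c(2) square_mat_mult_carrier[OF c]] VR[OF q] by simp
    then show ?thesis
      using upper_triangular_mult[OF upper_triangular_inv(1)[OF V(2)[OF q] u] step(6)[OF q] unit_matD(2)[OF u]]
        VR[OF q] c by simp
  qed
  have IH: "prod_form (rem_factors (Suc j) @ [M']) = (\<Sum>s\<in>{Suc j..<length \<beta>}. \<Sum>k\<in>{Suc s..<length \<beta>}.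
      chart_coefficient n \<beta> \<tau> s k *
        (dlog_coord \<gamma> s * dlog_coord \<delta> k - dlog_coord \<delta> s * dlog_coord \<gamma> k))"
    "\<And>c i. c \<in> {\<gamma>, \<delta>} \<Longrightarrow> i < n \<Longrightarrow> log_deriv c (\<lambda>q. R q $$ (i, i)) =
      (\<Sum>s\<in>{Suc j..<length \<beta>}. chart_exponent \<beta> \<tau> s i * dlog_coord c s)"
    using step(3)[OF M' Ru[unfolded R_def]] by (auto simp: R_def)
  have ld: "log_deriv c (\<lambda>q. mprod (rem_factors j @ [M]) q $$ (i, i)) =
      (\<Sum>s\<in>{j..<length \<beta>}. chart_exponent \<beta> \<tau> s i * dlog_coord c s)"
    if c: "c \<in> {\<gamma>, \<delta>}" and i: "i < n" for c i
  proof -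
    have "log_deriv c (\<lambda>q. mprod (rem_factors j @ [M]) q $$ (i, i)) =
      log_deriv c (\<lambda>q. V q $$ (i, i) * R q $$ (i, i))"
    proof (rule log_deriv_cong[OF c])
      fix q assume q: "q \<in> chart"
      show "mprod (rem_factors j @ [M]) q $$ (i, i) = V q $$ (i, i) * R q $$ (i, i)"
        unfolding VR[OF q]
        by (rule upper_triangular_mult_diag[OF V(2)[OF q] Ru[OF q] regularD(2)[OF V(1) q] regularD(2)[OF R q] i])
    qed
    also have "\<dots> = log_deriv c (\<lambda>q. V q $$ (i, i)) + log_deriv c (\<lambda>q. R q $$ (i, i))"
      using upper_triangular_inv(2)[OF V(2)[OF p_in] regularD(1)[OF V(1) p_in] i]
        upper_triangular_inv(2)[OF Ru[OF p_in] regularD(1)[OF R p_in] i]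
        regularD(3)[OF V(1) i i] regularD(3)[OF R i i] by (intro log_deriv_mult[OF c]) auto
    also have "\<dots> = (\<Sum>s\<in>{j..<length \<beta>}. chart_exponent \<beta> \<tau> s i * dlog_coord c s)"
      using Vd[OF c i] IH(2)[OF c i] step(2) by (simp add: sum.atLeast_Suc_lessThan)
    finally show ?thesis .
  qed
  have "form V R = (\<Sum>i<n.
      log_deriv \<gamma> (\<lambda>q. V q $$ (i, i)) * log_deriv \<delta> (\<lambda>q. R q $$ (i, i))
    - log_deriv \<delta> (\<lambda>q. V q $$ (i, i)) * log_deriv \<gamma> (\<lambda>q. R q $$ (i, i)))"
    by (rule form_upper_triangular[OF V R Ru])
  also have "\<dots> = (\<Sum>i<n. \<Sum>k\<in>{Suc j..<length \<beta>}. chart_exponent \<beta> \<tau> j i * chart_exponent \<beta> \<tau> k i *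
      (dlog_coord \<gamma> j * dlog_coord \<delta> k - dlog_coord \<delta> j * dlog_coord \<gamma> k))"
    using Vd IH(2) by (intro sum.cong refl)
      (simp add: sum_distrib_left sum_subtractf[symmetric] algebra_simps)
  also have "\<dots> = (\<Sum>k\<in>{Suc j..<length \<beta>}. chart_coefficient n \<beta> \<tau> j k *
        (dlog_coord \<gamma> j * dlog_coord \<delta> k - dlog_coord \<delta> j * dlog_coord \<gamma> k))"
    by (subst sum.swap) (simp add: chart_coefficient_def sum_distrib_right)
  finally have "prod_form (rem_factors j @ [M]) = (\<Sum>s\<in>{j..<length \<beta>}. \<Sum>k\<in>{Suc s..<length \<beta>}.
      chart_coefficient n \<beta> \<tau> s k *
        (dlog_coord \<gamma> s * dlog_coord \<delta> k - dlog_coord \<delta> s * dlog_coord \<gamma> k))"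
    using eq IH(1) step(2) by (simp add: equiv_factors_def R_def sum.atLeast_Suc_lessThan)
  then show ?case using ld by blast
qed

text \<open>The last half twist is constant on the chart.  The factors of the other one have form 0, like
  the single factor \<open>Lc n c\<close>, which is their product up to a constant permutation matrix.\<close>

lemma embedded_form:
  "prod_form (braid_factors (\<beta> @ Delta n @ Delta n) (embed_pt n)) =
     prod_form (rem_factors 0 @ [\<lambda>q. Lc n (drop (length \<beta>) q)])"
proof -
  let ?m = "length (Delta n)" and ?l = "length \<beta>" and ?E = "embed_pt n"
  let ?D = "braid_factors (Delta n)" and ?P = "\<lambda>_ :: complex list. perm_mat n (w0 n)"
  have len: "length q = ?l + ?m" if "q \<in> chart" for q
    using smooth_id that by (simp add: smooth_list_def)
  have Z: "smooth_list ?l (\<lambda>q. take ?l q)" "smooth_list ?m (\<lambda>q. drop ?l q)"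
    using smooth_list_take[OF smooth_id, of ?l] smooth_list_drop[OF smooth_id, of ?l] by auto
  have v0: "rem_vars 0 = take ?l" by (rule ext) (simp add: opened_vars_def)
  have parts: "take ?l (?E q) = take ?l q" "take ?m (drop ?l (?E q)) = drop ?l q"
    "drop ?m (drop ?l (?E q)) = replicate ?m 0" if "q \<in> chart" for q
    using len[OF that] by (auto simp: embed_pt_def)
  have E1: "equiv_factors (braid_factors \<beta> (\<lambda>q. take ?l q)) (braid_factors \<beta> (\<lambda>q. take ?l (?E q)))"
    by (rule braid_factors_cong[OF word Z(1)]) (simp add: parts)
  have E2: "equiv_factors (?D (drop ?l)) (?D (\<lambda>q. take ?m (drop ?l (?E q))))"
    by (rule braid_factors_cong[OF braid_word_Delta Z(2)]) (simp add: parts)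
  let ?A = "braid_factors \<beta> (take ?l)" and ?B = "?D (drop ?l)" and ?K = "?D (\<lambda>q. drop ?m (drop ?l (?E q)))"
  have K: "\<forall>F\<in>set ?K. \<exists>K. unit_mat n K \<and> (\<forall>q\<in>chart. F q = K)"
    using parts by (intro braid_factors_zero braid_word_Delta) auto
  have regular: "all_regular ?A" "all_regular ?B" "all_regular ?K"
    using E1 E2 const_factors[OF K] by (auto simp: equiv_factors_def)
  have split: "braid_factors (\<beta> @ Delta n @ Delta n) ?E =
    braid_factors \<beta> (\<lambda>q. take ?l (?E q)) @ ?D (\<lambda>q. take ?m (drop ?l (?E q))) @ ?K"
    by (simp add: braid_factors_append)
  let ?A' = "braid_factors \<beta> (\<lambda>q. take ?l (?E q))"
  have "equiv_factors ([] @ ?A @ (?B @ ?K)) ([] @ ?A' @ (?B @ ?K))"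
    using regular by (intro equiv_factors_context E1) auto
  moreover have "all_regular ?A'" using E1 unfolding equiv_factors_def by blast
  then have "equiv_factors (?A' @ ?B @ ?K) (?A' @ ?D (\<lambda>q. take ?m (drop ?l (?E q))) @ ?K)"
    using regular by (intro equiv_factors_context E2)
  ultimately have "equiv_factors (?A @ ?B @ ?K) (braid_factors (\<beta> @ Delta n @ Delta n) ?E)"
    unfolding split append_Nil by (rule equiv_factors_trans)
  then have "prod_form (braid_factors (\<beta> @ Delta n @ Delta n) ?E) = prod_form ((?A @ ?B) @ ?K)"
    by (simp add: equiv_factors_def)
  also have "\<dots> = prod_form (?A @ ?B)"
    using regular K by (intro prod_form_append_const) auto
  also have "\<dots> = prod_form ((?A @ ?B) @ [?P])"
  proof (rule prod_form_append_const[symmetric])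
    have "bij_betw (w0 n) {..<n} {..<n}"
      by (rule bij_betwI[of _ _ _ "w0 n"]) (auto simp: w0_def)
    then show "\<forall>F\<in>set [?P]. \<exists>K. unit_mat n K \<and> (\<forall>q\<in>chart. F q = K)"
      using unit_perm_mat by auto
  qed (use regular in auto)
  also have "\<dots> = prod_form (?A @ (?B @ [?P]) @ [])" by simp
  also have "\<dots> = prod_form (?A @ [\<lambda>q. Lc n (drop ?l q)] @ [])"
  proof (rule prod_form_replace)
    note L = Delta_factors[OF Z(2)]
    have bij: "bij_betw (w0 n) {..<n} {..<n}"
      by (rule bij_betwI[of _ _ _ "w0 n"]) (auto simp: w0_def)
    have P: "unit_mat n (perm_mat n (w0 n))" by (rule unit_perm_mat[OF bij])
    show "all_regular (?B @ [?P])" "all_regular [\<lambda>q. Lc n (drop ?l q)]" "all_regular ?A"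
      using regular regular_const[OF P] L by auto
    have "prod_form (?B @ [?P]) = prod_form ?B"
      using regular P by (intro prod_form_append_const) auto
    then show "prod_form (?B @ [?P]) = prod_form [\<lambda>q. Lc n (drop ?l q)]"
      using L by (simp add: mprod_Nil)
    fix q assume q: "q \<in> chart"
    have "mprod (?B @ [?P]) q = mprod ?B q * mprod [?P] q"
      using regular regular_const[OF P] q by (intro mprod_append) auto
    also have "\<dots> = Lc n (drop ?l q)"
      using q len by (simp add: mprod_braid_factors Lc_def right_mult_one_mat[OF perm_mat_carrier])
    also have "\<dots> = mprod [\<lambda>q. Lc n (drop ?l q)] q"
      using regularD(2)[OF L(2) q] by simp
    finally show "mprod (?B @ [?P]) q = mprod [\<lambda>q. Lc n (drop ?l q)] q" .
  qed simp
  finally show ?thesis by (simp add: v0)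
qed

lemma upper_start:
  assumes q: "q \<in> chart"
  shows "upper_triangular (mprod (rem_factors 0 @ [\<lambda>q. Lc n (drop (length \<beta>) q)]) q)"
proof -
  let ?l = "length \<beta>" and ?L = "\<lambda>q. Lc n (drop (length \<beta>) q)"
  have Z: "smooth_list (length (Delta n)) (\<lambda>q. drop ?l q)"
    using smooth_list_drop[OF smooth_id, of ?l] by auto
  have len: "length q = ?l + length (Delta n)"
    using smooth_id q by (simp add: smooth_list_def)
  note L = Delta_factors[OF Z]
  have "mprod (rem_factors 0 @ [?L]) q = mprod (rem_factors 0) q * mprod [?L] q"
    using regular_rem_factors[of 0] L(2) q by (intro mprod_append) auto
  also have "\<dots> = braid_mat n \<beta> (take ?l q) * Lc n (drop ?l q)"
    using q len regularD(2)[OF L(2) q] by (simp add: mprod_braid_factors opened_vars_def)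
  also have "\<dots> = braid_mat n (\<beta> @ Delta n) (take ?l q @ drop ?l q) * perm_mat n (w0 n)"
    using len by (subst braid_mat_append)
      (simp_all add: Lc_def assoc_mult_mat[OF braid_mat_carrier braid_mat_carrier perm_mat_carrier])
  finally show ?thesis using q by (simp add: toric_chart_def X0_def)
qed

theorem braid_form_on_chart:
  "braid_form n (\<beta> @ Delta n @ Delta n) (embed_pt n p)
      (velocity (\<lambda>t. embed_pt n (\<gamma> t))) (velocity (\<lambda>t. embed_pt n (\<delta> t))) =
   (\<Sum>k<length \<beta>. \<Sum>s<k. chart_coefficient n \<beta> \<tau> s k *
      (dlog_coord \<gamma> s * dlog_coord \<delta> k - dlog_coord \<delta> s * dlog_coord \<gamma> k))"
proof -
  let ?l = "length \<beta>" and ?m = "length (Delta n)"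
  have Z: "smooth_list ?m (\<lambda>q. drop ?l q)"
    using smooth_list_drop[OF smooth_id, of ?l] by auto
  have w: "is_braid_word n (\<beta> @ Delta n @ Delta n)"
    using word braid_word_Delta[of n] by (auto simp: is_braid_word_def)
  have "smooth_list (length (\<beta> @ Delta n @ Delta n)) (embed_pt n)"
    using smooth_list_append[OF smooth_id, of ?m "\<lambda>_. replicate ?m 0"]
    by (simp add: embed_pt_def[abs_def] smooth_list_def add.assoc)
  from braid_form_eq_prod_form[OF w this]
  have "braid_form n (\<beta> @ Delta n @ Delta n) (embed_pt n p)
      (velocity (\<lambda>t. embed_pt n (\<gamma> t))) (velocity (\<lambda>t. embed_pt n (\<delta> t))) =
    prod_form (rem_factors 0 @ [\<lambda>q. Lc n (drop ?l q)])"
    by (simp add: embedded_form)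
  also have "\<dots> = (\<Sum>s\<in>{0..<?l}. \<Sum>k\<in>{Suc s..<?l}. chart_coefficient n \<beta> \<tau> s k *
        (dlog_coord \<gamma> s * dlog_coord \<delta> k - dlog_coord \<delta> s * dlog_coord \<gamma> k))"
    using tail_form[of 0 "\<lambda>q. Lc n (drop ?l q)"] Delta_factors(2,3)[OF Z] upper_start by blast
  also have "\<dots> = (\<Sum>k<?l. \<Sum>s<k. chart_coefficient n \<beta> \<tau> s k *
        (dlog_coord \<gamma> s * dlog_coord \<delta> k - dlog_coord \<delta> s * dlog_coord \<gamma> k))"
    (is "_ = sum (\<lambda>k. sum (\<lambda>s. ?f s k) {..<k}) {..<?l}")
  proof -
    have "(\<Sum>s\<in>{..<?l}. \<Sum>k\<in>{k\<in>{..<?l}. s < k}. ?f s k) = (\<Sum>k\<in>{..<?l}. \<Sum>s\<in>{s\<in>{..<?l}. s < k}. ?f s k)"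
      by (rule sum.swap_restrict) auto
    moreover have "{k\<in>{..<?l}. s < k} = {Suc s..<?l}" for s by auto
    moreover have "{s\<in>{..<?l}. s < k} = {..<k}" if "k < ?l" for k using that by auto
    ultimately show ?thesis by (simp add: atLeast0LessThan)
  qed
  finally show ?thesis .
qed

end

theorem lemma3p10:
  fixes n :: nat and \<beta> :: braid_word and \<tau> :: "nat \<Rightarrow> nat"
  assumes "is_braid_word n \<beta>"
    and "\<tau> permutes {..<length \<beta>}"
  shows "\<exists>C :: nat \<Rightarrow> nat \<Rightarrow> complex.
    \<forall>p \<in> toric_chart n \<beta> \<tau>. \<forall>\<gamma> \<delta>.
      holo_curve (toric_chart n \<beta> \<tau>) p \<gamma> \<longrightarrow> holo_curve (toric_chart n \<beta> \<tau>) p \<delta> \<longrightarrow>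
      braid_form n (\<beta> @ Delta n @ Delta n) (embed_pt n p)
          (velocity (\<lambda>t. embed_pt n (\<gamma> t))) (velocity (\<lambda>t. embed_pt n (\<delta> t))) =
      (\<Sum>k<length \<beta>. \<Sum>s<k. C s k *
         (dlog (chart_coord n \<beta> \<tau> s) \<gamma> * dlog (chart_coord n \<beta> \<tau> k) \<delta>
        - dlog (chart_coord n \<beta> \<tau> s) \<delta> * dlog (chart_coord n \<beta> \<tau> k) \<gamma>))"
proof (intro exI[of _ "chart_coefficient n \<beta> \<tau>"] ballI allI impI)
  fix p \<gamma> \<delta>
  let ?S = "toric_chart n \<beta> \<tau>"
  assume p: "p \<in> ?S" and curves: "holo_curve ?S p \<gamma>" "holo_curve ?S p \<delta>"
  have len: "length q = length \<beta> + length (Delta n)" if "q \<in> ?S" for q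
    using that by (simp add: toric_chart_def X0_def)
  have near: "\<forall>\<^sub>F t in nhds 0. c t \<in> ?S" and diff: "\<And>k. k < length p \<Longrightarrow> (\<lambda>t. c t ! k) field_differentiable at 0"
    and base: "c 0 = p" if c: "c \<in> {\<gamma>, \<delta>}" for c
  proof -
    have "holo_curve ?S p c" using curves c by auto
    then obtain e where e: "e > 0" "\<And>t. t \<in> ball 0 e \<Longrightarrow> c t \<in> ?S" "c 0 = p"
      "\<And>k. k < length p \<Longrightarrow> (\<lambda>t. c t ! k) holomorphic_on ball 0 e"
      unfolding holo_curve_def by blast
    show "\<forall>\<^sub>F t in nhds 0. c t \<in> ?S"
      using e by (intro eventually_nhds_in_open[of "ball 0 e", THEN eventually_mono]) auto
    show "c 0 = p" by (rule e(3))
    show "(\<lambda>t. c t ! k) field_differentiable at 0" if "k < length p" for k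
      using holomorphic_on_imp_differentiable_at[OF e(4)[OF that]] e(1) by simp
  qed
  interpret curve_pair n ?S \<gamma> \<delta> p
    using near base p by unfold_locales
  have "smooth_list (length \<beta> + length (Delta n)) (\<lambda>q. q)"
    using len diff len[OF p] by (auto simp: smooth_list_def smooth_def)
  then interpret chart_curves n \<beta> \<tau> \<gamma> \<delta> p
    using assms by unfold_locales
  have "dlog f c = log_deriv c f" if "c \<in> {\<gamma>, \<delta>}" for c f
    using base[OF that] by (simp add: dlog_def log_deriv_def)
  then show "braid_form n (\<beta> @ Delta n @ Delta n) (embed_pt n p)
          (velocity (\<lambda>t. embed_pt n (\<gamma> t))) (velocity (\<lambda>t. embed_pt n (\<delta> t))) =
      (\<Sum>k<length \<beta>. \<Sum>s<k. chart_coefficient n \<beta> \<tau> s k *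
         (dlog (chart_coord n \<beta> \<tau> s) \<gamma> * dlog (chart_coord n \<beta> \<tau> k) \<delta>
        - dlog (chart_coord n \<beta> \<tau> s) \<delta> * dlog (chart_coord n \<beta> \<tau> k) \<gamma>))"
    using braid_form_on_chart by simp
qed

end
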